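(* Let $\mathbf{V}$ be a variety of algebras in a countable language satisfying the Construction Principle $(\mathrm{CP})$ and let $T$ be the (complete) first-order theory of the algebras in $\mathcal{F}^{\infty}_{\mathbf{V}}$. If $T$ behaves like the theory of free groups, then $T$ is not superstable.
   Context: $\mathcal{F}_{\mathbf{V}}$ is the class of free algebras in the variety $\mathbf{V}$, $\mathcal{F}^{\infty}_{\mathbf{V}}$ (resp. $\mathcal{F}^{<\infty}_{\mathbf{V}}$) the class of those of infinite (resp. finite) rank, and $F_{\mathbf{V}}(m)$ the free algebra of rank $m$. $\ast$ denotes the free product (coproduct) in $\mathbf{V}$; $A\leq B$ means $A$ is a substructure of $B$; $\langle X\rangle_B$ is the substructure of $B$ generated by $X$. For $A,B\in\mathcal{F}_{\mathbf{V}}$, $A\leq_{\ast}^{\mathrm{ff}}B$ means that there is $C\in\mathcal{F}_{\mathbf{V}}$ with $A\ast C=B$ (i.e., $A,C\leq B$ and $B$ is the internal free product of $A$ and $C$). $\preccurlyeq_{\omega,\omega}$ is the relation of elementary substructure in first-order logic. All algebras in $\mathcal{F}^{\infty}_{\mathbf{V}}$ are elementarily equivalent. Superstability of $T$ is the usual first-order notion. CP. $\mathbf{V}$ satisfies $(\mathrm{CP})$ if there are countable $A,B\in\mathcal{F}^{\infty}_{\mathbf{V}}$ with $A\leq B$ such that: (a) $A$ is freely generated by $\{a_i:i<\omega\}$ and, for every $i<\omega$, $\langle a_j:j\leq i\rangle_B\leq_{\ast}^{\mathrm{ff}}B$; (b) $A\not\leq_{\ast}^{\mathrm{ff}}B\ast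 C$ for every $C\in\mathcal{F}_{\mathbf{V}}$. $T$ behaves like the theory of free groups if: (1) there is $n_*<\omega$ such that $F_{\mathbf{V}}(m)\in\mathrm{Mod}(T)$ for every $n_*\leq m<\omega$; (2) for all $A,B\in\mathcal{F}^{<\infty}_{\mathbf{V}}\cap\mathrm{Mod}(T)$ with $A\leq_{\ast}^{\mathrm{ff}}B$ and all $b\in B$, the smallest free factor $D\in\mathrm{Mod}(T)$ of $B$ containing $Ab$ is contained in $\mathrm{acl}(Ab)$ (model-theoretic algebraic closure); (3) if $A,B\in\mathcal{F}^{<\infty}_{\mathbf{V}}$, $C\in\mathcal{F}_{\mathbf{V}}$, $A\leq B\leq C$, $A\leq_{\ast}^{\mathrm{ff}}C$ and $B\leq_{\ast}^{\mathrm{ff}}C$, then $A\leq_{\ast}^{\mathrm{ff}}B$; (4) for all $A,B\in\mathcal{F}_{\mathbf{V}}\cap\mathrm{Mod}(T)$, $A\leq_{\ast}^{\mathrm{ff}}B$ entails $A\preccurlyeq_{\omega,\omega}B$ and, if moreover $A,B\in\mathcal{F}^{<\infty}_{\mathbf{V}}$, then $A\preccurlyeq_{\omega,\omega}B$ entails $A\leq_{\ast}^{\mathrm{ff}}B$. *)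

theory Defs
  imports "HOL-Library.Countable_Set"
begin

text \<open>
  All classes of algebras and of models below consist of structures whose carriers are subsets of one
  type \<open>'u\<close>, which plays the role of the universe. Isomorphic copies are taken wherever an
  extension of a given structure may not fit inside \<open>'u\<close>: free products and elementary
  extensions are given with their embeddings. For a countable language and an infinite \<open>'u\<close>,
  free algebras on subsets of \<open>'u\<close> and free products of algebras over \<open>'u\<close> have copies over
  \<open>'u\<close>, so the universal properties below, which are tested on algebras over \<open>'u\<close>,
  determine the usual notions.
\<close>

section \<open>Algebras and first-order logic\<close>

text \<open>A language: \<open>ar f = Some n\<close> means that \<open>f\<close> is an operation symbol of arity \<open>n\<close>;
  \<open>ar f = None\<close> that \<open>f\<close> does not belong to the language, which may thus be empty.\<close>

type_synonym 'f lang = "'f \<Rightarrow> nat option"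

datatype 'f tm = Var nat | Fun 'f "'f tm list"

datatype 'f fm =
    Eq "'f tm" "'f tm"
  | Neg "'f fm"
  | Conj "'f fm" "'f fm"
  | Ex nat "'f fm"

primrec wf_tm :: "'f lang \<Rightarrow> 'f tm \<Rightarrow> bool" where
  "wf_tm ar (Var x) \<longleftrightarrow> True"
| "wf_tm ar (Fun f ts) \<longleftrightarrow> ar f = Some (length ts) \<and> list_all (wf_tm ar) ts"

primrec fv_tm :: "'f tm \<Rightarrow> nat set" where
  "fv_tm (Var x) = {x}"
| "fv_tm (Fun f ts) = \<Union> (set (map fv_tm ts))"

primrec wf_fm :: "'f lang \<Rightarrow> 'f fm \<Rightarrow> bool" where
  "wf_fm ar (Eq s t) \<longleftrightarrow> wf_tm ar s \<and> wf_tm ar t"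
| "wf_fm ar (Neg \<phi>) \<longleftrightarrow> wf_fm ar \<phi>"
| "wf_fm ar (Conj \<phi> \<psi>) \<longleftrightarrow> wf_fm ar \<phi> \<and> wf_fm ar \<psi>"
| "wf_fm ar (Ex x \<phi>) \<longleftrightarrow> wf_fm ar \<phi>"

primrec fv :: "'f fm \<Rightarrow> nat set" where
  "fv (Eq s t) = fv_tm s \<union> fv_tm t"
| "fv (Neg \<phi>) = fv \<phi>"
| "fv (Conj \<phi> \<psi>) = fv \<phi> \<union> fv \<psi>"
| "fv (Ex x \<phi>) = fv \<phi> - {x}"

record ('f, 'u) alg =
  carr :: "'u set"
  op :: "'f \<Rightarrow> 'u list \<Rightarrow> 'u"

text \<open>The carrier may be empty: in a language without constants the free algebra of rank 0 is
  the empty algebra.\<close>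

definition is_alg :: "'f lang \<Rightarrow> ('f, 'u) alg \<Rightarrow> bool" where
  "is_alg ar A \<longleftrightarrow>
     (\<forall>f xs. ar f = Some (length xs) \<and> set xs \<subseteq> carr A \<longrightarrow> op A f xs \<in> carr A)"

primrec eval_tm :: "('f, 'u) alg \<Rightarrow> (nat \<Rightarrow> 'u) \<Rightarrow> 'f tm \<Rightarrow> 'u" where
  "eval_tm A v (Var x) = v x"
| "eval_tm A v (Fun f ts) = op A f (map (eval_tm A v) ts)"

primrec sat :: "('f, 'u) alg \<Rightarrow> 'f fm \<Rightarrow> (nat \<Rightarrow> 'u) \<Rightarrow> bool" where
  "sat A (Eq s t) v \<longleftrightarrow> eval_tm A v s = eval_tm A v t"
| "sat A (Neg \<phi>) v \<longleftrightarrow> \<not> sat A \<phi> v"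
| "sat A (Conj \<phi> \<psi>) v \<longleftrightarrow> sat A \<phi> v \<and> sat A \<psi> v"
| "sat A (Ex x \<phi>) v \<longleftrightarrow> (\<exists>a \<in> carr A. sat A \<phi> (v(x := a)))"

definition sentence :: "'f lang \<Rightarrow> 'f fm \<Rightarrow> bool" where
  "sentence ar \<phi> \<longleftrightarrow> wf_fm ar \<phi> \<and> fv \<phi> = {}"

definition models :: "('f, 'u) alg \<Rightarrow> 'f fm \<Rightarrow> bool" where
  "models A \<phi> \<longleftrightarrow> (\<forall>v. sat A \<phi> v)"

definition Mod :: "'f lang \<Rightarrow> 'f fm set \<Rightarrow> ('f, 'u) alg set" where
  "Mod ar T = {A. is_alg ar A \<and> (\<forall>\<phi> \<in> T. models A \<phi>)}"

definition Th :: "'f lang \<Rightarrow> ('f, 'u) alg set \<Rightarrow> 'f fm set" where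
  "Th ar K = {\<phi>. sentence ar \<phi> \<and> (\<forall>A \<in> K. models A \<phi>)}"

definition subalg :: "'f lang \<Rightarrow> ('f, 'u) alg \<Rightarrow> ('f, 'u) alg \<Rightarrow> bool" where
  "subalg ar A B \<longleftrightarrow> is_alg ar A \<and> is_alg ar B \<and> carr A \<subseteq> carr B \<and>
     (\<forall>f xs. ar f = Some (length xs) \<and> set xs \<subseteq> carr A \<longrightarrow> op A f xs = op B f xs)"

definition gen :: "'f lang \<Rightarrow> ('f, 'u) alg \<Rightarrow> 'u set \<Rightarrow> ('f, 'u) alg" where
  "gen ar B X =
     B\<lparr>carr := \<Inter> {S. X \<subseteq> S \<and> S \<subseteq> carr B \<and> is_alg ar (B\<lparr>carr := S\<rparr>)}\<rparr>"

definition hom :: "'f lang \<Rightarrow> ('f, 'u) alg \<Rightarrow> ('f, 'u) alg \<Rightarrow> ('u \<Rightarrow> 'u) \<Rightarrow> bool" where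
  "hom ar A B h \<longleftrightarrow> h ` carr A \<subseteq> carr B \<and>
     (\<forall>f xs. ar f = Some (length xs) \<and> set xs \<subseteq> carr A \<longrightarrow>
        h (op A f xs) = op B f (map h xs))"

definition elem_embedding ::
    "'f lang \<Rightarrow> ('f, 'u) alg \<Rightarrow> ('f, 'u) alg \<Rightarrow> ('u \<Rightarrow> 'u) \<Rightarrow> bool" where
  "elem_embedding ar M N e \<longleftrightarrow> is_alg ar M \<and> is_alg ar N \<and> e ` carr M \<subseteq> carr N \<and>
     (\<forall>\<phi> v. wf_fm ar \<phi> \<and> v ` fv \<phi> \<subseteq> carr M \<longrightarrow>
        (sat M \<phi> v \<longleftrightarrow> sat N \<phi> (e \<circ> v)))"

definition elem_sub :: "'f lang \<Rightarrow> ('f, 'u) alg \<Rightarrow> ('f, 'u) alg \<Rightarrow> bool" where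
  "elem_sub ar A B \<longleftrightarrow> subalg ar A B \<and>
     (\<forall>\<phi> v. wf_fm ar \<phi> \<and> v ` fv \<phi> \<subseteq> carr A \<longrightarrow> (sat A \<phi> v \<longleftrightarrow> sat B \<phi> v))"

text \<open>\<open>acl ar M S\<close>: the variable \<open>y\<close> is the one being solved for, all other free variables
  are assigned parameters from \<open>S\<close>.\<close>

definition acl :: "'f lang \<Rightarrow> ('f, 'u) alg \<Rightarrow> 'u set \<Rightarrow> 'u set" where
  "acl ar M S = {b \<in> carr M. \<exists>\<phi> y v. wf_fm ar \<phi> \<and> v ` (fv \<phi> - {y}) \<subseteq> S \<and>
     sat M \<phi> (v(y := b)) \<and> finite {c \<in> carr M. sat M \<phi> (v(y := c))}}"

section \<open>Varieties, free algebras and free products\<close>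

definition variety :: "'f lang \<Rightarrow> ('f, 'u) alg set \<Rightarrow> bool" where
  "variety ar V \<longleftrightarrow> (\<exists>E. (\<forall>(s, t) \<in> E. wf_tm ar s \<and> wf_tm ar t) \<and>
     V = {A. is_alg ar A \<and>
            (\<forall>(s, t) \<in> E. \<forall>v. range v \<subseteq> carr A \<longrightarrow> eval_tm A v s = eval_tm A v t)})"

definition free_on ::
    "'f lang \<Rightarrow> ('f, 'u) alg set \<Rightarrow> ('f, 'u) alg \<Rightarrow> 'u set \<Rightarrow> bool" where
  "free_on ar V A X \<longleftrightarrow> A \<in> V \<and> X \<subseteq> carr A \<and>
     (\<forall>D \<in> V. \<forall>f. f ` X \<subseteq> carr D \<longrightarrow>
        (\<exists>h. hom ar A D h \<and> (\<forall>x \<in> X. h x = f x) \<and>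
           (\<forall>h'. hom ar A D h' \<and> (\<forall>x \<in> X. h' x = f x) \<longrightarrow> (\<forall>a \<in> carr A. h' a = h a))))"

definition free_algs :: "'f lang \<Rightarrow> ('f, 'u) alg set \<Rightarrow> ('f, 'u) alg set" where
  "free_algs ar V = {A. \<exists>X. free_on ar V A X}"

definition free_algs_inf :: "'f lang \<Rightarrow> ('f, 'u) alg set \<Rightarrow> ('f, 'u) alg set" where
  "free_algs_inf ar V = {A. \<exists>X. infinite X \<and> free_on ar V A X}"

definition free_algs_rank :: "'f lang \<Rightarrow> ('f, 'u) alg set \<Rightarrow> nat \<Rightarrow> ('f, 'u) alg set" where
  "free_algs_rank ar V m = {A. \<exists>X. finite X \<and> card X = m \<and> free_on ar V A X}"

definition free_algs_fin :: "'f lang \<Rightarrow> ('f, 'u) alg set \<Rightarrow> ('f, 'u) alg set" where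
  "free_algs_fin ar V = (\<Union>m. free_algs_rank ar V m)"

text \<open>\<open>P\<close> with \<open>i : A \<rightarrow> P\<close> and \<open>j : C \<rightarrow> P\<close> is the coproduct of \<open>A\<close> and \<open>C\<close> in \<open>V\<close>.\<close>

definition coproduct :: "'f lang \<Rightarrow> ('f, 'u) alg set \<Rightarrow> ('f, 'u) alg \<Rightarrow> ('f, 'u) alg \<Rightarrow>
    ('f, 'u) alg \<Rightarrow> ('u \<Rightarrow> 'u) \<Rightarrow> ('u \<Rightarrow> 'u) \<Rightarrow> bool" where
  "coproduct ar V A C P i j \<longleftrightarrow> A \<in> V \<and> C \<in> V \<and> P \<in> V \<and> hom ar A P i \<and> hom ar C P j \<and>
     (\<forall>D \<in> V. \<forall>f g. hom ar A D f \<and> hom ar C D g \<longrightarrow>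
        (\<exists>h. hom ar P D h \<and> (\<forall>a \<in> carr A. h (i a) = f a) \<and> (\<forall>c \<in> carr C. h (j c) = g c) \<and>
           (\<forall>h'. hom ar P D h' \<and> (\<forall>a \<in> carr A. h' (i a) = f a) \<and>
                 (\<forall>c \<in> carr C. h' (j c) = g c) \<longrightarrow> (\<forall>p \<in> carr P. h' p = h p))))"

definition internal_free_product :: "'f lang \<Rightarrow> ('f, 'u) alg set \<Rightarrow> ('f, 'u) alg \<Rightarrow>
    ('f, 'u) alg \<Rightarrow> ('f, 'u) alg \<Rightarrow> bool" where
  "internal_free_product ar V A C B \<longleftrightarrow>
     subalg ar A B \<and> subalg ar C B \<and> coproduct ar V A C B id id"

definition free_factor ::
    "'f lang \<Rightarrow> ('f, 'u) alg set \<Rightarrow> ('f, 'u) alg \<Rightarrow> ('f, 'u) alg \<Rightarrow> bool" where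
  "free_factor ar V A B \<longleftrightarrow> A \<in> free_algs ar V \<and> B \<in> free_algs ar V \<and>
     (\<exists>C \<in> free_algs ar V. internal_free_product ar V A C B)"

text \<open>Construction Principle. In the last clause \<open>P\<close> is the free product of \<open>B\<close> and \<open>C\<close>, and
  the copy of \<open>A\<close> in \<open>P\<close> is the image of \<open>A\<close> under the canonical map \<open>i : B \<rightarrow> P\<close>.\<close>

definition CP :: "'f lang \<Rightarrow> ('f, 'u) alg set \<Rightarrow> bool" where
  "CP ar V \<longleftrightarrow> (\<exists>A B. A \<in> free_algs_inf ar V \<and> B \<in> free_algs_inf ar V \<and>
     countable (carr A) \<and> countable (carr B) \<and> subalg ar A B \<and>
     (\<exists>a :: nat \<Rightarrow> 'u. inj a \<and> free_on ar V A (range a) \<and>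
        (\<forall>i. free_factor ar V (gen ar B (a ` {..i})) B)) \<and>
     (\<forall>C P i j. C \<in> free_algs ar V \<and> coproduct ar V B C P i j \<longrightarrow>
        \<not> free_factor ar V (P\<lparr>carr := i ` carr A\<rparr>) P))"

definition smallest_model_factor :: "'f lang \<Rightarrow> ('f, 'u) alg set \<Rightarrow> 'f fm set \<Rightarrow>
    ('f, 'u) alg \<Rightarrow> 'u set \<Rightarrow> ('f, 'u) alg \<Rightarrow> bool" where
  "smallest_model_factor ar V T B S D \<longleftrightarrow>
     free_factor ar V D B \<and> D \<in> Mod ar T \<and> S \<subseteq> carr D \<and>
     (\<forall>D'. free_factor ar V D' B \<and> D' \<in> Mod ar T \<and> S \<subseteq> carr D' \<longrightarrow> carr D \<subseteq> carr D')"

text \<open>The existence of the smallest free factor is part of the second clause.\<close>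

definition behaves_like_free_groups ::
    "'f lang \<Rightarrow> ('f, 'u) alg set \<Rightarrow> 'f fm set \<Rightarrow> bool" where
  "behaves_like_free_groups ar V T \<longleftrightarrow>
     (\<exists>n. \<forall>m \<ge> n. free_algs_rank ar V m \<subseteq> Mod ar T) \<and>
     (\<forall>A \<in> free_algs_fin ar V \<inter> Mod ar T. \<forall>B \<in> free_algs_fin ar V \<inter> Mod ar T.
        free_factor ar V A B \<longrightarrow>
        (\<forall>b \<in> carr B. \<exists>D. smallest_model_factor ar V T B (insert b (carr A)) D \<and>
           carr D \<subseteq> acl ar B (insert b (carr A)))) \<and>
     (\<forall>A \<in> free_algs_fin ar V. \<forall>B \<in> free_algs_fin ar V. \<forall>C \<in> free_algs ar V.
        subalg ar A B \<and> subalg ar B C \<and> free_factor ar V A C \<and> free_factor ar V B C \<longrightarrow>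
        free_factor ar V A B) \<and>
     (\<forall>A \<in> free_algs ar V \<inter> Mod ar T. \<forall>B \<in> free_algs ar V \<inter> Mod ar T.
        (free_factor ar V A B \<longrightarrow> elem_sub ar A B) \<and>
        (A \<in> free_algs_fin ar V \<and> B \<in> free_algs_fin ar V \<and> elem_sub ar A B \<longrightarrow>
           free_factor ar V A B))"

section \<open>Superstability\<close>

text \<open>
  A theory is superstable if it is stable (no formula has the order property) and every finitary
  type over a set \<open>A\<close> does not fork over some finite subset of \<open>A\<close>. Since there is no monster
  model, elementary extensions are quantified over explicitly; every type over \<open>A\<close> is the type of
  a tuple of some model containing \<open>A\<close>.

  Finite tuples are lists. A formula \<open>\<phi>(x, c)\<close> with object variables \<open>x\<close> of length \<open>n\<close> and
  parameters \<open>c\<close> is evaluated at \<open>b\<close> by sending the variable \<open>k\<close> to \<open>(b @ c) ! k\<close>, so that the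
  first \<open>n\<close> variables are the object variables.
\<close>

definition tuples :: "('f, 'u) alg \<Rightarrow> nat \<Rightarrow> 'u list set" where
  "tuples M n = {b. length b = n \<and> set b \<subseteq> carr M}"

definition fm_in :: "'f lang \<Rightarrow> nat \<Rightarrow> 'f fm \<Rightarrow> bool" where
  "fm_in ar n \<phi> \<longleftrightarrow> wf_fm ar \<phi> \<and> fv \<phi> \<subseteq> {..<n}"

definition holds :: "('f, 'u) alg \<Rightarrow> 'f fm \<Rightarrow> 'u list \<Rightarrow> bool" where
  "holds M \<phi> b \<longleftrightarrow> sat M \<phi> ((!) b)"

definition order_property ::
    "'u itself \<Rightarrow> 'f lang \<Rightarrow> 'f fm set \<Rightarrow> nat \<Rightarrow> nat \<Rightarrow> 'f fm \<Rightarrow> bool" where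
  "order_property U ar T m n \<phi> \<longleftrightarrow>
     (\<exists>M \<in> (Mod ar T :: ('f, 'u) alg set). \<exists>a b. range a \<subseteq> tuples M m \<and> range b \<subseteq> tuples M n \<and>
        (\<forall>i j :: nat. holds M \<phi> (a i @ b j) \<longleftrightarrow> i < j))"

definition stable :: "'u itself \<Rightarrow> 'f lang \<Rightarrow> 'f fm set \<Rightarrow> bool" where
  "stable U ar T \<longleftrightarrow> \<not> (\<exists>m n \<phi>. fm_in ar (m + n) \<phi> \<and> order_property U ar T m n \<phi>)"

definition same_type ::
    "'f lang \<Rightarrow> ('f, 'u) alg \<Rightarrow> 'u set \<Rightarrow> 'u list \<Rightarrow> 'u list \<Rightarrow> bool" where
  "same_type ar M A c d \<longleftrightarrow> length c = length d \<and>
     (\<forall>\<phi> p. set p \<subseteq> A \<and> fm_in ar (length c + length p) \<phi> \<longrightarrow>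
        (holds M \<phi> (c @ p) \<longleftrightarrow> holds M \<phi> (d @ p)))"

text \<open>\<open>\<phi>(x, c)\<close> divides over \<open>A\<close>: in some elementary extension there is a sequence of
  realisations \<open>s 0, s 1, \<dots>\<close> of the type of \<open>c\<close> over \<open>A\<close> such that the formulas
  \<open>\<phi>(x, s i)\<close> are \<open>k\<close>-inconsistent for some \<open>k\<close>.\<close>

definition divides ::
    "'f lang \<Rightarrow> ('f, 'u) alg \<Rightarrow> nat \<Rightarrow> 'f fm \<Rightarrow> 'u list \<Rightarrow> 'u set \<Rightarrow> bool" where
  "divides ar M n \<phi> c A \<longleftrightarrow>
     (\<exists>N e s k. elem_embedding ar M N e \<and>
        (\<forall>i :: nat. s i \<in> tuples N (length c) \<and> same_type ar N (e ` A) (map e c) (s i)) \<and>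
        (\<forall>I. finite I \<and> card I = k \<longrightarrow>
           \<not> (\<exists>b \<in> tuples N n. \<forall>i \<in> I. holds N \<phi> (b @ s i))))"

text \<open>\<open>\<phi>(x, c)\<close> forks over \<open>A\<close>: in some elementary extension it implies a finite disjunction of
  formulas \<open>\<psi>(x, d)\<close> each of which divides over \<open>A\<close>.\<close>

definition forks ::
    "'f lang \<Rightarrow> ('f, 'u) alg \<Rightarrow> nat \<Rightarrow> 'f fm \<Rightarrow> 'u list \<Rightarrow> 'u set \<Rightarrow> bool" where
  "forks ar M n \<phi> c A \<longleftrightarrow>
     (\<exists>N e \<Delta>. elem_embedding ar M N e \<and> finite \<Delta> \<and>
        (\<forall>(\<psi>, d) \<in> \<Delta>. set d \<subseteq> carr N \<and> fm_in ar (n + length d) \<psi> \<and> divides ar N n \<psi> d (e ` A)) \<and>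
        (\<forall>b \<in> tuples N n. holds N \<phi> (b @ map e c) \<longrightarrow> (\<exists>(\<psi>, d) \<in> \<Delta>. holds N \<psi> (b @ d))))"

text \<open>The type of \<open>b\<close> over \<open>A\<close>, computed in \<open>M\<close>, forks over \<open>A\<^sub>0\<close>.\<close>

definition type_forks ::
    "'f lang \<Rightarrow> ('f, 'u) alg \<Rightarrow> 'u list \<Rightarrow> 'u set \<Rightarrow> 'u set \<Rightarrow> bool" where
  "type_forks ar M b A A\<^sub>0 \<longleftrightarrow>
     (\<exists>\<phi> c. set c \<subseteq> A \<and> fm_in ar (length b + length c) \<phi> \<and> holds M \<phi> (b @ c) \<and>
        forks ar M (length b) \<phi> c A\<^sub>0)"

definition superstable :: "'u itself \<Rightarrow> 'f lang \<Rightarrow> 'f fm set \<Rightarrow> bool" where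
  "superstable U ar T \<longleftrightarrow> stable U ar T \<and>
     (\<forall>M \<in> (Mod ar T :: ('f, 'u) alg set). \<forall>A b. A \<subseteq> carr M \<and> set b \<subseteq> carr M \<longrightarrow>
        (\<exists>A\<^sub>0. finite A\<^sub>0 \<and> A\<^sub>0 \<subseteq> A \<and> \<not> type_forks ar M b A A\<^sub>0))"

end

theory Submission
  imports Defs
begin

text \<open>
  Let \<open>A \<le> B\<close> be as in (CP), with \<open>a 0, a 1, \<dots>\<close> free generators of \<open>A\<close>, and work in \<open>P = B * C\<close>
  with \<open>C\<close> free of infinite rank (\<open>P\<close> is realised as \<open>B\<close> itself with a basis split into two infinite halves).
  If \<open>T\<close> is superstable, the type over \<open>A * C\<close> of a finite tuple \<open>u\<close> of \<open>B\<close> does not fork over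
  some \<open>a 0, \<dots>, a (n - 1)\<close> together with finitely many elements of \<open>C\<close>. By clauses (2) and (3), \<open>u\<close> lies in a free factor
  with basis \<open>a 0, \<dots>, a (n - 1)\<close> and \<open>e\<close>, where \<open>e\<close> is algebraic over \<open>u, a 0, \<dots>, a (n - 1)\<close>.
  Then, for \<open>m \<ge> n\<close>, the tuple \<open>e\<close> has the same type over \<open>a 0, \<dots>, a (m - 1)\<close> as basis elements \<open>y\<close>
  independent of them: otherwise a formula \<open>\<phi>(x, a 0, \<dots>, a (m - 1))\<close> separates them, and replacing the block
  \<open>a n, \<dots>, a (m - 1)\<close> by disjoint blocks of a basis of \<open>C\<close> yields conjugates of it that \<open>e\<close> does not satisfy.
  Any tuple of \<open>P\<close> satisfies finitely or cofinitely many of these conjugates, and without the order property the size of the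
  finite exceptional sets is bounded. Hence \<open>\<phi>\<close>, restricted to the tuples that fail sufficiently many fixed conjugates, divides,
  and so the type of \<open>u\<close> forks after all, as \<open>e\<close> is algebraic over \<open>u\<close>. By clause (4), \<open>a 0, \<dots>, a (m - 1), e\<close>
  is therefore part of a basis of \<open>B\<close> for every \<open>m\<close>. Exhausting the countable algebra \<open>B\<close> in this way, the \<open>a i\<close> extend to a basis of
  \<open>B\<close>, so \<open>A\<close> is a free factor of \<open>B * C\<close>, against (CP). All indiscernible sequences consist of
  basis elements of \<open>P\<close>, so neither compactness nor saturated models are needed.
\<close>

section \<open>Generated subalgebras\<close>

abbreviation cl :: "'f lang \<Rightarrow> ('f, 'u) alg \<Rightarrow> 'u set \<Rightarrow> 'u set" where
  "cl ar B X \<equiv> carr (gen ar B X)"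

lemma is_algD: "is_alg ar A \<Longrightarrow> ar f = Some (length xs) \<Longrightarrow> set xs \<subseteq> carr A \<Longrightarrow> op A f xs \<in> carr A"
  unfolding is_alg_def by blast

lemma op_gen [simp]: "op (gen ar B X) = op B"
  by (simp add: gen_def)

lemma eval_tm_gen [simp]: "eval_tm (gen ar B X) v t = eval_tm B v t"
proof (induction t)
  case (Fun f ts)
  then have "map (eval_tm (gen ar B X) v) ts = map (eval_tm B v) ts"
    by (intro map_cong) auto
  then show ?case by (simp only: eval_tm.simps op_gen)
qed auto

lemma cl_eq: "cl ar B X = \<Inter> {S. X \<subseteq> S \<and> S \<subseteq> carr B \<and> is_alg ar (B\<lparr>carr := S\<rparr>)}"
  by (simp add: gen_def)

lemma cl_superset: "X \<subseteq> cl ar B X"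
  unfolding cl_eq by blast

lemma cl_least: "X \<subseteq> S \<Longrightarrow> S \<subseteq> carr B \<Longrightarrow> is_alg ar (B\<lparr>carr := S\<rparr>) \<Longrightarrow> cl ar B X \<subseteq> S"
  unfolding cl_eq by blast

lemma cl_subset:
  assumes "is_alg ar B" "X \<subseteq> carr B"
  shows "cl ar B X \<subseteq> carr B"
  by (rule cl_least) (use assms in auto)

lemma op_in_cl:
  assumes "ar f = Some (length xs)" "set xs \<subseteq> cl ar B X"
  shows "op B f xs \<in> cl ar B X"
  unfolding cl_eq
proof
  fix S assume S: "S \<in> {S. X \<subseteq> S \<and> S \<subseteq> carr B \<and> is_alg ar (B\<lparr>carr := S\<rparr>)}"
  then have "set xs \<subseteq> S" using assms(2) unfolding cl_eq by blast
  then show "op B f xs \<in> S" using S is_algD[of ar "B\<lparr>carr := S\<rparr>" f xs] assms(1) by simp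
qed

lemma is_alg_gen [simp]: "is_alg ar (gen ar B X)"
  unfolding is_alg_def using op_in_cl by (metis op_gen)

text \<open>\<open>cl\<close> is an intersection of subalgebras and not an inductive set; the rule
  comes from applying minimality to those elements of the closure that satisfy \<open>Q\<close>. The
  step case also supplies that the arguments lie in the closure.\<close>

lemma cl_induct [consumes 3, case_names base step]:
  assumes "x \<in> cl ar B X" "is_alg ar B" "X \<subseteq> carr B"
    and "\<And>x. x \<in> X \<Longrightarrow> Q x"
    and "\<And>f xs. ar f = Some (length xs) \<Longrightarrow> set xs \<subseteq> cl ar B X \<Longrightarrow> \<forall>x\<in>set xs. Q x \<Longrightarrow> Q (op B f xs)"
  shows "Q x"
proof -
  have "cl ar B X \<subseteq> {x \<in> cl ar B X. Q x}"
  proof (rule cl_least)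
    show "is_alg ar (B\<lparr>carr := {x \<in> cl ar B X. Q x}\<rparr>)"
      unfolding is_alg_def by (auto intro!: op_in_cl assms(5))
  qed (use assms(4) cl_superset[of X ar B] cl_subset[OF assms(2,3)] in auto)
  then show ?thesis using assms(1) by blast
qed

lemma cl_cl_subset:
  assumes "is_alg ar B" "X \<subseteq> carr B" "Y \<subseteq> cl ar B X"
  shows "cl ar B Y \<subseteq> cl ar B X"
proof -
  have "is_alg ar (B\<lparr>carr := cl ar B X\<rparr>)"
    unfolding is_alg_def by (simp add: op_in_cl)
  then show ?thesis
    using assms cl_subset by (intro cl_least) auto
qed

lemma cl_mono:
  assumes "is_alg ar B" "Y \<subseteq> carr B" "X \<subseteq> Y"
  shows "cl ar B X \<subseteq> cl ar B Y"
  using assms cl_cl_subset cl_superset by (metis subset_trans)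

text \<open>Makes closures inside \<open>gen ar B Y\<close> and inside \<open>B\<close>
  interchangeable. It is an equality of records and not only of carriers, because \<open>gen\<close>
  changes nothing but \<open>carr\<close>.\<close>

lemma gen_gen:
  assumes "is_alg ar B" "Y \<subseteq> carr B" "X \<subseteq> cl ar B Y"
  shows "gen ar (gen ar B Y) X = gen ar B X"
proof -
  have X: "X \<subseteq> carr B" using assms cl_subset by blast
  have "cl ar (gen ar B Y) X = cl ar B X"
  proof
    show "cl ar (gen ar B Y) X \<subseteq> cl ar B X"
    proof (rule cl_least)
      show "is_alg ar (gen ar B Y\<lparr>carr := cl ar B X\<rparr>)"
        unfolding is_alg_def by (simp add: op_in_cl)
      show "X \<subseteq> cl ar B X" by (rule cl_superset)
      show "cl ar B X \<subseteq> cl ar B Y" by (rule cl_cl_subset[OF assms])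
    qed
    show "cl ar B X \<subseteq> cl ar (gen ar B Y) X"
    proof
      fix x assume "x \<in> cl ar B X"
      then show "x \<in> cl ar (gen ar B Y) X" using assms(1) X
      proof (induction rule: cl_induct)
        case (base x) then show ?case using cl_superset by fast
      next
        case (step f xs) then show ?case by (metis op_gen op_in_cl subsetI)
      qed
    qed
  qed
  then show ?thesis
    by (simp add: gen_def)
qed

lemma subalg_gen: "is_alg ar B \<Longrightarrow> X \<subseteq> carr B \<Longrightarrow> subalg ar (gen ar B X) B"
  unfolding subalg_def using cl_subset[of ar B X] by simp

text \<open>Operations are finitary, so an element is built from finitely many generators. This is
  what confines finite sets to free factors of finite rank.\<close>

lemma cl_finite_support:
  assumes "is_alg ar B" "X \<subseteq> carr B" "x \<in> cl ar B X"
  shows "\<exists>F. finite F \<and> F \<subseteq> X \<and> x \<in> cl ar B F"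
  using assms(3,1,2)
proof (induction rule: cl_induct)
  case (base x)
  then show ?case using cl_superset by (intro exI[of _ "{x}"]) fast
next
  case (step f xs)
  then obtain F where F: "\<And>x. x \<in> set xs \<Longrightarrow> finite (F x) \<and> F x \<subseteq> X \<and> x \<in> cl ar B (F x)" by metis
  have "x \<in> cl ar B (\<Union>x\<in>set xs. F x)" if "x \<in> set xs" for x
  proof -
    have "F x \<subseteq> (\<Union>x\<in>set xs. F x)" "(\<Union>x\<in>set xs. F x) \<subseteq> carr B" using F that assms(2) by blast+
    then show ?thesis using cl_mono[OF assms(1)] F[OF that] by blast
  qed
  then have "op B f xs \<in> cl ar B (\<Union>x\<in>set xs. F x)" using step(1) by (intro op_in_cl) auto
  then show ?case using F by (intro exI[of _ "\<Union>x\<in>set xs. F x"]) auto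
qed

lemma cl_finite_support_set:
  assumes "is_alg ar B" "X \<subseteq> carr B" "S \<subseteq> cl ar B X" "finite S"
  shows "\<exists>F. finite F \<and> F \<subseteq> X \<and> S \<subseteq> cl ar B F"
proof -
  have "\<forall>x\<in>S. \<exists>F. finite F \<and> F \<subseteq> X \<and> x \<in> cl ar B F"
    using cl_finite_support[OF assms(1,2)] assms(3) by (meson subsetD)
  then obtain F where F: "\<And>x. x \<in> S \<Longrightarrow> finite (F x) \<and> F x \<subseteq> X \<and> x \<in> cl ar B (F x)" by metis
  have "x \<in> cl ar B (\<Union>x\<in>S. F x)" if "x \<in> S" for x
  proof -
    have "F x \<subseteq> (\<Union>x\<in>S. F x)" "(\<Union>x\<in>S. F x) \<subseteq> carr B" using F that assms(2) by blast+
    then show ?thesis using cl_mono[OF assms(1)] F[OF that] by blast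
  qed
  then show ?thesis using F assms(4) by (intro exI[of _ "\<Union>x\<in>S. F x"]) auto
qed

section \<open>Terms and generated subalgebras\<close>

lemma eval_tm_cong: "(\<And>i. i \<in> fv_tm t \<Longrightarrow> v i = w i) \<Longrightarrow> eval_tm B v t = eval_tm B w t"
proof (induction t)
  case (Fun f ts)
  then have "map (eval_tm B v) ts = map (eval_tm B w) ts"
    by (intro map_cong) auto
  then show ?case by (simp only: eval_tm.simps)
qed auto

lemma eval_tm_in_cl:
  "wf_tm ar t \<Longrightarrow> v ` fv_tm t \<subseteq> cl ar B X \<Longrightarrow> eval_tm B v t \<in> cl ar B X"
proof (induction t)
  case (Fun f ts)
  then have "\<And>t. t \<in> set ts \<Longrightarrow> eval_tm B v t \<in> cl ar B X"
    by (auto simp: list_all_iff)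
  then have "set (map (eval_tm B v) ts) \<subseteq> cl ar B X" by auto
  then show ?case using Fun(2) op_in_cl[of ar f "map (eval_tm B v) ts"] by simp
qed auto

lemma eval_tm_in_carr:
  "is_alg ar B \<Longrightarrow> wf_tm ar t \<Longrightarrow> v ` fv_tm t \<subseteq> carr B \<Longrightarrow> eval_tm B v t \<in> carr B"
proof (induction t)
  case (Fun f ts)
  then have "\<And>t. t \<in> set ts \<Longrightarrow> eval_tm B v t \<in> carr B"
    by (auto simp: list_all_iff)
  then have "set (map (eval_tm B v) ts) \<subseteq> carr B" by auto
  then show ?case using Fun(2,3) is_algD[of ar B f "map (eval_tm B v) ts"] by simp
qed auto

text \<open>Used to replace parameters from a generated subalgebra by terms in the generating
  tuple.\<close>

lemma cl_set_eval:
  assumes "is_alg ar B" "set xs \<subseteq> carr B" "x \<in> cl ar B (set xs)"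
  shows "\<exists>t. wf_tm ar t \<and> fv_tm t \<subseteq> {..<length xs} \<and> x = eval_tm B ((!) xs) t"
  using assms(3,1,2)
proof (induction rule: cl_induct)
  case (base x)
  then obtain i where "i < length xs" "x = xs ! i" by (auto simp: in_set_conv_nth)
  then show ?case by (intro exI[of _ "Var i"]) auto
next
  case (step f ys)
  then obtain T where T: "\<And>y. y \<in> set ys \<Longrightarrow> wf_tm ar (T y) \<and> fv_tm (T y) \<subseteq> {..<length xs} \<and> y = eval_tm B ((!) xs) (T y)"
    by metis
  have "map (eval_tm B ((!) xs) \<circ> T) ys = ys"
    using T by (metis comp_apply map_idI)
  then show ?case using step(1) T
    by (intro exI[of _ "Fun f (map T ys)"]) (auto simp: list_all_iff)
qed

section \<open>Homomorphisms and isomorphisms\<close>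

lemma homD: "hom ar A B h \<Longrightarrow> a \<in> carr A \<Longrightarrow> h a \<in> carr B"
  unfolding hom_def by blast

lemma hom_op: "hom ar A B h \<Longrightarrow> ar f = Some (length xs) \<Longrightarrow> set xs \<subseteq> carr A \<Longrightarrow> h (op A f xs) = op B f (map h xs)"
  unfolding hom_def by blast

lemma hom_comp:
  assumes "hom ar A B h" "hom ar B C k"
  shows "hom ar A C (k \<circ> h)"
  unfolding hom_def
proof (intro conjI allI impI)
  fix f xs assume *: "ar f = Some (length xs) \<and> set xs \<subseteq> carr A"
  then have "set (map h xs) \<subseteq> carr B" using homD[OF assms(1)] by auto
  with * show "(k \<circ> h) (op A f xs) = op C f (map (k \<circ> h) xs)"
    using hom_op[OF assms(1)] hom_op[OF assms(2), of f "map h xs"] by simp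
qed (use homD[OF assms(1)] homD[OF assms(2)] in auto)

lemma hom_restrict: "subalg ar A' A \<Longrightarrow> hom ar A D h \<Longrightarrow> hom ar A' D h"
  unfolding hom_def subalg_def by (smt (verit) image_mono subset_trans)

lemma hom_expand: "subalg ar D' D \<Longrightarrow> hom ar A D' h \<Longrightarrow> hom ar A D h"
  unfolding subalg_def hom_def 
  by (smt (verit, ccfv_threshold) image_mono length_map list.set_map subset_trans)

lemma hom_id: "subalg ar A B \<Longrightarrow> hom ar A B id"
  unfolding hom_def subalg_def by auto

lemma subalg_refl: "is_alg ar A \<Longrightarrow> subalg ar A A"
  unfolding subalg_def by auto

lemma subalg_trans: "subalg ar A B \<Longrightarrow> subalg ar B C \<Longrightarrow> subalg ar A C"
  unfolding subalg_def by (metis subset_trans)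

lemma hom_eq_on_cl:
  assumes "is_alg ar A" "X \<subseteq> carr A" "hom ar A D h" "hom ar A D h'" "\<And>x. x \<in> X \<Longrightarrow> h x = h' x"
    and "a \<in> cl ar A X"
  shows "h a = h' a"
  using assms(6,1,2)
proof (induction rule: cl_induct)
  case (step f xs)
  then have "set xs \<subseteq> carr A" using cl_subset[OF assms(1,2)] by blast
  moreover have "map h xs = map h' xs" using step by auto
  ultimately show ?case using hom_op[OF assms(3) step(1)] hom_op[OF assms(4) step(1)] by metis
qed (use assms in auto)

lemma hom_eval:
  assumes "hom ar A B h" "is_alg ar A"
  shows "wf_tm ar t \<Longrightarrow> v ` fv_tm t \<subseteq> carr A \<Longrightarrow> h (eval_tm A v t) = eval_tm B (h \<circ> v) t"
proof (induction t)
  case (Fun f ts)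
  have "set (map (eval_tm A v) ts) \<subseteq> carr A"
    using Fun eval_tm_in_carr[OF assms(2)] by (fastforce simp: list_all_iff)
  then have "h (op A f (map (eval_tm A v) ts)) = op B f (map h (map (eval_tm A v) ts))"
    using hom_op[OF assms(1)] Fun(2) by simp
  also have "map h (map (eval_tm A v) ts) = map (eval_tm B (h \<circ> v)) ts"
    using Fun by (auto simp: list_all_iff comp_def)
  finally show ?case by (simp add: comp_def)
qed auto

section \<open>Isomorphisms, and images of generated subalgebras\<close>

definition iso :: "'f lang \<Rightarrow> ('f, 'u) alg \<Rightarrow> ('f, 'u) alg \<Rightarrow> ('u \<Rightarrow> 'u) \<Rightarrow> bool" where
  "iso ar A B h \<longleftrightarrow> is_alg ar A \<and> is_alg ar B \<and> hom ar A B h \<and> bij_betw h (carr A) (carr B)"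

lemma iso_inverse:
  assumes "iso ar A B h"
  shows "iso ar B A (inv_into (carr A) h)"
proof -
  let ?k = "inv_into (carr A) h"
  have b: "bij_betw ?k (carr B) (carr A)" using assms bij_betw_inv_into by (auto simp: iso_def)
  have i: "?k (h x) = x" if "x \<in> carr A" for x
    using assms that by (simp add: iso_def bij_betw_def)
  have hi: "h (?k x) = x" if "x \<in> carr B" for x
    using assms that by (metis bij_betw_inv_into_right iso_def)
  have "?k (op B f xs) = op A f (map ?k xs)" if *: "ar f = Some (length xs)" "set xs \<subseteq> carr B" for f xs
  proof -
    have s: "set (map ?k xs) \<subseteq> carr A" using b * by (auto simp: bij_betw_def)
    have "map h (map ?k xs) = xs" using hi * by (auto intro!: map_idI)
    then have "h (op A f (map ?k xs)) = op B f xs"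
      using hom_op[of ar A B h f "map ?k xs"] assms s * by (simp add: iso_def)
    then show ?thesis using i is_algD[of ar A f "map ?k xs"] s * assms by (metis iso_def length_map)
  qed
  then show ?thesis using b assms by (auto simp: iso_def hom_def bij_betw_def)
qed

text \<open>Injectivity of \<open>h\<close> takes care of equations, surjectivity of
  quantifiers.\<close>

lemma sat_iso:
  assumes "iso ar A B h"
  shows "wf_fm ar \<phi> \<Longrightarrow> v ` fv \<phi> \<subseteq> carr A \<Longrightarrow> sat A \<phi> v \<longleftrightarrow> sat B \<phi> (h \<circ> v)"
proof (induction \<phi> arbitrary: v)
  case (Eq s t)
  have h: "hom ar A B h" "is_alg ar A" "inj_on h (carr A)" using assms by (auto simp: iso_def bij_betw_def)
  have "eval_tm A v s \<in> carr A" "eval_tm A v t \<in> carr A"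
    using Eq by (auto intro!: eval_tm_in_carr[OF h(2)])
  then have "eval_tm A v s = eval_tm A v t \<longleftrightarrow> h (eval_tm A v s) = h (eval_tm A v t)"
    using h(3) by (simp add: inj_on_eq_iff)
  also have "\<dots> \<longleftrightarrow> eval_tm B (h \<circ> v) s = eval_tm B (h \<circ> v) t"
    using Eq hom_eval[OF h(1,2)] by (simp add: image_Un)
  finally show ?case by (simp add: comp_def)
next
  case (Ex x \<phi>)
  have h: "h ` carr A = carr B" using assms by (auto simp: iso_def bij_betw_def)
  have "sat A \<phi> (v(x := a)) \<longleftrightarrow> sat B \<phi> ((h \<circ> v)(x := h a))" if "a \<in> carr A" for a
  proof -
    have "(v(x := a)) ` fv \<phi> \<subseteq> carr A" using Ex that by auto
    with Ex.IH[of "v(x := a)"] Ex.prems(1) have "sat A \<phi> (v(x := a)) \<longleftrightarrow> sat B \<phi> (h \<circ> v(x := a))"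
      by (simp only: wf_fm.simps)
    then show ?thesis by (simp only: fun_upd_comp)
  qed
  moreover have "(\<exists>a\<in>carr A. sat B \<phi> ((h \<circ> v)(x := h a))) \<longleftrightarrow> (\<exists>b\<in>carr B. sat B \<phi> ((h \<circ> v)(x := b)))"
    unfolding h[symmetric] by simp
  ultimately show ?case by (simp add: comp_def)
qed (auto simp: image_Un)

text \<open>In contrast to \<open>gen_gen\<close>, the operations of \<open>D\<close> may differ
  from those of \<open>P\<close> outside \<open>carr D\<close>, so only the carriers are claimed to
  be equal.\<close>

lemma cl_subalg:
  assumes D: "subalg ar D P" and S: "S \<subseteq> carr D"
  shows "cl ar D S = cl ar P S"
proof -
  have al: "is_alg ar D" "is_alg ar P" "carr D \<subseteq> carr P" using D by (auto simp: subalg_def)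
  have op: "op D f xs = op P f xs" if "ar f = Some (length xs)" "set xs \<subseteq> carr D" for f xs
    using D that by (auto simp: subalg_def)
  have SP: "S \<subseteq> carr P" using S al by blast
  have "x \<in> cl ar P S" if "x \<in> cl ar D S" for x
    using that al(1) S
  proof (induction rule: cl_induct)
    case (base x) then show ?case using cl_superset[of S ar P] by blast
  next
    case (step f xs)
    have "set xs \<subseteq> carr D" using step(2) cl_subset[OF al(1) S] by blast
    then show ?case using op[of f xs] step(1) op_in_cl[of ar f xs P S] step(3) by auto
  qed
  moreover have "x \<in> cl ar D S" if "x \<in> cl ar P S" for x
    using that al(2) SP
  proof (induction rule: cl_induct)
    case (base x) then show ?case using cl_superset[of S ar D] by blast
  next
    case (step f xs)
    have *: "set xs \<subseteq> cl ar D S" using step(3) by blast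
    then have "set xs \<subseteq> carr D" using cl_subset[OF al(1) S] by blast
    then show ?case using op[of f xs] step(1) op_in_cl[of ar f xs D S] * by simp
  qed
  ultimately show ?thesis by blast
qed

lemma hom_image_cl:
  assumes h: "hom ar A B h" and A: "is_alg ar A" "is_alg ar B" "S \<subseteq> carr A"
  shows "h ` cl ar A S = cl ar B (h ` S)"
proof -
  have hS: "h ` S \<subseteq> carr B" using h A(3) by (auto simp: hom_def)
  have "h x \<in> cl ar B (h ` S)" if "x \<in> cl ar A S" for x
    using that A(1,3)
  proof (induction rule: cl_induct)
    case (base x) then show ?case using cl_superset[of "h ` S" ar B] by blast
  next
    case (step f xs)
    have "set xs \<subseteq> carr A" using step(2) cl_subset[OF A(1,3)] by blast
    then have "h (op A f xs) = op B f (map h xs)" using hom_op[OF h step(1)] by simp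
    then show ?case using op_in_cl[of ar f "map h xs" B "h ` S"] step(1,3) by auto
  qed
  moreover have "y \<in> h ` cl ar A S" if "y \<in> cl ar B (h ` S)" for y
    using that A(2) hS
  proof (induction rule: cl_induct)
    case (base x) then show ?case using cl_superset[of S ar A] by blast
  next
    case (step f ys)
    have "\<forall>y\<in>set ys. \<exists>x. x \<in> cl ar A S \<and> h x = y"
    proof
      fix y assume "y \<in> set ys"
      then have "y \<in> h ` cl ar A S" using step(3) by simp
      then show "\<exists>x. x \<in> cl ar A S \<and> h x = y" by (elim imageE) auto
    qed
    then obtain g where g: "\<And>y. y \<in> set ys \<Longrightarrow> g y \<in> cl ar A S \<and> h (g y) = y" by metis
    have xs: "set (map g ys) \<subseteq> cl ar A S" "ys = map h (map g ys)"
      using g by (auto simp: map_idI)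
    then obtain xs where xs: "set xs \<subseteq> cl ar A S" "ys = map h xs" by blast
    moreover have "set xs \<subseteq> carr A" using xs cl_subset[OF A(1,3)] by blast
    ultimately have "op B f ys = h (op A f xs)" using hom_op[OF h, of f xs] step(1) by simp
    then show ?case using op_in_cl[of ar f xs A S] step(1) xs by auto
  qed
  ultimately show ?thesis by blast
qed

section \<open>Free algebras\<close>

locale variety_of_algebras =
  fixes ar :: "'f lang" and V :: "('f, 'u) alg set"
  assumes variety: "variety ar V"
begin

lemma is_alg: "A \<in> V \<Longrightarrow> is_alg ar A"
  using variety unfolding variety_def by blast

lemma gen_in: 
  assumes "A \<in> V" "X \<subseteq> carr A"
  shows "gen ar A X \<in> V"
proof -
  obtain E where E: "V = {A. is_alg ar A \<and>
            (\<forall>(s, t) \<in> E. \<forall>v. range v \<subseteq> carr A \<longrightarrow> eval_tm A v s = eval_tm A v t)}"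
    using variety unfolding variety_def by blast
  have "is_alg ar A" using assms is_alg by blast
  then have c: "cl ar A X \<subseteq> carr A" using assms(2) cl_subset by blast
  have "\<forall>(s, t) \<in> E. \<forall>v. range v \<subseteq> cl ar A X \<longrightarrow> eval_tm A v s = eval_tm A v t"
    using assms(1) c unfolding E by fast
  then show ?thesis unfolding E by simp
qed

lemma free_on_carr: "free_on ar V A X \<Longrightarrow> X \<subseteq> carr A"
  and free_on_V: "free_on ar V A X \<Longrightarrow> A \<in> V"
  unfolding free_on_def by auto

lemma free_on_alg: "free_on ar V A X \<Longrightarrow> is_alg ar A"
  using free_on_V is_alg by blast

lemma free_on_hom:
  assumes "free_on ar V A X" "D \<in> V" "f ` X \<subseteq> carr D"
  obtains h where "hom ar A D h" "\<And>x. x \<in> X \<Longrightarrow> h x = f x"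
proof -
  have "\<exists>h. hom ar A D h \<and> (\<forall>x\<in>X. h x = f x)"
    using assms unfolding free_on_def by blast
  then show ?thesis using that by blast
qed

lemma free_on_unique:
  assumes "free_on ar V A X" "D \<in> V" "hom ar A D h" "hom ar A D h'" "\<And>x. x \<in> X \<Longrightarrow> h x = h' x"
    and "a \<in> carr A"
  shows "h a = h' a"
proof -
  have "h ` X \<subseteq> carr D" using free_on_carr[OF assms(1)] homD[OF assms(3)] by blast
  then have "\<exists>k. hom ar A D k \<and> (\<forall>x \<in> X. k x = h x) \<and>
      (\<forall>h'. hom ar A D h' \<and> (\<forall>x \<in> X. h' x = h x) \<longrightarrow> (\<forall>a \<in> carr A. h' a = k a))"
    using assms(1,2) unfolding free_on_def by (elim conjE) (drule bspec, assumption, blast)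
  then obtain k where "\<And>h'. hom ar A D h' \<Longrightarrow> (\<forall>x \<in> X. h' x = h x) \<Longrightarrow> (\<forall>a \<in> carr A. h' a = k a)"
    by blast
  note k = this
  have "h a = k a" using k[OF assms(3)] assms(6) by simp
  moreover have "h' a = k a" using k[OF assms(4)] assms(5,6) by simp
  ultimately show ?thesis by simp
qed

text \<open>The identity on \<open>X\<close> extends to a homomorphism from \<open>A\<close> into
  \<open>gen ar A X\<close>. Seen as an endomorphism of \<open>A\<close> it agrees with the identity
  by uniqueness, so every element of \<open>A\<close> lies in the closure.\<close>

lemma free_on_cl:
  assumes "free_on ar V A X"
  shows "cl ar A X = carr A"
proof -
  have A: "A \<in> V" "is_alg ar A" "X \<subseteq> carr A" using assms free_on_V free_on_alg free_on_carr by auto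
  have s: "subalg ar (gen ar A X) A" using subalg_gen A by blast
  obtain h where h: "hom ar A (gen ar A X) h" "\<And>x. x \<in> X \<Longrightarrow> h x = x"
    using free_on_hom[OF assms gen_in[OF A(1,3)], of id] cl_superset by (metis id_apply image_id)
  have "h a = id a" if "a \<in> carr A" for a
    using free_on_unique[OF assms A(1) hom_expand[OF s h(1)] hom_id[OF subalg_refl[OF A(2)]]] h(2) that by simp
  then have "carr A \<subseteq> cl ar A X" using homD[OF h(1)] by (metis id_apply subsetI)
  then show ?thesis using cl_subset[OF A(2,3)] by blast
qed

text \<open>Generation by \<open>X\<close> takes the place of the uniqueness clause in
  \<open>free_on\<close>.\<close>

lemma free_onI:
  assumes "A \<in> V" "X \<subseteq> carr A" "carr A \<subseteq> cl ar A X"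
    and "\<And>D f. D \<in> V \<Longrightarrow> f ` X \<subseteq> carr D \<Longrightarrow> \<exists>h. hom ar A D h \<and> (\<forall>x\<in>X. h x = f x)"
  shows "free_on ar V A X"
  unfolding free_on_def
proof (intro conjI ballI allI impI)
  fix D f assume D: "D \<in> V" "f ` X \<subseteq> carr D"
  then obtain h where h: "hom ar A D h" "\<forall>x\<in>X. h x = f x" using assms(4) by blast
  have "h' a = h a" if "hom ar A D h' \<and> (\<forall>x \<in> X. h' x = f x)" "a \<in> carr A" for h' a
    using hom_eq_on_cl[OF is_alg[OF assms(1)] assms(2), of D h' h a] that h assms(3) by auto
  then show "\<exists>h. hom ar A D h \<and> (\<forall>x \<in> X. h x = f x) \<and>
           (\<forall>h'. hom ar A D h' \<and> (\<forall>x \<in> X. h' x = f x) \<longrightarrow> (\<forall>a \<in> carr A. h' a = h a))"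
    using h by blast
qed (use assms in auto)

text \<open>A map on \<open>X'\<close> is extended to \<open>X\<close> by a constant value, then to
  \<open>A\<close> by freeness, and restricted again.\<close>

lemma free_on_subset:
  assumes "free_on ar V A X" "X' \<subseteq> X"
  shows "free_on ar V (gen ar A X') X'"
proof (rule free_onI)
  have A: "A \<in> V" "is_alg ar A" "X' \<subseteq> carr A" "X \<subseteq> carr A"
    using assms free_on_V free_on_alg free_on_carr by (blast+)
  then show "gen ar A X' \<in> V" using gen_in by blast
  show "cl ar A X' \<subseteq> cl ar (gen ar A X') X'"
    using A gen_gen[OF A(2,3), of X'] cl_superset by fastforce
  fix D f assume D: "D \<in> V" "f ` X' \<subseteq> carr D"
  show "\<exists>h. hom ar (gen ar A X') D h \<and> (\<forall>x\<in>X'. h x = f x)"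
  \<comment> \<open>An empty \<open>D\<close> offers no constant value. In that case the language
    has no constants and \<open>X'\<close> is empty, so the generated subalgebra is empty
    too.\<close>
  proof (cases "carr D = {}")
    case True
    then have c: "ar g \<noteq> Some 0" for g using is_algD[OF is_alg[OF D(1)], of g "[]"] by auto
    have "cl ar A X' \<subseteq> {}" using D True c by (intro cl_least) (auto simp: is_alg_def)
    then show ?thesis using D True c unfolding hom_def by auto
  next
    case False
    then obtain d where d: "d \<in> carr D" by blast
    obtain h where "hom ar A D h" "\<And>x. x \<in> X \<Longrightarrow> h x = (if x \<in> X' then f x else d)"
      using free_on_hom[OF assms(1) D(1), of "\<lambda>x. if x \<in> X' then f x else d"] D(2) d by auto
    then show ?thesis using assms(2) hom_restrict[OF subalg_gen[OF A(2,3)]]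
      by (metis subset_eq)
  qed
qed (rule cl_superset)

text \<open>Given a map on the new basis, its values on \<open>Y\<close> determine a homomorphism
  \<open>k\<close> on the subalgebra generated by \<open>X'\<close>; the values of \<open>k\<close>
  on \<open>X'\<close>, with the given ones on the rest, form a map on the old basis
  \<open>X\<close>.\<close>

lemma free_on_replace:
  assumes "free_on ar V A X" "X' \<subseteq> X" "free_on ar V (gen ar A X') Y"
  shows "free_on ar V A (Y \<union> (X - X'))"
proof (rule free_onI)
  have A: "A \<in> V" "is_alg ar A" "X' \<subseteq> carr A" "X \<subseteq> carr A" "Y \<subseteq> cl ar A X'"
    using assms free_on_V free_on_alg free_on_carr by (blast+)
  have s: "subalg ar (gen ar A X') A" using subalg_gen A by blast
  show "A \<in> V" by fact
  show Yc: "Y \<union> (X - X') \<subseteq> carr A" using A(4,5) cl_subset[OF A(2,3)] by (meson Diff_subset Un_least subset_trans)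
  have "cl ar A X' = cl ar A Y" using free_on_cl[OF assms(3)] gen_gen[OF A(2,3,5)] by simp
  then have "X' \<subseteq> cl ar A Y" using cl_superset[of X' ar A] by simp
  then have "X \<subseteq> cl ar A (Y \<union> (X - X'))"
    using cl_superset[of "Y \<union> (X - X')" ar A] cl_mono[OF A(2) Yc, of Y] by blast
  then show "carr A \<subseteq> cl ar A (Y \<union> (X - X'))"
    using cl_cl_subset[OF A(2) Yc] free_on_cl[OF assms(1)] by blast
  fix D f assume D: "D \<in> V" "f ` (Y \<union> (X - X')) \<subseteq> carr D"
  obtain k where k: "hom ar (gen ar A X') D k" "\<And>x. x \<in> Y \<Longrightarrow> k x = f x"
    using free_on_hom[OF assms(3) D(1), of f] D(2) by (metis image_Un le_sup_iff)
  have "(\<lambda>x. if x \<in> X' then k x else f x) ` X \<subseteq> carr D"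
    using D(2) homD[OF k(1)] cl_superset[of X' ar A] by auto
  then obtain h where h: "hom ar A D h" "\<And>x. x \<in> X \<Longrightarrow> h x = (if x \<in> X' then k x else f x)"
    by (rule free_on_hom[OF assms(1) D(1)]) (rule that, blast+)
  have "h x = k x" if "x \<in> cl ar A X'" for x
    using free_on_unique[OF free_on_subset[OF assms(1,2)] D(1) hom_restrict[OF s h(1)] k(1)] h(2) assms(2) that
    by (metis subsetD)
  then show "\<exists>h. hom ar A D h \<and> (\<forall>x\<in>Y \<union> (X - X'). h x = f x)"
    using h k(2) A(5) by (intro exI[of _ h]) auto
qed

text \<open>Homomorphisms on the two generated subalgebras amount to a map on \<open>X\<close>, so
  the universal property of the coproduct is that of the basis.\<close>

lemma free_factor_gen:
  assumes "free_on ar V A X" "X' \<subseteq> X"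
  shows "coproduct ar V (gen ar A X') (gen ar A (X - X')) A id id"
    and "free_factor ar V (gen ar A X') A"
proof -
  have A: "A \<in> V" "is_alg ar A" "X' \<subseteq> carr A" "X - X' \<subseteq> carr A"
    using assms free_on_V free_on_alg free_on_carr by (blast+)
  let ?A = "gen ar A X'" and ?C = "gen ar A (X - X')"
  have s: "subalg ar ?A A" "subalg ar ?C A" using subalg_gen A by blast+
  have f: "free_on ar V ?A X'" "free_on ar V ?C (X - X')" using free_on_subset assms by auto
  show *: "coproduct ar V ?A ?C A id id"
    unfolding coproduct_def
  proof (intro conjI ballI allI impI)
    fix D f' g assume D: "D \<in> V" and "hom ar ?A D f' \<and> hom ar ?C D g"
    then have fg: "hom ar ?A D f'" "hom ar ?C D g" by auto
    have "f' x \<in> carr D" if "x \<in> X'" for x 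
      using homD[OF fg(1)] cl_superset[of X' ar A] that by (meson subsetD)
    moreover have "g x \<in> carr D" if "x \<in> X - X'" for x 
      using homD[OF fg(2)] cl_superset[of "X - X'" ar A] that by (meson subsetD)
    ultimately have "(\<lambda>x. if x \<in> X' then f' x else g x) ` X \<subseteq> carr D" by auto
    then obtain h where h: "hom ar A D h" "\<And>x. x \<in> X \<Longrightarrow> h x = (if x \<in> X' then f' x else g x)"
      by (rule free_on_hom[OF assms(1) D]) (rule that, blast+)
    have 1: "h x = f' x" if "x \<in> carr ?A" for x
      using free_on_unique[OF f(1) D hom_restrict[OF s(1) h(1)] fg(1)] h(2) assms(2) that by (metis subsetD)
    have 2: "h x = g x" if "x \<in> carr ?C" for x
      using free_on_unique[OF f(2) D hom_restrict[OF s(2) h(1)] fg(2)] h(2) that by (metis DiffE)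
    have 3: "h' p = h p" if "hom ar A D h'" "\<forall>a\<in>carr ?A. h' (id a) = f' a" "\<forall>a\<in>carr ?C. h' (id a) = g a" "p \<in> carr A" for h' p
    proof (rule free_on_unique[OF assms(1) D that(1) h(1) _ that(4)])
      fix x assume "x \<in> X"
      then have "x \<in> carr ?A \<or> x \<in> carr ?C"
        using cl_superset[of X' ar A] cl_superset[of "X - X'" ar A] by (meson DiffI subsetD)
      then show "h' x = h x" using 1 2 that(2,3) by (metis id_apply)
    qed
    show "\<exists>h. hom ar A D h \<and> (\<forall>a\<in>carr ?A. h (id a) = f' a) \<and> (\<forall>c\<in>carr ?C. h (id c) = g c) \<and>
           (\<forall>h'. hom ar A D h' \<and> (\<forall>a\<in>carr ?A. h' (id a) = f' a) \<and>
                 (\<forall>c\<in>carr ?C. h' (id c) = g c) \<longrightarrow> (\<forall>p\<in>carr A. h' p = h p))"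
      using h(1) 1 2 3 by (intro exI[of _ h] conjI allI impI ballI) (simp_all only: id_apply, blast+)
  qed (use A gen_in s hom_id in auto)
  show "free_factor ar V ?A A"
    unfolding free_factor_def internal_free_product_def free_algs_def
    using * s f assms(1) by blast
qed

text \<open>Converse to \<open>free_factor_gen\<close>: a basis of the factor and a basis of a
  complement together form a basis of the free product.\<close>

lemma free_factor_basis:
  assumes "free_factor ar V A B" "free_on ar V A X"
  obtains Y where "free_on ar V B (X \<union> Y)"
proof -
  obtain C Y where C: "free_on ar V C Y" and s: "subalg ar A B" "subalg ar C B" and co: "coproduct ar V A C B id id"
    using assms(1) unfolding free_factor_def internal_free_product_def free_algs_def by blast
  have "free_on ar V B (X \<union> Y)"
    unfolding free_on_def
  proof (intro conjI ballI allI impI)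
    show "B \<in> V" using co by (simp add: coproduct_def)
    show "X \<union> Y \<subseteq> carr B" using s free_on_carr[OF C] free_on_carr[OF assms(2)] by (auto simp: subalg_def)
    fix D f assume D: "D \<in> V" "f ` (X \<union> Y) \<subseteq> carr D"
    obtain k where k: "hom ar A D k" "\<And>x. x \<in> X \<Longrightarrow> k x = f x"
      using free_on_hom[OF assms(2) D(1)] D(2) by (metis image_Un le_sup_iff)
    obtain l where l: "hom ar C D l" "\<And>x. x \<in> Y \<Longrightarrow> l x = f x"
      using free_on_hom[OF C D(1)] D(2) by (metis image_Un le_sup_iff)
    obtain h where h: "hom ar B D h" "\<And>a. a \<in> carr A \<Longrightarrow> h a = k a" "\<And>a. a \<in> carr C \<Longrightarrow> h a = l a"
      and u: "\<And>h'. hom ar B D h' \<Longrightarrow> (\<forall>a\<in>carr A. h' a = k a) \<Longrightarrow> (\<forall>a\<in>carr C. h' a = l a) \<Longrightarrow> \<forall>p\<in>carr B. h' p = h p"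
      using co D(1) k(1) l(1) unfolding coproduct_def id_apply by blast
    have "h' p = h p" if h': "hom ar B D h'" "\<forall>x\<in>X \<union> Y. h' x = f x" and "p \<in> carr B" for h' p
    proof -
      have "\<forall>a\<in>carr A. h' a = k a"
        using free_on_unique[OF assms(2) D(1) hom_restrict[OF s(1) h'(1)] k(1)] h'(2) k(2) by simp
      moreover have "\<forall>a\<in>carr C. h' a = l a"
        using free_on_unique[OF C D(1) hom_restrict[OF s(2) h'(1)] l(1)] h'(2) l(2) by simp
      ultimately show ?thesis using u h' that by blast
    qed
    moreover have "\<forall>x\<in>X \<union> Y. h x = f x"
      using h(2,3) k(2) l(2) free_on_carr[OF C] free_on_carr[OF assms(2)] by fastforce
    ultimately show "\<exists>h. hom ar B D h \<and> (\<forall>x\<in>X \<union> Y. h x = f x) \<and>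
           (\<forall>h'. hom ar B D h' \<and> (\<forall>x\<in>X \<union> Y. h' x = f x) \<longrightarrow> (\<forall>a\<in>carr B. h' a = h a))"
      using h(1) by blast
  qed
  then show ?thesis using that by blast
qed

text \<open>The extensions of \<open>f\<close> and of its inverse are inverse to each other, since
  their composites fix a basis.\<close>

lemma free_on_iso_extend:
  assumes "free_on ar V A X" "free_on ar V B Y" "bij_betw f X Y"
  obtains h where "iso ar A B h" "\<And>x. x \<in> X \<Longrightarrow> h x = f x"
proof -
  let ?g = "inv_into X f"
  have A: "A \<in> V" "is_alg ar A" "X \<subseteq> carr A" "B \<in> V" "is_alg ar B" "Y \<subseteq> carr B"
    using assms free_on_V free_on_alg free_on_carr by (blast+)
  have g: "bij_betw ?g Y X" using bij_betw_inv_into assms(3) by blast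
  have gf: "?g (f x) = x" if "x \<in> X" for x using that assms(3) by (simp add: bij_betw_def)
  have fg: "f (?g x) = x" if "x \<in> Y" for x using that assms(3) by (simp add: bij_betw_inv_into_right)
  obtain h where h: "hom ar A B h" "\<And>x. x \<in> X \<Longrightarrow> h x = f x"
    using free_on_hom[OF assms(1) A(4), of f] assms(3) A by (metis bij_betw_imp_surj_on)
  obtain k where k: "hom ar B A k" "\<And>x. x \<in> Y \<Longrightarrow> k x = ?g x"
    using free_on_hom[OF assms(2) A(1), of ?g] g A by (metis bij_betw_imp_surj_on)
  have fX: "f x \<in> Y" if "x \<in> X" for x using assms(3) that by (auto simp: bij_betw_def)
  have gY: "?g x \<in> X" if "x \<in> Y" for x using g that by (auto simp: bij_betw_def)
  have 1: "(k \<circ> h) a = id a" if "a \<in> carr A" for a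
    by (rule free_on_unique[OF assms(1) A(1) hom_comp[OF h(1) k(1)] hom_id[OF subalg_refl[OF A(2)]] _ that])
      (simp add: h k gf fX)
  have 2: "(h \<circ> k) a = id a" if "a \<in> carr B" for a
    by (rule free_on_unique[OF assms(2) A(4) hom_comp[OF k(1) h(1)] hom_id[OF subalg_refl[OF A(5)]] _ that])
      (simp add: h k fg gY)
  have "bij_betw h (carr A) (carr B)"
    by (rule bij_betw_byWitness[of _ k]) (use 1 2 homD[OF h(1)] homD[OF k(1)] in auto)
  then show ?thesis using that h A by (auto simp: iso_def)
qed

lemma free_on_iso:
  assumes "free_on ar V A X" "iso ar A B h" "B \<in> V"
  shows "free_on ar V B (h ` X)"
proof -
  let ?k = "inv_into (carr A) h"
  have A: "A \<in> V" "is_alg ar A" "X \<subseteq> carr A" "is_alg ar B"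
    using assms free_on_V free_on_alg free_on_carr is_alg by (blast+)
  have h: "hom ar A B h" "bij_betw h (carr A) (carr B)" using assms(2) by (auto simp: iso_def)
  have k: "hom ar B A ?k" using iso_inverse[OF assms(2)] by (auto simp: iso_def)
  have kh: "?k (h x) = x" if "x \<in> carr A" for x using that h(2) by (simp add: bij_betw_def)
  have hk: "h (?k x) = x" if "x \<in> carr B" for x using that h(2) by (simp add: bij_betw_inv_into_right)
  have hX: "h ` X \<subseteq> carr B" using homD[OF h(1)] A by blast
  show ?thesis
    unfolding free_on_def
  proof (intro conjI ballI allI impI)
    fix D f assume D: "D \<in> V" "f ` h ` X \<subseteq> carr D"
    obtain l where l: "hom ar A D l" "\<And>x. x \<in> X \<Longrightarrow> l x = f (h x)"
      using free_on_hom[OF assms(1) D(1), of "f \<circ> h"] D(2) by (metis comp_apply image_comp)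
    have "h' b = (l \<circ> ?k) b" if h': "hom ar B D h'" "\<forall>x\<in>h ` X. h' x = f x" "b \<in> carr B" for h' b
    proof -
      have "(h' \<circ> h) (?k b) = l (?k b)"
        by (rule free_on_unique[OF assms(1) D(1) hom_comp[OF h(1) h'(1)] l(1) _ homD[OF k h'(3)]])
         (use h' l in auto)
      then show ?thesis using hk h' by simp
    qed
    moreover have "\<forall>x\<in>h ` X. (l \<circ> ?k) x = f x" using kh l(2) A(3) by auto
    ultimately show "\<exists>k. hom ar B D k \<and> (\<forall>x\<in>h ` X. k x = f x) \<and>
           (\<forall>h'. hom ar B D h' \<and> (\<forall>x\<in>h ` X. h' x = f x) \<longrightarrow> (\<forall>a\<in>carr B. h' a = k a))"
      using hom_comp[OF k l(1)] by (intro exI[of _ "l \<circ> ?k"]) blast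
  qed (use assms hX in auto)
qed

text \<open>Allows an isomorphic copy of the left factor. In the end this presents \<open>P\<close>
  as a coproduct whose left factor is \<open>P\<close> itself.\<close>

lemma coproduct_iso:
  assumes co: "coproduct ar V A C P j k" and i: "iso ar A' A i" and A': "A' \<in> V"
  shows "coproduct ar V A' C P (j \<circ> i) k"
proof -
  let ?l = "inv_into (carr A') i"
  have h: "hom ar A' A i" "hom ar A A' ?l" "bij_betw i (carr A') (carr A)"
    using i iso_inverse[OF i] by (auto simp: iso_def)
  have li: "?l (i a) = a" if "a \<in> carr A'" for a using that h(3) by (simp add: bij_betw_def)
  have il: "i (?l a) = a" if "a \<in> carr A" for a using that h(3) by (simp add: bij_betw_inv_into_right)
  have c: "C \<in> V" "P \<in> V" "hom ar A P j" "hom ar C P k" using co by (auto simp: coproduct_def)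
  show ?thesis
    unfolding coproduct_def
  proof (intro conjI ballI allI impI)
    show "hom ar A' P (j \<circ> i)" using hom_comp h(1) c(3) by blast
    fix D f g assume D: "D \<in> V" and fg: "hom ar A' D f \<and> hom ar C D g"
    then have "hom ar A D (f \<circ> ?l) \<and> hom ar C D g" using hom_comp h(2) by blast
    then have "\<exists>h. hom ar P D h \<and> (\<forall>a \<in> carr A. h (j a) = (f \<circ> ?l) a) \<and> (\<forall>c \<in> carr C. h (k c) = g c) \<and>
           (\<forall>h'. hom ar P D h' \<and> (\<forall>a \<in> carr A. h' (j a) = (f \<circ> ?l) a) \<and>
                 (\<forall>c \<in> carr C. h' (k c) = g c) \<longrightarrow> (\<forall>p \<in> carr P. h' p = h p))"
      using co D unfolding coproduct_def by blast
    moreover have "(\<forall>a \<in> carr A. h' (j a) = (f \<circ> ?l) a) \<longleftrightarrow> (\<forall>a \<in> carr A'. h' ((j \<circ> i) a) = f a)" for h'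
    proof
      assume *: "\<forall>a \<in> carr A. h' (j a) = (f \<circ> ?l) a"
      show "\<forall>a \<in> carr A'. h' ((j \<circ> i) a) = f a" using * li homD[OF h(1)] by simp
    next
      assume *: "\<forall>a \<in> carr A'. h' ((j \<circ> i) a) = f a"
      show "\<forall>a \<in> carr A. h' (j a) = (f \<circ> ?l) a" using * il homD[OF h(2)] by (metis comp_apply)
    qed
    ultimately show "\<exists>h. hom ar P D h \<and> (\<forall>a \<in> carr A'. h ((j \<circ> i) a) = f a) \<and> (\<forall>c \<in> carr C. h (k c) = g c) \<and>
           (\<forall>h'. hom ar P D h' \<and> (\<forall>a \<in> carr A'. h' ((j \<circ> i) a) = f a) \<and>
                 (\<forall>c \<in> carr C. h' (k c) = g c) \<longrightarrow> (\<forall>p \<in> carr P. h' p = h p))"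
      by (simp only:)
  qed (use A' c in auto)
qed

text \<open>The endomorphism that sends \<open>x\<close> to \<open>y\<close> and fixes the other
  basis elements is the identity on the closure of \<open>X'\<close>. Some \<open>y\<close> other
  than \<open>x\<close> has to exist: a one-element algebra generated by a constant may have that
  constant as a basis.\<close>

lemma basis_not_in_cl:
  assumes "free_on ar V A X" "X' \<subseteq> X" "x \<in> X - X'" "y \<in> carr A" "y \<noteq> x"
  shows "x \<notin> cl ar A X'"
proof
  assume x: "x \<in> cl ar A X'"
  have A: "A \<in> V" "is_alg ar A" "X \<subseteq> carr A" "X' \<subseteq> carr A"
    using assms free_on_V free_on_alg free_on_carr is_alg by (blast+)
  obtain h where h: "hom ar A A h" "\<And>z. z \<in> X \<Longrightarrow> h z = (if z = x then y else z)"
    using free_on_hom[OF assms(1) A(1), of "\<lambda>z. if z = x then y else z"] A assms(4) by auto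
  have "h x = id x"
    by (rule hom_eq_on_cl[OF A(2,4) h(1) hom_id[OF subalg_refl[OF A(2)]] _ x]) (use h(2) assms in auto)
  then show False using h(2) assms by auto
qed

text \<open>Finitely many elements of \<open>X\<close> generate \<open>Y\<close> and hence all of
  \<open>A\<close>. If \<open>X\<close> is infinite, two further elements of \<open>X\<close>
  contradict \<open>basis_not_in_cl\<close>.\<close>

lemma finite_basis:
  assumes "free_on ar V A X" "free_on ar V A Y" "finite Y"
  shows "finite X"
proof (rule ccontr)
  assume "infinite X"
  have A: "is_alg ar A" "X \<subseteq> carr A" "Y \<subseteq> carr A"
    using assms free_on_alg free_on_carr by (blast+)
  obtain F where F: "finite F" "F \<subseteq> X" "Y \<subseteq> cl ar A F"
    using cl_finite_support_set[OF A(1,2) _ assms(3)] free_on_cl[OF assms(1)] A(3) by blast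
  then have "carr A \<subseteq> cl ar A F" 
    using cl_cl_subset[OF A(1)] F A free_on_cl[OF assms(2)] by (metis subset_trans)
  moreover have "infinite (X - F)" using \<open>infinite X\<close> F by simp
  then obtain x where "x \<in> X - F" by (metis ex_in_conv finite.emptyI)
  moreover have "infinite (X - F - {x})" using \<open>infinite (X - F)\<close> by simp
  then obtain y where "y \<in> X - F - {x}" by (metis ex_in_conv finite.emptyI)
  ultimately show False using basis_not_in_cl[OF assms(1) F(2), of x y] A by blast
qed

text \<open>The extensions to the stages \<open>gen ar B (G i)\<close> are compatible by uniqueness
  and hence glue together; the arguments of an operation all lie in a common stage.\<close>

lemma free_on_chain:
  assumes B: "B \<in> V" and G: "mono G" "\<And>i :: nat. G i \<subseteq> carr B" "\<And>i. free_on ar V (gen ar B (G i)) (G i)"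
    and c: "carr B \<subseteq> (\<Union>i. cl ar B (G i))"
  shows "free_on ar V B (\<Union>i. G i)"
proof (rule free_onI)
  have a: "is_alg ar B" using B is_alg by blast
  show UG: "(\<Union>i. G i) \<subseteq> carr B" using G by blast
  show "carr B \<subseteq> cl ar B (\<Union>i. G i)"
    using c cl_mono[OF a UG] by blast
  have mono: "cl ar B (G i) \<subseteq> cl ar B (G j)" if "i \<le> j" for i j
    using cl_mono[OF a G(2)] monoD[OF G(1) that] by simp
  fix D f assume D: "D \<in> V" "f ` (\<Union>i. G i) \<subseteq> carr D"
  have "\<exists>h. hom ar (gen ar B (G i)) D h \<and> (\<forall>x \<in> G i. h x = f x)" for i
  proof -
    have "f ` G i \<subseteq> carr D" using D(2) by blast
    then show ?thesis by (rule free_on_hom[OF G(3) D(1)]) blast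
  qed
  then obtain H where H: "\<And>i. hom ar (gen ar B (G i)) D (H i)" "\<And>i x. x \<in> G i \<Longrightarrow> H i x = f x"
    by metis
  have HH: "H i x = H j x" if "i \<le> j" "x \<in> cl ar B (G i)" for i j x
  proof (rule free_on_unique[OF G(3) D(1) H(1) _ _ that(2)])
    have *: "G i \<subseteq> cl ar B (G j)" using mono[OF that(1)] cl_superset[of "G i" ar B] by blast
    have "subalg ar (gen ar B (G i)) (gen ar B (G j))"
      using subalg_gen[OF is_alg_gen *] by (simp add: gen_gen[OF a G(2) *])
    then show "hom ar (gen ar B (G i)) D (H j)" using hom_restrict H(1) by blast
    show "H i x = H j x" if "x \<in> G i" for x
      using H(2)[OF that] H(2)[of x j] that monoD[OF G(1) \<open>i \<le> j\<close>] by auto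
  qed
  \<comment> \<open>The least stage is only a canonical choice: by \<open>HH\<close> any stage that
    contains \<open>x\<close> gives the same value.\<close>
  define h where "h x = H (LEAST i. x \<in> cl ar B (G i)) x" for x
  have h: "h x = H i x" if "x \<in> cl ar B (G i)" for x i
    unfolding h_def using that by (metis HH LeastI Least_le)
  have "hom ar B D h"
    unfolding hom_def
  proof (intro conjI allI impI)
    show "h ` carr B \<subseteq> carr D" using c h homD[OF H(1)] by fastforce
    fix f xs assume *: "ar f = Some (length xs) \<and> set xs \<subseteq> carr B"
    have "\<exists>i. set xs \<subseteq> cl ar B (G i)" if "set xs \<subseteq> carr B" for xs
      using that
    proof (induction xs)
      case (Cons x xs)
      then obtain i j where "set xs \<subseteq> cl ar B (G i)" "x \<in> cl ar B (G j)" using c by auto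
      then have "set (x # xs) \<subseteq> cl ar B (G (max i j))" using mono[of i "max i j"] mono[of j "max i j"] by auto
      then show ?case by blast
    qed auto
    then obtain i where i: "set xs \<subseteq> cl ar B (G i)" using * by blast
    then have "h (op B f xs) = H i (op B f xs)" using h op_in_cl * by metis
    also have "\<dots> = op D f (map (H i) xs)" using hom_op[OF H(1)[of i], of f xs] i * by simp
    also have "map (H i) xs = map h xs" using h i by auto
    finally show "h (op B f xs) = op D f (map h xs)" .
  qed
  moreover have "h x = f x" if "x \<in> G i" for x i
    using h[of x i] H(2) that cl_superset by (metis subsetD)
  ultimately show "\<exists>h. hom ar B D h \<and> (\<forall>x\<in>\<Union> (range G). h x = f x)" by blast
qed (fact B)

text \<open>The value of a term at \<open>xs\<close> is sent to its value at \<open>ys\<close>.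
  Agreement of the two tuples on equations makes this map well defined and injective.\<close>

lemma iso_of_same_equations:
  assumes A: "A \<in> V" and len: "length xs = length ys" and xy: "set xs \<subseteq> carr A" "set ys \<subseteq> carr A"
    and eq: "\<And>s t. wf_tm ar s \<Longrightarrow> wf_tm ar t \<Longrightarrow> fv_tm s \<union> fv_tm t \<subseteq> {..<length xs} \<Longrightarrow>
      eval_tm A ((!) xs) s = eval_tm A ((!) xs) t \<longleftrightarrow> eval_tm A ((!) ys) s = eval_tm A ((!) ys) t"
  obtains h where "iso ar (gen ar A (set xs)) (gen ar A (set ys)) h" 
    "\<And>t. wf_tm ar t \<Longrightarrow> fv_tm t \<subseteq> {..<length xs} \<Longrightarrow> h (eval_tm A ((!) xs) t) = eval_tm A ((!) ys) t"
proof -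
  have a: "is_alg ar A" using A is_alg by blast
  let ?W = "{t. wf_tm ar t \<and> fv_tm t \<subseteq> {..<length xs}}"
  have "\<forall>x\<in>cl ar A (set xs). \<exists>t. t \<in> ?W \<and> x = eval_tm A ((!) xs) t"
    using cl_set_eval[OF a xy(1)] by blast
  then obtain T where T: "\<And>x. x \<in> cl ar A (set xs) \<Longrightarrow> T x \<in> ?W \<and> x = eval_tm A ((!) xs) (T x)" by metis
  define h where "h x = eval_tm A ((!) ys) (T x)" for x
  have inx: "eval_tm A ((!) xs) t \<in> cl ar A (set xs)" if "t \<in> ?W" for t
    using that by (intro eval_tm_in_cl) (use cl_superset in fastforce)+
  have iny: "eval_tm A ((!) ys) t \<in> cl ar A (set ys)" if "t \<in> ?W" for t
    using that len by (intro eval_tm_in_cl) (use cl_superset in fastforce)+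
  have h: "h (eval_tm A ((!) xs) t) = eval_tm A ((!) ys) t" if "t \<in> ?W" for t
    unfolding h_def using T[OF inx[OF that]] that eq[of "T (eval_tm A ((!) xs) t)" t] by auto
  have "hom ar (gen ar A (set xs)) (gen ar A (set ys)) h"
    unfolding hom_def
  proof (intro conjI allI impI)
    show "h ` cl ar A (set xs) \<subseteq> cl ar A (set ys)" using T iny by (auto simp: h_def)
    fix f zs assume *: "ar f = Some (length zs) \<and> set zs \<subseteq> cl ar A (set xs)"
    let ?t = "Fun f (map T zs)"
    have "?t \<in> ?W" using * T by (fastforce simp: list_all_iff)
    moreover have "map (eval_tm A ((!) xs) \<circ> T) zs = zs" using T * by (intro map_idI) auto
    moreover have "map (eval_tm A ((!) ys) \<circ> T) zs = map h zs" by (simp add: h_def)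
    ultimately show "h (op (gen ar A (set xs)) f zs) = op (gen ar A (set ys)) f (map h zs)"
      using h[of ?t] by (simp add: comp_def cong: map_cong)
  qed
  moreover have "bij_betw h (cl ar A (set xs)) (cl ar A (set ys))"
  proof (rule bij_betw_imageI)
    show "inj_on h (cl ar A (set xs))"
    proof (rule inj_onI)
      fix x y assume *: "x \<in> cl ar A (set xs)" "y \<in> cl ar A (set xs)" "h x = h y"
      then show "x = y" using T[of x] T[of y] eq[of "T x" "T y"] by (auto simp: h_def)
    qed
    have "y \<in> h ` cl ar A (set xs)" if "y \<in> cl ar A (set ys)" for y
      using cl_set_eval[OF a xy(2) that] h inx len by (metis (mono_tags, lifting) imageI mem_Collect_eq)
    then show "h ` cl ar A (set xs) = cl ar A (set ys)" using T iny by (auto simp: h_def)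
  qed
  ultimately have "iso ar (gen ar A (set xs)) (gen ar A (set ys)) h" by (simp add: iso_def)
  then show ?thesis using that h by blast
qed

end

section \<open>Definable relations\<close>

lemma finite_fv_tm [simp]: "finite (fv_tm t)"
  by (induction t) auto

lemma finite_fv [simp]: "finite (fv \<phi>)"
  by (induction \<phi>) auto

lemma sat_cong: "(\<And>i. i \<in> fv \<phi> \<Longrightarrow> v i = w i) \<Longrightarrow> sat M \<phi> v \<longleftrightarrow> sat M \<phi> w"
proof (induction \<phi> arbitrary: v w)
  case (Eq s t)
  have "eval_tm M v s = eval_tm M w s" by (rule eval_tm_cong, rule Eq.prems) simp
  moreover have "eval_tm M v t = eval_tm M w t" by (rule eval_tm_cong, rule Eq.prems) simp
  ultimately show ?case by (simp only: sat.simps)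
next
  case (Neg \<phi>)
  have "sat M \<phi> v \<longleftrightarrow> sat M \<phi> w" by (rule Neg.IH, rule Neg.prems) simp
  then show ?case by simp
next
  case (Conj \<phi> \<psi>)
  have "sat M \<phi> v \<longleftrightarrow> sat M \<phi> w" by (rule Conj.IH(1), rule Conj.prems) simp
  moreover have "sat M \<psi> v \<longleftrightarrow> sat M \<psi> w" by (rule Conj.IH(2), rule Conj.prems) simp
  ultimately show ?case by simp
next
  case (Ex x \<phi>)
  have "sat M \<phi> (v(x := a)) \<longleftrightarrow> sat M \<phi> (w(x := a))" for a
    using Ex.prems by (intro Ex.IH) auto
  then show ?case by simp
qed

section \<open>Capture-avoiding substitution\<close>

primrec subst_tm :: "'f tm \<Rightarrow> (nat \<Rightarrow> 'f tm) \<Rightarrow> 'f tm" where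
  "subst_tm (Var x) = (\<lambda>\<sigma>. \<sigma> x)"
| "subst_tm (Fun f ts) = (\<lambda>\<sigma>. Fun f (map (\<lambda>t. subst_tm t \<sigma>) ts))"

text \<open>The bound variable is renamed to a number above all variables of the terms put in for
  the free variables of the body, which excludes capture. Inserting 0 keeps the maximum meaningful
  for an empty union.\<close>

primrec subst :: "'f fm \<Rightarrow> (nat \<Rightarrow> 'f tm) \<Rightarrow> 'f fm" where
  "subst (Eq s t) = (\<lambda>\<sigma>. Eq (subst_tm s \<sigma>) (subst_tm t \<sigma>))"
| "subst (Neg \<phi>) = (\<lambda>\<sigma>. Neg (subst \<phi> \<sigma>))"
| "subst (Conj \<phi> \<psi>) = (\<lambda>\<sigma>. Conj (subst \<phi> \<sigma>) (subst \<psi> \<sigma>))"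
| "subst (Ex x \<phi>) = (\<lambda>\<sigma>. let y = Suc (Max (insert 0 (\<Union>z\<in>fv \<phi>. fv_tm (\<sigma> z)))) in
     Ex y (subst \<phi> (\<sigma>(x := Var y))))"

lemma eval_subst_tm: "eval_tm M v (subst_tm t \<sigma>) = eval_tm M (\<lambda>i. eval_tm M v (\<sigma> i)) t"
proof (induction t)
  case (Fun f ts)
  then have "map (\<lambda>t. eval_tm M v (subst_tm t \<sigma>)) ts = map (eval_tm M (\<lambda>i. eval_tm M v (\<sigma> i))) ts"
    by (intro map_cong) auto
  then show ?case by (simp add: comp_def cong: map_cong)
qed simp

lemma wf_subst_tm: "wf_tm ar t \<Longrightarrow> (\<And>i. i \<in> fv_tm t \<Longrightarrow> wf_tm ar (\<sigma> i)) \<Longrightarrow> wf_tm ar (subst_tm t \<sigma>)"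
  by (induction t) (auto simp: list_all_iff)

lemma fv_subst_tm: "fv_tm (subst_tm t \<sigma>) \<subseteq> (\<Union>z\<in>fv_tm t. fv_tm (\<sigma> z))"
  by (induction t) fastforce+

lemma fresh_variable:
  assumes "i \<in> fv \<phi>"
  shows "Suc (Max (insert 0 (\<Union>z\<in>fv \<phi>. fv_tm (\<sigma> z)))) \<notin> fv_tm (\<sigma> i)"
proof
  let ?S = "insert 0 (\<Union>z\<in>fv \<phi>. fv_tm (\<sigma> z))"
  assume "Suc (Max ?S) \<in> fv_tm (\<sigma> i)"
  then have "Suc (Max ?S) \<in> ?S" using assms by auto
  then have "Suc (Max ?S) \<le> Max ?S" by (intro Max_ge) auto
  then show False by simp
qed

lemma wf_subst: "wf_fm ar \<phi> \<Longrightarrow> (\<And>i. i \<in> fv \<phi> \<Longrightarrow> wf_tm ar (\<sigma> i)) \<Longrightarrow> wf_fm ar (subst \<phi> \<sigma>)"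
  by (induction \<phi> arbitrary: \<sigma>) (auto simp: wf_subst_tm Let_def)

lemma fv_subst: "fv (subst \<phi> \<sigma>) \<subseteq> (\<Union>z\<in>fv \<phi>. fv_tm (\<sigma> z))"
proof (induction \<phi> arbitrary: \<sigma>)
  case (Eq s t)
  then show ?case using fv_subst_tm[of s \<sigma>] fv_subst_tm[of t \<sigma>] by auto
next
  case (Neg \<phi>)
  then show ?case by simp
next
  case (Conj \<phi> \<psi>)
  show ?case using Conj.IH(1)[of \<sigma>] Conj.IH(2)[of \<sigma>] by (simp add: Un_mono subset_iff)
next
  case (Ex x \<phi>)
  have "fv (subst \<phi> (\<sigma>(x := Var y))) - {y} \<subseteq> (\<Union>z\<in>fv \<phi> - {x}. fv_tm (\<sigma> z))" for y
  proof -
    have "(\<Union>z\<in>fv \<phi>. fv_tm ((\<sigma>(x := Var y)) z)) \<subseteq> insert y (\<Union>z\<in>fv \<phi> - {x}. fv_tm (\<sigma> z))"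
      by (auto split: if_splits)
    with Ex.IH[of "\<sigma>(x := Var y)"] have "fv (subst \<phi> (\<sigma>(x := Var y))) \<subseteq> insert y (\<Union>z\<in>fv \<phi> - {x}. fv_tm (\<sigma> z))"
      by (rule subset_trans)
    then show ?thesis by (simp only: Diff_subset_conv insert_is_Un[symmetric])
  qed
  then show ?case by (simp add: Let_def)
qed

lemma sat_subst: "sat M (subst \<phi> \<sigma>) v \<longleftrightarrow> sat M \<phi> (\<lambda>i. eval_tm M v (\<sigma> i))"
proof (induction \<phi> arbitrary: \<sigma> v)
  case (Ex x \<phi>)
  let ?y = "Suc (Max (insert 0 (\<Union>z\<in>fv \<phi>. fv_tm (\<sigma> z))))"
  have "sat M \<phi> (\<lambda>i. eval_tm M (v(?y := a)) ((\<sigma>(x := Var ?y)) i)) \<longleftrightarrow>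
        sat M \<phi> ((\<lambda>i. eval_tm M v (\<sigma> i))(x := a))" for a
  proof (rule sat_cong)
    fix i assume i: "i \<in> fv \<phi>"
    show "eval_tm M (v(?y := a)) ((\<sigma>(x := Var ?y)) i) = ((\<lambda>i. eval_tm M v (\<sigma> i))(x := a)) i"
    proof (cases "i = x")
      case False
      have "eval_tm M (v(?y := a)) (\<sigma> i) = eval_tm M v (\<sigma> i)"
        using fresh_variable[OF i, of \<sigma>] by (intro eval_tm_cong) (metis fun_upd_other)
      then show ?thesis using False by simp
    qed simp
  qed
  then show ?case by (simp add: Let_def Ex.IH fun_upd_def)
qed (simp_all add: eval_subst_tm)

text \<open>Finiteness is not expressible, but a fixed bound is: there are at most
  \<open>Suc N\<close> solutions iff for some \<open>w\<close> at most \<open>N\<close> of them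
  differ from \<open>w\<close>. The carrier must be nonempty so that \<open>w\<close> can be chosen
  even when there is no solution. One formula \<open>\<chi>\<close> serves all such algebras, which
  allows comparing two of them.\<close>

lemma ex_at_most_formula:
  "\<exists>\<chi>. (wf_fm ar \<phi> \<longrightarrow> wf_fm ar \<chi>) \<and> fv \<chi> \<subseteq> fv \<phi> - {y} \<and>
     (\<forall>M :: ('f, 'u) alg. carr M \<noteq> {} \<longrightarrow> (\<forall>v. sat M \<chi> v \<longleftrightarrow>
        finite {c \<in> carr M. sat M \<phi> (v(y := c))} \<and> card {c \<in> carr M. sat M \<phi> (v(y := c))} \<le> N))"
proof (induction N arbitrary: \<phi>)
  case 0
  have "\<not> (\<exists>a\<in>carr M. sat M \<phi> (v(y := a))) \<longleftrightarrow>
      finite {c \<in> carr M. sat M \<phi> (v(y := c))} \<and> card {c \<in> carr M. sat M \<phi> (v(y := c))} \<le> 0"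
    for M :: "('f, 'u) alg" and v
    by (metis (no_types, lifting) Collect_empty_eq card.empty card_0_eq finite.emptyI le_zero_eq)
  then show ?case
    by (intro exI[of _ "Neg (Ex y \<phi>)"]) (simp only: wf_fm.simps fv.simps sat.simps, blast)
next
  case (Suc N)
  obtain w where w: "w \<notin> insert y (fv \<phi>)"
    using ex_new_if_finite[of "insert y (fv \<phi>)"] by auto
  let ?\<phi> = "Conj \<phi> (Neg (Eq (Var y) (Var w)))"
  obtain \<chi> where \<chi>: "wf_fm ar ?\<phi> \<longrightarrow> wf_fm ar \<chi>" "fv \<chi> \<subseteq> fv ?\<phi> - {y}"
    and s: "\<And>(M :: ('f, 'u) alg) v. carr M \<noteq> {} \<Longrightarrow> sat M \<chi> v \<longleftrightarrow>
        finite {c \<in> carr M. sat M ?\<phi> (v(y := c))} \<and> card {c \<in> carr M. sat M ?\<phi> (v(y := c))} \<le> N"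
    using Suc[of ?\<phi>] by blast
  show ?case
  proof (intro exI[of _ "Ex w \<chi>"] conjI allI impI)
    fix M :: "('f, 'u) alg" and v assume M: "carr M \<noteq> {}"
    let ?S = "{c \<in> carr M. sat M \<phi> (v(y := c))}"
    have S: "{c \<in> carr M. sat M ?\<phi> ((v(w := z))(y := c))} = ?S - {z}" for z
    proof -
      have "sat M \<phi> ((v(w := z))(y := c)) \<longleftrightarrow> sat M \<phi> (v(y := c))" for c
        using w by (intro sat_cong) auto
      then show ?thesis using w by auto
    qed
    have "sat M (Ex w \<chi>) v \<longleftrightarrow> (\<exists>z\<in>carr M. finite (?S - {z}) \<and> card (?S - {z}) \<le> N)"
      unfolding sat.simps(4) s[OF M] S ..
    also have "\<dots> \<longleftrightarrow> finite ?S \<and> card ?S \<le> Suc N"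
    proof
      assume "\<exists>z\<in>carr M. finite (?S - {z}) \<and> card (?S - {z}) \<le> N"
      then obtain z where z: "finite (?S - {z})" "card (?S - {z}) \<le> N" by blast
      then have "card ?S - 1 \<le> N" by (metis card_Diff_singleton_if diff_le_self le_trans)
      with z show "finite ?S \<and> card ?S \<le> Suc N" by auto
    next
      assume *: "finite ?S \<and> card ?S \<le> Suc N"
      show "\<exists>z\<in>carr M. finite (?S - {z}) \<and> card (?S - {z}) \<le> N"
      proof (cases "?S = {}")
        case True
        show ?thesis unfolding True using M by auto
      next
        case False
        then obtain z where "z \<in> ?S" by blast
        then show ?thesis using * by (intro bexI[of _ z]) auto
      qed
    qed
    finally show "sat M (Ex w \<chi>) v \<longleftrightarrow> finite ?S \<and> card ?S \<le> Suc N" .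
  qed (use \<chi> in auto)
qed

lemma at_most_formula:
  assumes "wf_fm ar \<phi>"
  obtains \<chi> where "wf_fm ar \<chi>" "fv \<chi> \<subseteq> fv \<phi> - {y}"
    "\<And>(M :: ('f, 'u) alg) v. carr M \<noteq> {} \<Longrightarrow> sat M \<chi> v \<longleftrightarrow>
        finite {c \<in> carr M. sat M \<phi> (v(y := c))} \<and> card {c \<in> carr M. sat M \<phi> (v(y := c))} \<le> N"
proof -
  obtain \<chi> where \<chi>: "(wf_fm ar \<phi> \<longrightarrow> wf_fm ar \<chi>) \<and> fv \<chi> \<subseteq> fv \<phi> - {y} \<and>
     (\<forall>M :: ('f, 'u) alg. carr M \<noteq> {} \<longrightarrow> (\<forall>v. sat M \<chi> v \<longleftrightarrow>
        finite {c \<in> carr M. sat M \<phi> (v(y := c))} \<and> card {c \<in> carr M. sat M \<phi> (v(y := c))} \<le> N))"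
    using ex_at_most_formula[of ar \<phi> y N] by (elim exE)
  show ?thesis by (rule that[of \<chi>]) (use \<chi> assms in \<open>simp_all only: simp_thms\<close>)
qed

text \<open>The number of solutions in \<open>A\<close> is a bound that a formula can express, so it
  passes to \<open>B\<close> and the solution set stays finite there.\<close>

lemma acl_elem_sub:
  fixes A B :: "('f, 'u) alg"
  assumes "elem_sub ar A B" "S \<subseteq> carr A"
  shows "acl ar A S \<subseteq> acl ar B S"
proof
  fix b assume "b \<in> acl ar A S"
  then obtain \<phi> y v where b: "b \<in> carr A" "wf_fm ar \<phi>" "v ` (fv \<phi> - {y}) \<subseteq> S" "sat A \<phi> (v(y := b))"
    and fin: "finite {c \<in> carr A. sat A \<phi> (v(y := c))}"
    unfolding acl_def by blast
  have e: "sat A \<psi> w \<longleftrightarrow> sat B \<psi> w" if "wf_fm ar \<psi>" "w ` fv \<psi> \<subseteq> carr A" for \<psi> w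
    using assms that unfolding elem_sub_def by blast
  have AB: "carr A \<subseteq> carr B" using assms by (auto simp: elem_sub_def subalg_def)
  let ?N = "card {c \<in> carr A. sat A \<phi> (v(y := c))}"
  obtain \<chi> where \<chi>: "wf_fm ar \<chi>" "fv \<chi> \<subseteq> fv \<phi> - {y}"
    and s: "\<And>(M :: ('f, 'u) alg) v. carr M \<noteq> {} \<Longrightarrow> sat M \<chi> v \<longleftrightarrow>
        finite {c \<in> carr M. sat M \<phi> (v(y := c))} \<and> card {c \<in> carr M. sat M \<phi> (v(y := c))} \<le> ?N"
    by (rule at_most_formula[OF b(2), of y ?N]) (rule that)
  have "sat A \<chi> v" using s[of A v] b(1) fin by auto
  then have "sat B \<chi> v" using e[OF \<chi>(1), of v] \<chi>(2) b(3) assms(2) by blast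
  then have "finite {c \<in> carr B. sat B \<phi> (v(y := c))}" using s[of B v] b(1) AB by auto
  moreover have "sat B \<phi> (v(y := b))"
    using e[OF b(2), of "v(y := b)"] b assms(2) by auto
  ultimately show "b \<in> acl ar B S" using b AB unfolding acl_def by blast
qed

text \<open>Definability without parameters, tested only on tuples of length \<open>n\<close>.
  Formulas can thereby be assembled as predicates on lists, without writing down their
  syntax.\<close>

definition definable :: "'f lang \<Rightarrow> ('f, 'u) alg \<Rightarrow> nat \<Rightarrow> ('u list \<Rightarrow> bool) \<Rightarrow> bool" where
  "definable ar M n R \<longleftrightarrow> (\<exists>\<phi>. fm_in ar n \<phi> \<and> (\<forall>w\<in>tuples M n. holds M \<phi> w \<longleftrightarrow> R w))"

lemma definable_holds: "fm_in ar n \<phi> \<Longrightarrow> definable ar M n (holds M \<phi>)"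
  unfolding definable_def by blast

lemma definable_cong:
  assumes "definable ar M n R" "\<And>w. w \<in> tuples M n \<Longrightarrow> R w \<longleftrightarrow> R' w"
  shows "definable ar M n R'"
  using assms unfolding definable_def by metis

lemma definable_not: "definable ar M n R \<Longrightarrow> definable ar M n (\<lambda>w. \<not> R w)"
  unfolding definable_def
proof (elim exE conjE)
  fix \<phi> assume "fm_in ar n \<phi>" "\<forall>w\<in>tuples M n. holds M \<phi> w \<longleftrightarrow> R w"
  then show "\<exists>\<phi>. fm_in ar n \<phi> \<and> (\<forall>w\<in>tuples M n. holds M \<phi> w \<longleftrightarrow> \<not> R w)"
    by (intro exI[of _ "Neg \<phi>"]) (auto simp: fm_in_def holds_def)
qed

lemma definable_conj:
  "definable ar M n R \<Longrightarrow> definable ar M n R' \<Longrightarrow> definable ar M n (\<lambda>w. R w \<and> R' w)"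
  unfolding definable_def
proof (elim exE conjE)
  fix \<phi> \<psi> assume "fm_in ar n \<phi>" "\<forall>w\<in>tuples M n. holds M \<phi> w \<longleftrightarrow> R w"
    "fm_in ar n \<psi>" "\<forall>w\<in>tuples M n. holds M \<psi> w \<longleftrightarrow> R' w"
  then show "\<exists>\<phi>. fm_in ar n \<phi> \<and> (\<forall>w\<in>tuples M n. holds M \<phi> w \<longleftrightarrow> R w \<and> R' w)"
    by (intro exI[of _ "Conj \<phi> \<psi>"]) (auto simp: fm_in_def holds_def)
qed

lemma definable_True: "definable ar M n (\<lambda>w. True)"
  unfolding definable_def
  by (rule exI[of _ "Neg (Ex 0 (Neg (Eq (Var 0) (Var 0))))"]) (auto simp: fm_in_def holds_def)

lemma definable_ball:
  assumes "finite J" "\<And>j. j \<in> J \<Longrightarrow> definable ar M n (R j)"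
  shows "definable ar M n (\<lambda>w. \<forall>j\<in>J. R j w)"
  using assms
proof (induction J rule: finite_induct)
  case (insert j J)
  then have "definable ar M n (\<lambda>w. R j w \<and> (\<forall>j\<in>J. R j w))" by (intro definable_conj) auto
  then show ?case by (rule definable_cong) auto
qed (use definable_True in auto)

lemma definable_bex:
  assumes "finite J" "\<And>j. j \<in> J \<Longrightarrow> definable ar M n (R j)"
  shows "definable ar M n (\<lambda>w. \<exists>j\<in>J. R j w)"
proof -
  have "definable ar M n (\<lambda>w. \<not> (\<forall>j\<in>J. \<not> R j w))"
    using assms by (intro definable_not definable_ball)
  then show ?thesis by (rule definable_cong) auto
qed

lemma definable_sat:
  assumes "wf_fm ar \<phi>" "\<And>i. i \<in> fv \<phi> \<Longrightarrow> wf_tm ar (\<sigma> i) \<and> fv_tm (\<sigma> i) \<subseteq> {..<n}"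
  shows "definable ar M n (\<lambda>w. sat M \<phi> (\<lambda>i. eval_tm M ((!) w) (\<sigma> i)))"
proof -
  have "fv (subst \<phi> \<sigma>) \<subseteq> {..<n}"
    using fv_subst[of \<phi> \<sigma>] assms(2) by blast
  then have "fm_in ar n (subst \<phi> \<sigma>)"
    using assms wf_subst[of ar \<phi> \<sigma>] by (simp add: fm_in_def)
  then show ?thesis unfolding definable_def holds_def by (metis sat_subst)
qed

text \<open>The list \<open>js\<close> tells which entries of the longer tuple \<open>w\<close> are
  handed to \<open>R\<close>, and in which order; all rearrangements of variables below are of this
  form.\<close>

lemma definable_reindex:
  assumes "definable ar M n R" "length js = n" "set js \<subseteq> {..<m}"
  shows "definable ar M m (\<lambda>w. R (map ((!) w) js))"
proof -
  obtain \<phi> where \<phi>: "wf_fm ar \<phi>" "fv \<phi> \<subseteq> {..<n}" "\<And>w. w \<in> tuples M n \<Longrightarrow> sat M \<phi> ((!) w) \<longleftrightarrow> R w"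
    using assms(1) unfolding definable_def fm_in_def holds_def by blast
  have "definable ar M m (\<lambda>w. sat M \<phi> (\<lambda>i. eval_tm M ((!) w) (Var (js ! i))))"
    using \<phi> assms by (intro definable_sat) (auto simp: subset_iff)
  then show ?thesis
  proof (rule definable_cong)
    fix w assume w: "w \<in> tuples M m"
    then have t: "map ((!) w) js \<in> tuples M n"
      using assms by (auto simp: tuples_def subset_iff)
    have "sat M \<phi> (\<lambda>i. eval_tm M ((!) w) (Var (js ! i))) \<longleftrightarrow> sat M \<phi> ((!) (map ((!) w) js))"
      using \<phi>(2) assms(2) by (intro sat_cong) auto
    then show "sat M \<phi> (\<lambda>i. eval_tm M ((!) w) (Var (js ! i))) \<longleftrightarrow> R (map ((!) w) js)"
      using \<phi>(3)[OF t] by simp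
  qed
qed

lemma holds_snoc: 
  assumes "fv \<phi> \<subseteq> {..<Suc (length w)}"
  shows "sat M \<phi> (((!) w)(length w := x)) \<longleftrightarrow> holds M \<phi> (w @ [x])"
  unfolding holds_def using assms by (intro sat_cong) (auto simp: nth_append less_Suc_eq)

lemma tuples_snoc: "w \<in> tuples M n \<Longrightarrow> x \<in> carr M \<Longrightarrow> w @ [x] \<in> tuples M (Suc n)"
  by (auto simp: tuples_def)

lemma definable_ex:
  assumes "definable ar M (Suc n) R"
  shows "definable ar M n (\<lambda>w. \<exists>x\<in>carr M. R (w @ [x]))"
proof -
  obtain \<phi> where \<phi>: "fm_in ar (Suc n) \<phi>" "\<And>w. w \<in> tuples M (Suc n) \<Longrightarrow> holds M \<phi> w \<longleftrightarrow> R w"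
    using assms(1) unfolding definable_def by blast
  show ?thesis
    unfolding definable_def
  proof (intro exI[of _ "Ex n \<phi>"] conjI ballI)
    show "fm_in ar n (Ex n \<phi>)" using \<phi>(1) by (auto simp: fm_in_def)
    fix w assume w: "w \<in> tuples M n"
    then have "length w = n" by (simp add: tuples_def)
    moreover have "fv \<phi> \<subseteq> {..<Suc (length w)}" using \<phi>(1) \<open>length w = n\<close> by (auto simp: fm_in_def)
    ultimately show "holds M (Ex n \<phi>) w \<longleftrightarrow> (\<exists>x\<in>carr M. R (w @ [x]))"
      using holds_snoc[of \<phi> w M] \<phi>(2)[OF tuples_snoc[OF w]] by (simp add: holds_def)
  qed
qed

lemma definable_at_most:
  fixes M :: "('f, 'u) alg"
  assumes "definable ar M (Suc n) R" "carr M \<noteq> {}"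
  shows "definable ar M n (\<lambda>w. finite {x\<in>carr M. R (w @ [x])} \<and> card {x\<in>carr M. R (w @ [x])} \<le> N)"
proof -
  obtain \<phi> where \<phi>: "fm_in ar (Suc n) \<phi>" "\<And>w. w \<in> tuples M (Suc n) \<Longrightarrow> holds M \<phi> w \<longleftrightarrow> R w"
    using assms(1) unfolding definable_def by blast
  have "wf_fm ar \<phi>" using \<phi>(1) by (simp add: fm_in_def)
  then obtain \<chi> where \<chi>: "wf_fm ar \<chi>" "fv \<chi> \<subseteq> fv \<phi> - {n}"
    and s: "\<And>(M :: ('f, 'u) alg) v. carr M \<noteq> {} \<Longrightarrow> sat M \<chi> v \<longleftrightarrow>
        finite {c \<in> carr M. sat M \<phi> (v(n := c))} \<and> card {c \<in> carr M. sat M \<phi> (v(n := c))} \<le> N"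
    by (rule at_most_formula[of ar \<phi> n N]) (rule that)
  show ?thesis
    unfolding definable_def
  proof (intro exI[of _ \<chi>] conjI ballI)
    show "fm_in ar n \<chi>" using \<phi>(1) \<chi> by (auto simp: fm_in_def subset_iff less_Suc_eq)
    fix w assume w: "w \<in> tuples M n"
    then have l: "length w = n" by (simp add: tuples_def)
    moreover have "fv \<phi> \<subseteq> {..<Suc (length w)}" using \<phi>(1) l by (auto simp: fm_in_def)
    ultimately have "{c \<in> carr M. sat M \<phi> (((!) w)(n := c))} = {x\<in>carr M. R (w @ [x])}"
      using holds_snoc[of \<phi> w M] \<phi>(2)[OF tuples_snoc[OF w]] by auto
    then show "holds M \<chi> w \<longleftrightarrow> finite {x\<in>carr M. R (w @ [x])} \<and> card {x\<in>carr M. R (w @ [x])} \<le> N"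
      using s[OF assms(2)] by (simp add: holds_def)
  qed
qed

lemma definable_ex_tuple:
  assumes "definable ar M (n + q) R"
  shows "definable ar M n (\<lambda>w. \<exists>xs\<in>tuples M q. R (w @ xs))"
  using assms
proof (induction q arbitrary: R)
  case 0
  then show ?case by (simp add: tuples_def)
next
  case (Suc q)
  then have "definable ar M (n + q) (\<lambda>w. \<exists>x\<in>carr M. R (w @ [x]))" by (intro definable_ex) simp
  then have "definable ar M n (\<lambda>w. \<exists>xs\<in>tuples M q. \<exists>x\<in>carr M. R ((w @ xs) @ [x]))"
    by (rule Suc.IH)
  then show ?case
  proof (rule definable_cong)
    fix w 
    show "(\<exists>xs\<in>tuples M q. \<exists>x\<in>carr M. R ((w @ xs) @ [x])) \<longleftrightarrow> (\<exists>xs\<in>tuples M (Suc q). R (w @ xs))"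
    proof
      assume "\<exists>xs\<in>tuples M (Suc q). R (w @ xs)"
      then obtain xs where xs: "xs \<in> tuples M (Suc q)" "R (w @ xs)" by blast
      then have "xs \<noteq> []" by (auto simp: tuples_def)
      then have "xs = butlast xs @ [last xs]" by simp
      moreover have "butlast xs \<in> tuples M q" "last xs \<in> carr M"
        using xs \<open>xs \<noteq> []\<close> by (auto simp: tuples_def dest: in_set_butlastD)
      ultimately show "\<exists>xs\<in>tuples M q. \<exists>x\<in>carr M. R ((w @ xs) @ [x])"
        using xs(2) by (metis append.assoc)
    qed (metis append.assoc tuples_snoc)
  qed
qed

lemma map_nth_append_upt:
  "map ((!) (as @ bs @ cs)) [length as..<length as + length bs] = bs"
  by (rule nth_equalityI) (auto simp: nth_append)

text \<open>Automorphisms of \<open>P\<close> are the means of showing below that conjugate tuples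
  satisfy the same formulas.\<close>

lemma holds_iso:
  assumes "iso ar P P h" "fm_in ar n \<phi>" "w \<in> tuples P n"
  shows "holds P \<phi> (map h w) \<longleftrightarrow> holds P \<phi> w"
proof -
  have w: "length w = n" "set w \<subseteq> carr P" using assms(3) by (auto simp: tuples_def)
  have f: "wf_fm ar \<phi>" "fv \<phi> \<subseteq> {..<n}" using assms(2) by (auto simp: fm_in_def)
  have "w ! i \<in> carr P" if "i \<in> fv \<phi>" for i
    using w f that by (metis lessThan_iff nth_mem subsetD)
  then have "sat P \<phi> ((!) w) \<longleftrightarrow> sat P \<phi> (h \<circ> (!) w)"
    using f(1) by (intro sat_iso[OF assms(1)]) auto
  also have "\<dots> \<longleftrightarrow> sat P \<phi> ((!) (map h w))"
    using w f by (intro sat_cong) auto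
  finally show ?thesis by (simp add: holds_def)
qed

lemma acl_mono:
  assumes "S \<subseteq> S'"
  shows "acl ar M S \<subseteq> acl ar M S'"
proof
  fix b assume "b \<in> acl ar M S"
  then obtain \<phi> y v where *: "b \<in> carr M" "wf_fm ar \<phi>" "v ` (fv \<phi> - {y}) \<subseteq> S" "sat M \<phi> (v(y := b))"
    "finite {c \<in> carr M. sat M \<phi> (v(y := c))}"
    unfolding acl_def mem_Collect_eq by (elim conjE exE) (rule that)
  then show "b \<in> acl ar M S'"
    unfolding acl_def mem_Collect_eq using subset_trans[OF *(3) assms] 
    by (intro exI[of _ \<phi>] exI[of _ y] exI[of _ v] conjI)
qed

text \<open>Parameters from the closure are terms in \<open>w\<close>, so \<open>w\<close> itself
  can serve as the parameter tuple. The disjunction over the finite set \<open>S\<close> of the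
  formulas obtained still has finitely many solutions.\<close>

lemma acl_definable:
  assumes P: "is_alg ar P" and w: "w \<in> tuples P n" and e: "finite S" "S \<subseteq> acl ar P (cl ar P (set w))"
  obtains \<chi> where "fm_in ar (n + 1) \<chi>" "finite {x \<in> carr P. holds P \<chi> (w @ [x])}"
    "\<And>x. x \<in> S \<Longrightarrow> holds P \<chi> (w @ [x])"
proof -
  have w': "length w = n" "set w \<subseteq> carr P" using w by (auto simp: tuples_def)
  have "\<exists>R. definable ar P (n + 1) R \<and> finite {x \<in> carr P. R (w @ [x])} \<and> R (w @ [b])" if bS: "b \<in> S" for b
  proof -
    obtain \<phi> y v where b: "b \<in> carr P" "wf_fm ar \<phi>" "v ` (fv \<phi> - {y}) \<subseteq> cl ar P (set w)" "sat P \<phi> (v(y := b))"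
      and fin: "finite {c \<in> carr P. sat P \<phi> (v(y := c))}"
      using subsetD[OF e(2) bS] unfolding acl_def mem_Collect_eq by (elim conjE exE) (rule that)
    have "\<forall>i\<in>fv \<phi> - {y}. \<exists>t. wf_tm ar t \<and> fv_tm t \<subseteq> {..<n} \<and> v i = eval_tm P ((!) w) t"
      using cl_set_eval[OF P w'(2)] b(3) w'(1) by blast
    then obtain \<tau> where \<tau>: "\<And>i. i \<in> fv \<phi> - {y} \<Longrightarrow> wf_tm ar (\<tau> i) \<and> fv_tm (\<tau> i) \<subseteq> {..<n} \<and> v i = eval_tm P ((!) w) (\<tau> i)"
      by metis
    \<comment> \<open>Position \<open>n\<close> is that of \<open>x\<close> in
      \<open>w @ [x]\<close>: it receives the variable solved for, while every other free variable
      becomes a term in \<open>w\<close>.\<close>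
    let ?\<sigma> = "\<lambda>i. if i = y then Var n else \<tau> i"
    let ?R = "\<lambda>w. sat P \<phi> (\<lambda>i. eval_tm P ((!) w) (?\<sigma> i))"
    have "definable ar P (n + 1) ?R"
    proof (rule definable_sat[OF b(2)])
      fix i assume "i \<in> fv \<phi>"
      then have "i \<noteq> y \<Longrightarrow> wf_tm ar (\<tau> i) \<and> fv_tm (\<tau> i) \<subseteq> {..<n}" using \<tau> by blast
      then show "wf_tm ar (?\<sigma> i) \<and> fv_tm (?\<sigma> i) \<subseteq> {..<n + 1}"
        by (cases "i = y") (auto simp: subset_iff less_SucI)
    qed
    moreover have R: "?R (w @ [x]) \<longleftrightarrow> sat P \<phi> (v(y := x))" for x
    proof (rule sat_cong)
      fix i assume i: "i \<in> fv \<phi>"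
      show "eval_tm P ((!) (w @ [x])) (?\<sigma> i) = (v(y := x)) i"
      proof (cases "i = y")
        case False
        then have t: "fv_tm (\<tau> i) \<subseteq> {..<n}" "v i = eval_tm P ((!) w) (\<tau> i)" using \<tau> i by auto
        have "eval_tm P ((!) (w @ [x])) (\<tau> i) = eval_tm P ((!) w) (\<tau> i)"
          by (rule eval_tm_cong) (use t(1) w'(1) in \<open>auto simp: nth_append\<close>)
        then show ?thesis using False t by simp
      qed (use w'(1) in auto)
    qed
    ultimately show ?thesis
      by (intro exI[of _ ?R] conjI) (assumption, unfold R, rule fin, rule b(4))
  qed
  then obtain R where R: "\<And>b. b \<in> S \<Longrightarrow> definable ar P (n + 1) (R b) \<and> finite {x \<in> carr P. R b (w @ [x])} \<and> R b (w @ [b])"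
    by metis
  have "definable ar P (n + 1) (\<lambda>w. \<exists>b\<in>S. R b w)"
    using e(1) R by (intro definable_bex) auto
  then obtain \<chi> where \<chi>: "fm_in ar (n + 1) \<chi>" "\<And>w. w \<in> tuples P (n + 1) \<Longrightarrow> holds P \<chi> w \<longleftrightarrow> (\<exists>b\<in>S. R b w)"
    unfolding definable_def by blast
  have h: "holds P \<chi> (w @ [x]) \<longleftrightarrow> (\<exists>b\<in>S. R b (w @ [x]))" if "x \<in> carr P" for x
    using \<chi>(2)[of "w @ [x]"] tuples_snoc[OF w that] by simp
  have "{x \<in> carr P. holds P \<chi> (w @ [x])} = (\<Union>b\<in>S. {x \<in> carr P. R b (w @ [x])})"
    using h by auto
  then have "finite {x \<in> carr P. holds P \<chi> (w @ [x])}" using e(1) R by simp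
  moreover have "holds P \<chi> (w @ [x])" if "x \<in> S" for x
  proof -
    have "x \<in> carr P" using e(2) that unfolding acl_def by blast
    then show ?thesis using h R that by blast
  qed
  ultimately show ?thesis using that \<chi>(1) by blast
qed

section \<open>Forking and stability\<close>

text \<open>What remains of the two sets after removing finite sets is countably infinite and is
  matched through enumerations.\<close>

lemma extend_bij_betw:
  assumes A: "countable A" "infinite A" and B: "countable B" "infinite B"
    and f: "finite S" "S \<subseteq> A" "bij_betw f S S'" "S' \<subseteq> B"
  obtains g where "bij_betw g A B" "\<And>x. x \<in> S \<Longrightarrow> g x = f x"
proof -
  have "finite S'" using f bij_betw_finite by blast
  then have inf: "infinite (A - S)" "infinite (B - S')" using A B f by auto
  have c: "countable (A - S)" "countable (B - S')" using A B by auto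
  have "bij_betw (inv_into (B - S') (to_nat_on (B - S')) \<circ> to_nat_on (A - S)) (A - S) (B - S')"
    using to_nat_on_infinite[OF c(1) inf(1)] bij_betw_inv_into[OF to_nat_on_infinite[OF c(2) inf(2)]]
    by (rule bij_betw_trans)
  then obtain k where k: "bij_betw k (A - S) (B - S')" by blast
  have "bij_betw (\<lambda>x. if x \<in> S then f x else k x) (S \<union> (A - S)) (S' \<union> (B - S'))"
    using f(3) k by (rule bij_betw_disjoint_Un) auto
  moreover have "S \<union> (A - S) = A" "S' \<union> (B - S') = B" using f by auto
  ultimately show ?thesis using that[of "\<lambda>x. if x \<in> S then f x else k x"] by simp
qed

lemma elem_embedding_refl: "is_alg ar M \<Longrightarrow> elem_embedding ar M M id"
  unfolding elem_embedding_def by simp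

lemma dividing_forks:
  assumes "is_alg ar M" "set c \<subseteq> carr M" "fm_in ar (n + length c) \<phi>" "divides ar M n \<phi> c A"
  shows "forks ar M n \<phi> c A"
  unfolding forks_def
  by (rule exI[of _ M], rule exI[of _ id], rule exI[of _ "{(\<phi>, c)}"])
    (use assms elem_embedding_refl in auto)

text \<open>Forking is passed from \<open>e\<close> to \<open>u\<close>, over which together with
  \<open>g\<close> the tuple \<open>e\<close> is algebraic. The dividing formula says of
  \<open>u\<close> that \<open>\<phi>\<close> has a solution among the boundedly many elements
  algebraic over \<open>u\<close> and \<open>g\<close> by \<open>\<chi>\<close>. A tuple satisfying
  too many of its conjugates would yield one \<open>xs\<close> satisfying \<open>k\<close>
  conjugates of \<open>\<phi>\<close>.\<close>

lemma type_forks_if_algebraic: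
  fixes P :: "('f, 'u) alg" and s' :: "nat \<Rightarrow> 'u list"
  assumes P: "is_alg ar P" "carr P \<noteq> {}"
    and len: "u \<in> tuples P r" "g \<in> tuples P p" "s \<in> tuples P l" "\<And>i. s' i \<in> tuples P l"
    and \<phi>: "fm_in ar (q + (p + l)) \<phi>" "e \<in> tuples P q" "holds P \<phi> (e @ g @ s)"
    and alg: "fm_in ar (r + p + 1) \<chi>" "finite {x \<in> carr P. holds P \<chi> (u @ g @ [x])}"
       "\<And>x. x \<in> set e \<Longrightarrow> holds P \<chi> (u @ g @ [x])"
    and conj: "\<And>i. same_type ar P A\<^sub>0 (g @ s) (g @ s' i)"
    and incons: "\<And>I xs. finite I \<Longrightarrow> card I = k \<Longrightarrow> xs \<in> tuples P q \<Longrightarrow> \<exists>i\<in>I. \<not> holds P \<phi> (xs @ g @ s' i)"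
    and A: "set g \<union> set s \<subseteq> A"
  shows "type_forks ar P u A A\<^sub>0"
proof -
  \<comment> \<open>In \<open>b @ g @ t\<close> the positions below \<open>r\<close> belong to
    \<open>b\<close>, those from \<open>r\<close> to \<open>r + p\<close> to \<open>g\<close>, and
    the rest below \<open>n\<close> to \<open>t\<close>. Positions from \<open>n\<close> on carry
    the auxiliary \<open>x\<close> or \<open>xs\<close>.\<close>
  define n where "n = r + p + l"
  define U where "U b = {x \<in> carr P. holds P \<chi> (b @ g @ [x])}" for b
  define N where "N = card (U u)"
  \<comment> \<open>The formula below says of \<open>b\<close> that \<open>U b\<close> has at most \<open>N\<close> elements: only then
    does the pigeonhole principle turn inconsistency for \<open>xs\<close> into inconsistency for \<open>b\<close>.\<close>
  define R1 where "R1 = (\<lambda>w. holds P \<chi> (map ((!) w) ([0..<r + p] @ [n])))"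
  define R2 where "R2 = (\<lambda>w. (\<forall>j\<in>{..<q}. holds P \<chi> (map ((!) w) ([0..<r + p] @ [n + j]))) \<and>
    holds P \<phi> (map ((!) w) ([n..<n + q] @ [r..<n])))"
  have "definable ar P (Suc n) R1"
    unfolding R1_def
    by (rule definable_reindex[OF definable_holds[OF alg(1)]]) (auto simp: n_def)
  then have d1: "definable ar P n (\<lambda>w. finite {x\<in>carr P. R1 (w @ [x])} \<and> card {x\<in>carr P. R1 (w @ [x])} \<le> N)"
    using P(2) by (rule definable_at_most)
  have "definable ar P (n + q) R2"
    unfolding R2_def
  proof (intro definable_conj definable_ball)
    show "definable ar P (n + q) (\<lambda>w. holds P \<chi> (map ((!) w) ([0..<r + p] @ [n + j])))" if "j \<in> {..<q}" for j
      by (rule definable_reindex[OF definable_holds[OF alg(1)]]) (use that in \<open>auto simp: n_def\<close>)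
    show "definable ar P (n + q) (\<lambda>w. holds P \<phi> (map ((!) w) ([n..<n + q] @ [r..<n])))"
      by (rule definable_reindex[OF definable_holds[OF \<phi>(1)]]) (auto simp: n_def)
  qed simp
  then have "definable ar P n (\<lambda>w. \<exists>xs\<in>tuples P q. R2 (w @ xs))"
    by (rule definable_ex_tuple)
  with d1 have "definable ar P n (\<lambda>w. (finite {x\<in>carr P. R1 (w @ [x])} \<and> card {x\<in>carr P. R1 (w @ [x])} \<le> N) \<and>
      (\<exists>xs\<in>tuples P q. R2 (w @ xs)))"
    by (rule definable_conj)
  then obtain \<psi> where \<psi>: "fm_in ar n \<psi>" and \<psi>_iff: "\<And>w. w \<in> tuples P n \<Longrightarrow> holds P \<psi> w \<longleftrightarrow>
      (finite {x\<in>carr P. R1 (w @ [x])} \<and> card {x\<in>carr P. R1 (w @ [x])} \<le> N) \<and> (\<exists>xs\<in>tuples P q. R2 (w @ xs))"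
    unfolding definable_def by blast
  have holds_\<psi>: "holds P \<psi> (b @ g @ t) \<longleftrightarrow> finite (U b) \<and> card (U b) \<le> N \<and>
      (\<exists>xs\<in>tuples P q. set xs \<subseteq> U b \<and> holds P \<phi> (xs @ g @ t))"
    if b: "b \<in> tuples P r" and t: "t \<in> tuples P l" for b t
  proof -
    have l: "length b = r" "length g = p" "length t = l" using b t len by (auto simp: tuples_def)
    have m1: "map ((!) (b @ g @ t @ xs)) [0..<r + p] = b @ g" for xs
      using map_nth_append_upt[of "[]" "b @ g" "t @ xs"] l by simp
    have m2: "map ((!) (b @ g @ t @ xs)) [n..<n + q] = xs" if "length xs = q" for xs
      using map_nth_append_upt[of "b @ g @ t" xs "[]"] l that by (simp add: n_def add.assoc)
    have m3: "map ((!) (b @ g @ t @ xs)) [r..<n] = g @ t" for xs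
      using map_nth_append_upt[of b "g @ t" xs] l by (simp add: n_def add.assoc)
    have m4: "(b @ g @ t @ xs) ! (n + j) = xs ! j" for xs j
      using l nth_append_length_plus[of "b @ g @ t" xs j] by (simp add: n_def add.assoc)
    have "{x\<in>carr P. R1 ((b @ g @ t) @ [x])} = U b"
      using m1 m4[of _ 0] by (simp add: R1_def U_def)
    moreover have "R2 ((b @ g @ t) @ xs) \<longleftrightarrow> set xs \<subseteq> U b \<and> holds P \<phi> (xs @ g @ t)" if "xs \<in> tuples P q" for xs
    proof -
      have xs: "length xs = q" "set xs \<subseteq> carr P" using that by (auto simp: tuples_def)
      have "R2 ((b @ g @ t) @ xs) \<longleftrightarrow> (\<forall>j\<in>{..<q}. holds P \<chi> (b @ g @ [xs ! j])) \<and> holds P \<phi> (xs @ g @ t)"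
        using m1 m2 m3 m4 xs by (simp add: R2_def)
      also have "(\<forall>j\<in>{..<q}. holds P \<chi> (b @ g @ [xs ! j])) \<longleftrightarrow> set xs \<subseteq> U b"
        using xs by (auto simp: U_def in_set_conv_nth subset_iff)
      finally show ?thesis .
    qed
    moreover have "b @ g @ t \<in> tuples P n" using b t len by (auto simp: tuples_def n_def)
    ultimately show ?thesis using \<psi>_iff by auto
  qed
  have lg: "length (g @ s) = p + l" "length g = p" "length s = l" "length u = r" using len by (auto simp: tuples_def)
  have "divides ar P r \<psi> (g @ s) A\<^sub>0"
    unfolding divides_def
  \<comment> \<open>At most \<open>N ^ q\<close> tuples of length \<open>q\<close> lie in
    \<open>U b\<close>, so among \<open>N ^ q * k + 1\<close> indices some \<open>k\<close> share
    the same tuple. The summand 1 also makes \<open>I\<close> nonempty, which gives the bound on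
    \<open>U b\<close>.\<close>
  proof (rule exI[of _ P], rule exI[of _ id], rule exI[of _ "\<lambda>i. g @ s' i"], rule exI[of _ "N ^ q * k + 1"],
      intro conjI allI impI notI)
    fix I :: "nat set" assume I: "finite I \<and> card I = N ^ q * k + 1"
    assume "\<exists>b\<in>tuples P r. \<forall>i\<in>I. holds P \<psi> (b @ g @ s' i)"
    then obtain b where b: "b \<in> tuples P r" "\<And>i. i \<in> I \<Longrightarrow> holds P \<psi> (b @ g @ s' i)" by blast
    have "I \<noteq> {}" using I by auto
    then obtain i0 where "i0 \<in> I" by blast
    then have U: "finite (U b)" "card (U b) \<le> N" using b holds_\<psi>[OF b(1) len(4)] by auto
    let ?Q = "{xs. set xs \<subseteq> U b \<and> length xs = q}"
    have Q: "finite ?Q" "card ?Q \<le> N ^ q"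
      using finite_lists_length_eq[OF U(1), of q] card_lists_length_eq[OF U(1), of q] U(2) by (simp_all add: power_mono)
    have "\<exists>xs. xs \<in> tuples P q \<and> set xs \<subseteq> U b \<and> holds P \<phi> (xs @ g @ s' i)" if "i \<in> I" for i
      using b(2)[OF that] holds_\<psi>[OF b(1) len(4)] by blast
    then obtain F where F: "\<And>i. i \<in> I \<Longrightarrow> F i \<in> tuples P q \<and> set (F i) \<subseteq> U b \<and> holds P \<phi> (F i @ g @ s' i)"
      by metis
    have "\<exists>xs\<in>?Q. card {i\<in>I. F i = xs} \<ge> k"
    proof (rule ccontr)
      assume "\<not> ?thesis"
      then have lt: "card {i\<in>I. F i = xs} \<le> k" if "xs \<in> ?Q" for xs using that by force
      have "I = (\<Union>xs\<in>?Q. {i\<in>I. F i = xs})" using F by (auto simp: tuples_def)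
      then have "card I = card (\<Union>xs\<in>?Q. {i\<in>I. F i = xs})" by (rule arg_cong)
      also have "\<dots> \<le> (\<Sum>xs\<in>?Q. card {i\<in>I. F i = xs})" by (rule card_UN_le[OF Q(1)])
      also have "\<dots> \<le> card ?Q * k" using sum_bounded_above[OF lt, of ?Q "\<lambda>xs. xs"] by simp
      also have "\<dots> \<le> N ^ q * k" using Q(2) by simp
      finally show False using I by simp
    qed
    then obtain xs where xs: "xs \<in> ?Q" "card {i\<in>I. F i = xs} \<ge> k" by blast
    then obtain J where J: "J \<subseteq> {i\<in>I. F i = xs}" "card J = k" "finite J" by (meson obtain_subset_with_card_n)
    have "xs \<in> tuples P q" using xs(1) by (auto simp: tuples_def U_def)
    then obtain i where "i \<in> J" "\<not> holds P \<phi> (xs @ g @ s' i)" using incons J by blast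
    then show False using F J by blast
  next
    show "elem_embedding ar P P id" using elem_embedding_refl P by blast
    show "g @ s' i \<in> tuples P (length (g @ s))" for i using len(2) len(4)[of i] lg by (auto simp: tuples_def)
    show "same_type ar P (id ` A\<^sub>0) (map id (g @ s)) (g @ s' i)" for i using conj by simp
  qed
  then have "forks ar P (length u) \<psi> (g @ s) A\<^sub>0"
    using dividing_forks[OF P(1), of "g @ s" r \<psi>] \<psi> len lg by (auto simp: tuples_def n_def add.assoc)
  moreover have "holds P \<psi> (u @ g @ s)"
  proof -
    have "set e \<subseteq> U u" using alg(3) \<phi>(2) by (auto simp: U_def tuples_def)
    moreover have "finite (U u)" using alg(2) by (simp add: U_def)
    ultimately show ?thesis using holds_\<psi>[OF len(1,3)] \<phi>(2,3) by (auto simp: N_def)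
  qed
  moreover have "fm_in ar (length u + length (g @ s)) \<psi>" using \<psi> lg by (simp add: n_def add.assoc)
  ultimately show ?thesis
    unfolding type_forks_def using A by (intro exI[of _ \<psi>] exI[of _ "g @ s"]) auto
qed

text \<open>If the finite index sets were of unbounded size, permutations of the
  \<open>\<beta> i\<close> would straighten them into arbitrarily long initial segments of the
  naturals, and these give the order property.\<close>

lemma stable_finite_bound:
  fixes P :: "('f, 'u) alg"
  assumes stable: "stable TYPE('u) ar T" and P: "P \<in> Mod ar T"
    and \<phi>: "fm_in ar (q + (p + l)) \<phi>" and len: "g \<in> tuples P p" "\<And>i. \<beta> i \<in> tuples P l"
    and perm: "\<And>\<pi> :: nat \<Rightarrow> nat. bij \<pi> \<Longrightarrow> \<exists>h. iso ar P P h \<and> map h g = g \<and> (\<forall>i. map h (\<beta> i) = \<beta> (\<pi> i))"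
  obtains K where "\<And>xs. xs \<in> tuples P q \<Longrightarrow> finite {i. holds P \<phi> (xs @ g @ \<beta> i)} \<Longrightarrow> 
    card {i. holds P \<phi> (xs @ g @ \<beta> i)} \<le> K"
proof (rule ccontr)
  assume "\<not> thesis"
  then have unbounded: "\<exists>xs\<in>tuples P q. finite {i. holds P \<phi> (xs @ g @ \<beta> i)} \<and> card {i. holds P \<phi> (xs @ g @ \<beta> i)} > K" for K
    using that by (metis not_le)
  have "\<exists>xs n. xs \<in> tuples P q \<and> n > K \<and> (\<forall>i. holds P \<phi> (xs @ g @ \<beta> i) \<longleftrightarrow> i < n)" for K
  proof -
    obtain xs where xs: "xs \<in> tuples P q" 
      and S: "finite {i. holds P \<phi> (xs @ g @ \<beta> i)}" "card {i. holds P \<phi> (xs @ g @ \<beta> i)} > K"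
      using unbounded by blast
    let ?S = "{i. holds P \<phi> (xs @ g @ \<beta> i)}"
    obtain f where f: "bij_betw f ?S {..<card ?S}"
      using ex_bij_betw_finite_nat[OF S(1)] by (metis atLeast0LessThan)
    \<comment> \<open>The automorphism belonging to \<open>\<pi>\<close> fixes \<open>g\<close> and
      carries \<open>xs\<close> to a tuple whose index set is the initial segment
      \<open>{..<card ?S}\<close>.\<close>
    obtain \<pi> :: "nat \<Rightarrow> nat" where \<pi>: "bij_betw \<pi> UNIV UNIV" "\<And>x. x \<in> ?S \<Longrightarrow> \<pi> x = f x"
      by (rule extend_bij_betw[OF _ _ _ _ S(1) subset_UNIV f subset_UNIV]) auto
    have \<pi>S: "\<pi> ` ?S = {..<card ?S}" using \<pi>(2) f by (metis (no_types, lifting) bij_betw_imp_surj_on image_cong)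
    obtain h where h: "iso ar P P h" "map h g = g" "\<And>i. map h (\<beta> i) = \<beta> (\<pi> i)"
      using perm[OF \<pi>(1)] by blast
    have "holds P \<phi> (map h xs @ g @ \<beta> j) \<longleftrightarrow> j < card ?S" for j
    proof -
      obtain i where i: "j = \<pi> i" using \<pi>(1) by (metis bij_pointE)
      have "xs @ g @ \<beta> i \<in> tuples P (q + (p + l))" using xs len(1) len(2)[of i] by (auto simp: tuples_def)
      from holds_iso[OF h(1) \<phi> this] have "holds P \<phi> (map h xs @ g @ \<beta> j) \<longleftrightarrow> i \<in> ?S"
        using h i by simp
      also have "\<dots> \<longleftrightarrow> \<pi> i \<in> \<pi> ` ?S" using \<pi>(1) by (simp add: inj_image_mem_iff bij_betw_def)
      finally show ?thesis using \<pi>S i by auto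
    qed
    moreover have "map h xs \<in> tuples P q"
      using xs h(1) by (auto simp: tuples_def iso_def bij_betw_def)
    ultimately show ?thesis using S(2) by blast
  qed
  then obtain X N where XN: "\<And>K. X K \<in> tuples P q" "\<And>K :: nat. N K > K"
    "\<And>K i. holds P \<phi> (X K @ g @ \<beta> i) \<longleftrightarrow> i < (N K :: nat)"
    by metis
  \<comment> \<open>Iterating \<open>N\<close> makes the lengths \<open>N (\<kappa> i)\<close>
    strictly increasing, since \<open>\<kappa> (Suc i)\<close> is \<open>N (\<kappa> i)\<close> and
    \<open>N\<close> exceeds its argument.\<close>
  define \<kappa> where "\<kappa> i = (N ^^ i) 0" for i
  have "strict_mono (\<lambda>i. N (\<kappa> i))"
    by (rule strict_mono_Suc_iff[THEN iffD2]) (simp add: \<kappa>_def XN(2))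
  then have lt: "N (\<kappa> i) < N (\<kappa> j) \<longleftrightarrow> i < j" for i j by (rule strict_mono_less)
  \<comment> \<open>The negated formula holds iff
    \<open>N (\<kappa> (Suc i)) \<le> N (\<kappa> j)\<close>, that is, iff
    \<open>Suc i \<le> j\<close>; the shift by one turns this into the strict inequality of the
    order property.\<close>
  let ?a = "\<lambda>i. X (\<kappa> (Suc i)) @ g" and ?b = "\<lambda>j. \<beta> (N (\<kappa> j))"
  have "holds P (Neg \<phi>) (?a i @ ?b j) \<longleftrightarrow> i < j" for i j
    using XN(3)[of "\<kappa> (Suc i)" "N (\<kappa> j)"] lt[of j "Suc i"] by (auto simp: holds_def)
  moreover have "range ?a \<subseteq> tuples P (q + p)" using XN(1) len(1) unfolding tuples_def by fastforce
  moreover have "range ?b \<subseteq> tuples P l" using len(2) by auto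
  ultimately have "order_property TYPE('u) ar T (q + p) l (Neg \<phi>)"
    unfolding order_property_def using P by blast
  moreover have "fm_in ar (q + p + l) (Neg \<phi>)" using \<phi> by (simp add: fm_in_def add.assoc)
  ultimately show False using stable unfolding stable_def by blast
qed

section \<open>Blocks of basis elements\<close>

context variety_of_algebras
begin

section \<open>Automorphisms of a free algebra that come from permutations of a basis\<close>

lemma free_on_permutation:
  assumes "free_on ar V P W" "bij_betw f W W"
  obtains h where "iso ar P P h" "\<And>w. w \<in> W \<Longrightarrow> h w = f w"
  using free_on_iso_extend[OF assms(1,1,2)] by blast

lemma iso_fixes_cl:
  assumes "iso ar P P h" "F \<subseteq> carr P" "\<And>x. x \<in> F \<Longrightarrow> h x = x" "x \<in> cl ar P F"
  shows "h x = x"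
proof -
  have P: "is_alg ar P" "hom ar P P h" using assms(1) by (auto simp: iso_def)
  have "h x = id x"
    by (rule hom_eq_on_cl[OF P(1) assms(2) P(2) hom_id[OF subalg_refl[OF P(1)]] _ assms(4)]) (simp add: assms(3))
  then show ?thesis by simp
qed

text \<open>Exchanging \<open>s\<close> and \<open>t\<close> entry by entry is an involution of
  \<open>W\<close>, read off from the association list \<open>zip (s @ t) (t @ s)\<close>.\<close>

lemma swap_tuples:
  assumes W: "free_on ar V P W" and st: "distinct (s @ t)" "length s = length t" "set s \<union> set t \<subseteq> W"
  obtains h where "iso ar P P h" "map h s = t" "\<And>w. w \<in> W - (set s \<union> set t) \<Longrightarrow> h w = w"
proof -
  define f where "f x = (case map_of (zip (s @ t) (t @ s)) x of None \<Rightarrow> x | Some y \<Rightarrow> y)" for x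
  have f: "f ((s @ t) ! i) = (t @ s) ! i" if "i < length (s @ t)" for i
    unfolding f_def using map_of_zip_nth[of "s @ t" "t @ s" i] st that by simp
  have f1: "f (s ! i) = t ! i" if "i < length s" for i
    using f[of i] that st(2) by (simp add: nth_append)
  have f2: "f (t ! i) = s ! i" if "i < length t" for i
    using f[of "length s + i"] that st(2) by (simp add: nth_append)
  have f3: "f x = x" if "x \<notin> set s \<union> set t" for x
  proof -
    have "map_of (zip (s @ t) (t @ s)) x = None"
      using that by (auto simp: map_of_eq_None_iff dest: set_zip_leftD)
    then show ?thesis by (simp only: f_def option.case)
  qed
  have ff: "f (f x) = x" for x
  proof (cases "x \<in> set s \<union> set t")
    case True
    then show ?thesis using f1 f2 st(2) by (auto simp: in_set_conv_nth)
  qed (simp add: f3)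
  have fW: "f x \<in> W" if "x \<in> W" for x
  proof (cases "x \<in> set s \<union> set t")
    case True
    then have "f x \<in> set s \<union> set t" using f1 f2 st(2) by (auto simp: in_set_conv_nth)
    then show ?thesis using st(3) by blast
  qed (simp add: f3 that)
  have "bij_betw f W W" by (rule bij_betw_byWitness[of _ f]) (use ff fW in auto)
  then obtain h where h: "iso ar P P h" "\<And>w. w \<in> W \<Longrightarrow> h w = f w" using free_on_permutation[OF W] by blast
  have "map h s = t" using h(2) f1 st by (intro nth_equalityI) (auto simp: subset_iff)
  moreover have "h w = w" if "w \<in> W - (set s \<union> set t)" for w using h(2) f3 that by auto
  ultimately show ?thesis using that h(1) by blast
qed

end

text \<open>The array \<open>z\<close> consists of distinct basis elements. The first
  \<open>l\<close> entries of its rows form pairwise disjoint blocks, which take the role of an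
  indiscernible sequence: every permutation of them is induced by an automorphism.\<close>

locale blocks = variety_of_algebras +
  fixes P :: "('f, 'u) alg" and W :: "'u set" and z :: "nat \<Rightarrow> nat \<Rightarrow> 'u" and l :: nat
  assumes basis: "free_on ar V P W"
    and inj_z: "\<And>i j i' j'. z i j = z i' j' \<Longrightarrow> i = i' \<and> j = j'"
    and z_in: "z i j \<in> W"
begin

definition block :: "nat \<Rightarrow> 'u list" where
  "block i = map (z i) [0..<l]"

lemma algP: "is_alg ar P" and W_carr: "W \<subseteq> carr P"
  using basis free_on_alg free_on_carr by blast+

lemma length_block [simp]: "length (block i) = l"
  by (simp add: block_def)

lemma set_block: "set (block i) = z i ` {..<l}"
  by (auto simp: block_def)

lemma block_in_W: "set (block i) \<subseteq> W"
  using z_in by (auto simp: set_block)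

lemma block_tuple: "block i \<in> tuples P l"
  using block_in_W W_carr by (force simp: tuples_def)

lemma block_disjoint: "i \<noteq> j \<Longrightarrow> set (block i) \<inter> set (block j) = {}"
  using inj_z by (auto simp: set_block)

lemma distinct_block: "distinct (block i)"
  using inj_z by (auto simp: block_def distinct_map inj_on_def)

lemma permute_blocks:
  assumes \<pi>: "bij \<pi>"
  obtains h where "iso ar P P h" "\<And>i. map h (block i) = block (\<pi> i)" 
    "\<And>w. w \<in> W \<Longrightarrow> (\<And>i j. w \<noteq> z i j) \<Longrightarrow> h w = w"
proof -
  \<comment> \<open>Whole rows are permuted. The position chosen by \<open>SOME\<close> is the only
    one, by injectivity of the array.\<close>
  define f where "f \<rho> w = (if \<exists>i j. w = z i j then (case (SOME (i, j). w = z i j) of (i, j) \<Rightarrow> z (\<rho> i) j) else w)" for \<rho> :: "nat \<Rightarrow> nat" and w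
  have fz: "f \<rho> (z i j) = z (\<rho> i) j" for \<rho> i j
  proof -
    have "(SOME (i', j'). z i j = z i' j') = (i, j)"
      by (rule some_equality) (auto dest: inj_z)
    then show ?thesis unfolding f_def by auto
  qed
  have fn: "f \<rho> w = w" if "\<And>i j. w \<noteq> z i j" for \<rho> w using that by (simp add: f_def)
  have inv: "f (inv \<pi>) (f \<pi> w) = w" "f \<pi> (f (inv \<pi>) w) = w" for w
    using fz fn \<pi> by (metis bij_inv_eq_iff)+
  have fW: "f \<rho> w \<in> W" if "w \<in> W" for \<rho> w using fz fn z_in that by metis
  have "bij_betw (f \<pi>) W W"
    by (rule bij_betw_byWitness[of _ "f (inv \<pi>)"]) (use inv fW in auto)
  then obtain h where h: "iso ar P P h" "\<And>w. w \<in> W \<Longrightarrow> h w = f \<pi> w" using free_on_permutation[OF basis] by blast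
  have "map h (block i) = block (\<pi> i)" for i
    using h(2) z_in fz by (simp add: block_def)
  moreover have "h w = w" if "w \<in> W" "\<And>i j. w \<noteq> z i j" for w using h(2) fn that by auto
  ultimately show ?thesis using that h(1) by blast
qed

text \<open>The tuple \<open>xs\<close> is generated by a finite part \<open>F\<close> of the basis,
  which meets only finitely many rows. Two blocks from other rows are exchanged by an automorphism
  that fixes \<open>xs\<close> and \<open>c\<close>, so the truth value is constant on those
  rows.\<close>

lemma holds_block_finite_or_cofinite:
  assumes \<phi>: "fm_in ar (q + (p + l)) \<phi>" and xs: "xs \<in> tuples P q" and c: "c \<in> tuples P p" "set c \<subseteq> W - range (\<lambda>(i, j). z i j)"
  shows "finite {i. holds P \<phi> (xs @ c @ block i)} \<or> finite {i. \<not> holds P \<phi> (xs @ c @ block i)}"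
proof -
  have xs': "length xs = q" "set xs \<subseteq> carr P" and c': "length c = p" "set c \<subseteq> carr P" 
    using xs c by (auto simp: tuples_def)
  obtain F where F: "finite F" "F \<subseteq> W" "set xs \<subseteq> cl ar P F"
    using cl_finite_support_set[OF algP W_carr _ finite_set[of xs]] xs'(2) free_on_cl[OF basis] by blast
  define J where "J = {i. \<exists>j. z i j \<in> F}"
  have "J \<subseteq> (\<lambda>w. THE i. \<exists>j. w = z i j) ` F"
  proof
    fix i assume "i \<in> J"
    then obtain j where j: "z i j \<in> F" by (auto simp: J_def)
    have "(THE i'. \<exists>j'. z i j = z i' j') = i" by (rule the_equality) (auto dest: inj_z)
    then show "i \<in> (\<lambda>w. THE i. \<exists>j. w = z i j) ` F" using j by force
  qed
  then have J: "finite J" using F(1) finite_surj by blast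
  have eq: "holds P \<phi> (xs @ c @ block i) \<longleftrightarrow> holds P \<phi> (xs @ c @ block j)" if ij: "i \<notin> J" "j \<notin> J" for i j
  proof (cases "i = j")
    case False
    have "distinct (block i @ block j)" using distinct_block block_disjoint[OF False] by auto
    moreover have "set (block i) \<union> set (block j) \<subseteq> W" using block_in_W by blast
    ultimately obtain h where h: "iso ar P P h" "map h (block i) = block j" 
      and hw: "\<And>w. w \<in> W - (set (block i) \<union> set (block j)) \<Longrightarrow> h w = w"
      using swap_tuples[OF basis, of "block i" "block j"] by (metis length_block)
    have "h w = w" if "w \<in> F" for w
      using hw[of w] F(2) that ij by (auto simp: J_def set_block)
    then have "map h xs = xs"
      using iso_fixes_cl[OF h(1), of F] F W_carr by (intro map_idI) blast
    moreover have "map h c = c"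
      using c(2) hw by (intro map_idI) (force simp: set_block)
    moreover have "xs @ c @ block i \<in> tuples P (q + (p + l))"
      using xs c(1) block_tuple[of i] by (auto simp: tuples_def)
    ultimately show ?thesis using holds_iso[OF h(1) \<phi>, of "xs @ c @ block i"] h(2) by simp
  qed simp
  show ?thesis
  proof (cases "\<exists>i. i \<notin> J \<and> holds P \<phi> (xs @ c @ block i)")
    case True
    then have "{i. \<not> holds P \<phi> (xs @ c @ block i)} \<subseteq> J" using eq by blast
    then show ?thesis using J finite_subset by blast
  next
    case False
    then have "{i. holds P \<phi> (xs @ c @ block i)} \<subseteq> J" by blast
    then show ?thesis using J finite_subset by blast
  qed
qed

text \<open>Since \<open>c\<close> avoids the array, the automorphisms permuting the blocks fix it,
  and \<open>stable_finite_bound\<close> applies.\<close>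

lemma block_bound:
  assumes stable: "stable TYPE('u) ar T" and P: "P \<in> Mod ar T"
    and \<phi>: "fm_in ar (q + (p + l)) \<phi>" and c: "c \<in> tuples P p" "set c \<subseteq> W - range (\<lambda>(i, j). z i j)"
  obtains K where "\<And>xs. xs \<in> tuples P q \<Longrightarrow> finite {i. holds P \<phi> (xs @ c @ block i)} \<Longrightarrow> 
    card {i. holds P \<phi> (xs @ c @ block i)} \<le> K"
proof -
  have "\<exists>h. iso ar P P h \<and> map h c = c \<and> (\<forall>i. map h (block i) = block (\<pi> i))" if "bij \<pi>" for \<pi> :: "nat \<Rightarrow> nat"
  proof -
    obtain h where h: "iso ar P P h" "\<And>i. map h (block i) = block (\<pi> i)" 
      "\<And>w. w \<in> W \<Longrightarrow> (\<And>i j. w \<noteq> z i j) \<Longrightarrow> h w = w"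
      using permute_blocks[OF \<open>bij \<pi>\<close>] by blast
    then have "map h c = c" using c(2) by (intro map_idI) force
    then show ?thesis using h by blast
  qed
  then show ?thesis
    by (rule stable_finite_bound[OF stable P \<phi> c(1) block_tuple]) (use that in auto)
qed

text \<open>Turns the failure of \<open>\<phi>\<close> at the first \<open>K\<close> blocks into
  part of the formula, with these blocks as further parameters. With \<open>K\<close> above the
  bound for finite exceptional sets, solutions of the new formula satisfy \<open>\<phi>\<close> at
  finitely many blocks only.\<close>

lemma definable_block_restriction:
  fixes K :: nat
  assumes \<phi>: "fm_in ar (q + (p + l)) \<phi>" and c: "c \<in> tuples P p"
  defines "g \<equiv> c @ concat (map block [0..<K])"
  obtains \<phi>' where "fm_in ar (q + (length g + l)) \<phi>'" 
    "\<And>xs t. xs \<in> tuples P q \<Longrightarrow> t \<in> tuples P l \<Longrightarrow> holds P \<phi>' (xs @ g @ t) \<longleftrightarrow>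
       holds P \<phi> (xs @ c @ t) \<and> (\<forall>j<K. \<not> holds P \<phi> (xs @ c @ block j))"
proof -
  have lc: "length c = p" using c by (simp add: tuples_def)
  have len: "length (concat (map block js)) = length js * l" for js by (induction js) auto
  have lg: "length g = p + K * l" using lc len by (simp add: g_def)
  let ?n = "q + (length g + l)"
  \<comment> \<open>In \<open>xs @ g @ t\<close> block \<open>j\<close> starts at position
    \<open>q + p + j * l\<close>, after \<open>xs\<close>, \<open>c\<close> and the earlier blocks;
    \<open>t\<close> starts at \<open>q + length g\<close>.\<close>
  let ?R = "\<lambda>w. holds P \<phi> (map ((!) w) ([0..<q + p] @ [q + length g..<q + length g + l])) \<and>
    (\<forall>j\<in>{..<K}. \<not> holds P \<phi> (map ((!) w) ([0..<q + p] @ [q + p + j * l..<q + p + j * l + l])))"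
  have "definable ar P ?n ?R"
  proof (intro definable_conj definable_ball definable_not)
    show "definable ar P ?n (\<lambda>w. holds P \<phi> (map ((!) w) ([0..<q + p] @ [q + length g..<q + length g + l])))"
      by (rule definable_reindex[OF definable_holds[OF \<phi>]]) (auto simp: lg)
    fix j assume j: "j \<in> {..<K}"
    have "Suc j * l \<le> K * l" using j by (intro mult_le_mono1) auto
    then show "definable ar P ?n (\<lambda>w. holds P \<phi> (map ((!) w) ([0..<q + p] @ [q + p + j * l..<q + p + j * l + l])))"
      by (intro definable_reindex[OF definable_holds[OF \<phi>]]) (auto simp: lg)
  qed simp
  then obtain \<phi>' where \<phi>': "fm_in ar ?n \<phi>'" "\<And>w. w \<in> tuples P ?n \<Longrightarrow> holds P \<phi>' w \<longleftrightarrow> ?R w"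
    unfolding definable_def by blast
  have "holds P \<phi>' (xs @ g @ t) \<longleftrightarrow>
       holds P \<phi> (xs @ c @ t) \<and> (\<forall>j<K. \<not> holds P \<phi> (xs @ c @ block j))"
    if xs: "xs \<in> tuples P q" and t: "t \<in> tuples P l" for xs t
  proof -
    have l: "length xs = q" "length t = l" using xs t by (auto simp: tuples_def)
    have 1: "map ((!) (xs @ g @ t)) [0..<q + p] = xs @ c"
      using map_nth_append_upt[of "[]" "xs @ c" "concat (map block [0..<K]) @ t"] l lc by (simp add: g_def)
    have 2: "map ((!) (xs @ g @ t)) [q + length g..<q + length g + l] = t"
      using map_nth_append_upt[of "xs @ g" t "[]"] l by simp
    have 3: "map ((!) (xs @ g @ t)) [q + p + j * l..<q + p + j * l + l] = block j" if "j < K" for j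
    proof -
      have "[0..<K] = [0..<j] @ j # [Suc j..<K]" using that 
        by (metis upt_add_eq_append le_add_diff_inverse less_imp_le_nat upt_conv_Cons zero_le)
      then have "xs @ g @ t = (xs @ c @ concat (map block [0..<j])) @ block j @ concat (map block [Suc j..<K]) @ t"
        by (simp add: g_def)
      then show ?thesis
        using map_nth_append_upt[of "xs @ c @ concat (map block [0..<j])" "block j"] l lc
        by (simp add: len add.assoc)
    qed
    have "set (concat (map block [0..<K])) \<subseteq> carr P" using block_in_W W_carr by fastforce
    then have "xs @ g @ t \<in> tuples P ?n" using xs c t by (auto simp: tuples_def g_def)
    then show ?thesis using \<phi>'(2) 1 2 3 by (auto simp del: upt_Suc)
  qed
  then show ?thesis using that \<phi>'(1) by blast
qed

end

section \<open>Algebras with the construction principle in a superstable theory\<close>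

text \<open>Here \<open>P\<close> is the free product of the algebras generated by
  \<open>X\<^sub>1\<close> and \<open>X\<^sub>2\<close>, the \<open>B\<close> and \<open>C\<close>
  of the outline. The assumption \<open>extend_a\<close> is clause (a) of (CP) in terms of bases;
  clause (b) enters only at the very end.\<close>

locale cp_setting = variety_of_algebras ar V for ar :: "'f lang" and V :: "('f, 'u) alg set" +
  fixes T :: "'f fm set" and P :: "('f, 'u) alg" and X\<^sub>1 X\<^sub>2 :: "'u set" and a :: "nat \<Rightarrow> 'u"
  assumes T: "T = Th ar (free_algs_inf ar V)"
    and behaves: "behaves_like_free_groups ar V T"
    and superstable: "superstable TYPE('u) ar T"
    and basis: "free_on ar V P (X\<^sub>1 \<union> X\<^sub>2)"
    and disjoint: "X\<^sub>1 \<inter> X\<^sub>2 = {}"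
    and infinite: "infinite X\<^sub>1" "infinite X\<^sub>2"
    and countable: "countable (carr P)"
    and inj_a: "inj a"
    and extend_a: "\<And>m. \<exists>Y. a ` {..<m} \<subseteq> Y \<and> free_on ar V (gen ar P X\<^sub>1) Y"
begin

abbreviation B :: "('f, 'u) alg" where
  "B \<equiv> gen ar P X\<^sub>1"

lemma P: "P \<in> V" "is_alg ar P" "X\<^sub>1 \<union> X\<^sub>2 \<subseteq> carr P"
  using basis free_on_V free_on_alg free_on_carr by blast+

lemma X1_carr: "X\<^sub>1 \<subseteq> carr P"
  using P by blast

lemma basis_B: "free_on ar V B X\<^sub>1"
  using free_on_subset[OF basis] by blast

lemma B_carr: "carr B \<subseteq> carr P"
  using cl_subset[OF P(2) X1_carr] .

lemma Mod_inf: "A \<in> free_algs_inf ar V \<Longrightarrow> A \<in> Mod ar T"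
  unfolding T Th_def Mod_def free_algs_inf_def using free_on_alg by auto

lemma P_inf: "P \<in> free_algs_inf ar V"
  unfolding free_algs_inf_def using basis infinite(1) finite_subset by auto

lemma P_Mod: "P \<in> Mod ar T" 
  using Mod_inf P_inf by blast

text \<open>A basis of \<open>B\<close> may replace \<open>X\<^sub>1\<close> in the basis of
  \<open>P\<close>. It cannot meet \<open>X\<^sub>2\<close>, whose elements lie outside the closure
  of \<open>X\<^sub>1\<close> by \<open>basis_not_in_cl\<close>.\<close>

lemma basis_union:
  assumes "free_on ar V B Y"
  shows "free_on ar V P (Y \<union> X\<^sub>2)" and "Y \<inter> X\<^sub>2 = {}" and "infinite Y" and "Y \<subseteq> carr P" and "countable Y"
proof -
  have "X\<^sub>1 \<union> X\<^sub>2 - X\<^sub>1 = X\<^sub>2" using disjoint by blast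
  then show "free_on ar V P (Y \<union> X\<^sub>2)" using free_on_replace[OF basis _ assms] by simp
  show Y: "Y \<subseteq> carr P" using free_on_carr[OF assms] B_carr by blast
  show "countable Y" using Y countable countable_subset by blast
  show "infinite Y" using finite_basis[OF basis_B assms] infinite by blast
  obtain x0 where "x0 \<in> X\<^sub>1" using infinite by (metis ex_in_conv finite.emptyI)
  show "Y \<inter> X\<^sub>2 = {}"
  proof (rule ccontr)
    assume "\<not> ?thesis"
    then obtain x where "x \<in> Y" "x \<in> X\<^sub>2" by blast
    then have "x \<in> cl ar P X\<^sub>1" using free_on_carr[OF assms] by blast
    moreover have "x0 \<noteq> x" using \<open>x0 \<in> X\<^sub>1\<close> \<open>x \<in> X\<^sub>2\<close> disjoint by blast
    ultimately show False
      using basis_not_in_cl[OF basis, of X\<^sub>1 x x0] \<open>x \<in> X\<^sub>2\<close> \<open>x0 \<in> X\<^sub>1\<close> disjoint P by blast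
  qed
qed

text \<open>If \<open>\<phi>\<close> held of \<open>e\<close> but not of \<open>y\<close>, then
  \<open>\<phi>\<close> with \<open>a n, ..., a (m - 1)\<close> replaced by any block would fail at
  \<open>y\<close>, and therefore at \<open>e\<close>. So \<open>e\<close> satisfies
  \<open>\<phi>\<close> with its original parameters but fails all the block conjugates, and this
  contrast yields a dividing formula.\<close>

lemma holds_generic_if_holds:
  assumes Y: "free_on ar V B Y" "a ` {..<m} \<subseteq> Y" and Y': "free_on ar V B Y'" "a ` {..<n} \<union> set e \<subseteq> Y'"
    and nm: "n \<le> m" and e: "distinct e" "set e \<inter> a ` {..<n} = {}" 
    and y: "distinct y" "set y \<subseteq> Y - a ` {..<m}" "length y = length e"
    and u: "set u \<subseteq> carr P" and A: "finite A\<^sub>0" "A\<^sub>0 \<subseteq> a ` {..<n} \<union> X\<^sub>2"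
    and nf: "\<not> type_forks ar P u (range a \<union> X\<^sub>2) A\<^sub>0"
    and alg: "set e \<subseteq> acl ar P (cl ar P (set u \<union> a ` {..<n}))"
    and \<phi>: "fm_in ar (length e + m) \<phi>" and holds: "holds P \<phi> (e @ map a [0..<m])"
  shows "holds P \<phi> (y @ map a [0..<m])"
proof (rule ccontr)
  assume not: "\<not> holds P \<phi> (y @ map a [0..<m])"
  define W where "W = Y \<union> X\<^sub>2"
  have W: "free_on ar V P W" "W \<subseteq> carr P" and YX: "Y \<inter> X\<^sub>2 = {}" and W': "free_on ar V P (Y' \<union> X\<^sub>2)" "Y' \<inter> X\<^sub>2 = {}" "Y' \<subseteq> carr P"
    using basis_union[OF Y(1)] basis_union[OF Y'(1)] P by (auto simp: W_def)
  define q where "q = length e"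
  define l where "l = m - n"
  define c where "c = map a [0..<n]"
  define s where "s = map a [n..<m]"
  have cs: "map a [0..<m] = c @ s"
    using nm by (metis c_def s_def le_add_diff_inverse map_append upt_add_eq_append zero_le)
  have set_c: "set c = a ` {..<n}" by (auto simp: c_def)
  have set_s: "set s = a ` {n..<m}" by (auto simp: s_def)
  have aj: "a i = a j \<longleftrightarrow> i = j" for i j using inj_a by (simp add: inj_eq)
  have disj_cs: "set c \<inter> set s = {}" unfolding set_c set_s by (auto simp: aj)
  have dist: "distinct c" "distinct s" unfolding c_def s_def by (auto simp: distinct_map inj_on_def aj)
  have a_m: "a ` {..<m} = set c \<union> set s"
    unfolding set_c set_s image_Un[symmetric] using nm by (simp add: ivl_disj_un_one(2))
  have csY: "set c \<union> set s \<subseteq> Y" using Y(2) a_m by simp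
  have y_tuple: "y \<in> tuples P q" using y W by (auto simp: tuples_def q_def W_def)
  have c_tuple: "c \<in> tuples P n" using csY W by (auto simp: tuples_def c_def W_def)
  have s_tuple: "s \<in> tuples P l" using csY W by (auto simp: tuples_def s_def W_def l_def)
  have e_tuple: "e \<in> tuples P q" using Y' W' by (auto simp: tuples_def q_def)
  have \<phi>': "fm_in ar (q + (n + l)) \<phi>" using \<phi> nm by (simp add: q_def l_def)
  \<comment> \<open>The blocks are taken outside \<open>A\<^sub>0\<close>, so that exchanging
    \<open>s\<close> with a block fixes \<open>A\<^sub>0\<close> pointwise.\<close>
  have "infinite (X\<^sub>2 - A\<^sub>0)" using infinite A by simp
  then obtain f :: "nat \<Rightarrow> 'u" where f: "inj f" "range f \<subseteq> X\<^sub>2 - A\<^sub>0" using infinite_countable_subset by blast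
  define z where "z i j = f (prod_encode (i, j))" for i j
  interpret blocks ar V P W z l
    using W(1) f by unfold_locales (auto simp: z_def W_def inj_eq prod_encode_eq)
  have zX: "z i j \<in> X\<^sub>2 - A\<^sub>0" for i j using f by (auto simp: z_def)
  have block_X2: "set (block i) \<subseteq> X\<^sub>2 - A\<^sub>0" for i using zX by (auto simp: set_block)
  have c_W: "set c \<subseteq> W - range (\<lambda>(i, j). z i j)" using csY zX YX by (auto simp: W_def)
  have "\<exists>h. iso ar P P h \<and> map h s = block i \<and> (\<forall>w \<in> W - (set s \<union> set (block i)). h w = w)" for i
  proof -
    have "distinct (s @ block i)" using dist distinct_block csY block_X2[of i] YX by auto
    moreover have "length s = length (block i)" using s_tuple by (simp add: tuples_def)
    moreover have "set s \<union> set (block i) \<subseteq> W" using csY block_X2[of i] by (auto simp: W_def)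
    ultimately show ?thesis using swap_tuples[OF W(1)] by metis
  qed
  then obtain h where h: "\<And>i. iso ar P P (h i)" "\<And>i. map (h i) s = block i"
    "\<And>i w. w \<in> W \<Longrightarrow> w \<notin> set s \<Longrightarrow> w \<notin> set (block i) \<Longrightarrow> h i w = w"
    by (metis DiffI UnE)
  have hY: "h i w = w" if "w \<in> Y" "w \<notin> set s" for i w
    by (rule h(3)) (use that block_X2[of i] YX in \<open>unfold W_def, blast+\<close>)
  have hc: "map (h i) c = c" for i
    by (intro map_idI hY) (use csY disj_cs in blast)+
  \<comment> \<open>\<open>y\<close> and \<open>c\<close> lie in \<open>Y\<close> and avoid
    \<open>s\<close>, so the automorphism \<open>h i\<close> moves only the parameters
    \<open>s\<close>, to block \<open>i\<close>.\<close>
  have y_not: "\<not> holds P \<phi> (y @ c @ block i)" for i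
  proof -
    have "map (h i) y = y"
      by (intro map_idI hY) (use y(2) a_m in blast)+
    moreover have "y @ c @ s \<in> tuples P (q + (n + l))"
      using y_tuple c_tuple s_tuple by (auto simp: tuples_def)
    ultimately show ?thesis using holds_iso[OF h(1)[of i] \<phi>', of "y @ c @ s"] h(2) hc not by (simp add: cs)
  qed
  \<comment> \<open>\<open>e\<close> and \<open>c\<close> lie in the basis \<open>Y'\<close>, and
    \<open>y\<close> and \<open>c\<close> in the basis \<open>Y\<close>. A bijection from
    \<open>Y'\<close> to \<open>Y\<close> taking \<open>e\<close> to \<open>y\<close> and fixing
    \<open>c\<close>, joined with the identity on \<open>X\<^sub>2\<close>, gives an automorphism
    that also fixes the blocks.\<close>
  have e_not: "\<not> holds P \<phi> (e @ c @ block i)" for i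
  proof -
    let ?f = "\<lambda>x. if x \<in> set e then the (map_of (zip e y) x) else x"
    have fe: "map ?f e = y"
      using e(1) y(3) by (intro nth_equalityI) (auto simp: map_of_zip_nth)
    have fc: "?f x = x" if "x \<in> set c" for x using that e(2) set_c by auto
    have yc: "set y \<inter> set c = {}" using y(2) a_m by blast
    have bij: "bij_betw ?f (set e \<union> set c) (set y \<union> set c)"
    proof (rule bij_betw_imageI)
      have "?f ` set e = set y" 
        using fe by (metis (no_types, lifting) list.set_map)
      moreover have "?f ` set c = set c" using fc by (intro image_cong[of _ _ _ id, simplified]) auto
      ultimately show im: "?f ` (set e \<union> set c) = set y \<union> set c" by (simp only: image_Un)
      have "card (set e \<union> set c) = card (set y \<union> set c)"
        using e y yc set_c by (subst (1 2) card_Un_disjoint) (auto simp: distinct_card)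
      then show "inj_on ?f (set e \<union> set c)" using im by (intro eq_card_imp_inj_on) auto
    qed
    have eY: "set e \<subseteq> Y'" "set c \<subseteq> Y'" using Y'(2) set_c by auto
    have sub: "finite (set e \<union> set c)" "set e \<union> set c \<subseteq> Y'" "set y \<union> set c \<subseteq> Y"
      using eY csY y(2) by auto
    obtain g where g: "bij_betw g Y' Y" "\<And>x. x \<in> set e \<union> set c \<Longrightarrow> g x = ?f x"
      by (rule extend_bij_betw[OF basis_union(5)[OF Y'(1)] basis_union(3)[OF Y'(1)] basis_union(5)[OF Y(1)]
          basis_union(3)[OF Y(1)] sub(1,2) bij sub(3)]) (rule that)
    have "bij_betw (\<lambda>x. if x \<in> Y' then g x else id x) (Y' \<union> X\<^sub>2) (Y \<union> X\<^sub>2)"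
      using g(1) bij_betw_id by (rule bij_betw_disjoint_Un) (use W'(2) YX in auto)
    then obtain k where k: "iso ar P P k" "\<And>x. x \<in> Y' \<union> X\<^sub>2 \<Longrightarrow> k x = (if x \<in> Y' then g x else id x)"
      using free_on_iso_extend[OF W'(1) W(1)[unfolded W_def]] by blast
    have "map k e = map ?f e" using k(2) g(2) eY by (intro map_cong) auto
    then have "map k e = y" using fe by simp
    moreover have "map k c = c" using k(2) g(2) fc eY by (intro map_idI) auto
    moreover have "k x = x" if "x \<in> X\<^sub>2" for x using k(2)[of x] that W'(2) by auto
    then have "map k (block i) = block i" using block_X2[of i] by (intro map_idI) blast
    moreover have "e @ c @ block i \<in> tuples P (q + (n + l))"
      using e_tuple c_tuple block_tuple[of i] by (auto simp: tuples_def)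
    ultimately show ?thesis using holds_iso[OF k(1) \<phi>', of "e @ c @ block i"] y_not[of i] by simp
  qed
  have stable: "stable TYPE('u) ar T" using superstable by (simp add: superstable_def)
  obtain K2 where K2: "\<And>xs. xs \<in> tuples P q \<Longrightarrow> finite {i. holds P \<phi> (xs @ c @ block i)} \<Longrightarrow> 
    card {i. holds P \<phi> (xs @ c @ block i)} \<le> K2"
    using block_bound[OF stable P_Mod \<phi>' c_tuple c_W] by blast
  have "fm_in ar (q + (n + l)) (Neg \<phi>)" using \<phi>' by (simp add: fm_in_def)
  from block_bound[OF stable P_Mod this c_tuple c_W]
  obtain K1 where K1: "\<And>xs. xs \<in> tuples P q \<Longrightarrow> finite {i. \<not> holds P \<phi> (xs @ c @ block i)} \<Longrightarrow> 
    card {i. \<not> holds P \<phi> (xs @ c @ block i)} \<le> K1"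
    by (auto simp: holds_def)
  \<comment> \<open>One block more than \<open>K1\<close>: a tuple failing \<open>\<phi>\<close> at
    all of them fails it infinitely often.\<close>
  define g where "g = c @ concat (map block [0..<Suc K1])"
  have g_tuple: "g \<in> tuples P (length g)"
    using c_tuple block_in_W W(2) by (fastforce simp: tuples_def g_def)
  obtain \<phi>' where \<phi>'': "fm_in ar (q + (length g + l)) \<phi>'" 
    "\<And>xs t. xs \<in> tuples P q \<Longrightarrow> t \<in> tuples P l \<Longrightarrow> holds P \<phi>' (xs @ g @ t) \<longleftrightarrow>
       holds P \<phi> (xs @ c @ t) \<and> (\<forall>j<Suc K1. \<not> holds P \<phi> (xs @ c @ block j))"
    using definable_block_restriction[OF \<phi>' c_tuple, of "Suc K1"] unfolding g_def by metis
  have holds': "holds P \<phi>' (e @ g @ s)"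
    using \<phi>''(2)[OF e_tuple s_tuple] holds e_not by (simp add: cs)
  define r where "r = length u"
  have u_tuple: "u \<in> tuples P r" using u by (simp add: tuples_def r_def)
  have ug: "u @ g \<in> tuples P (r + length g)" using u_tuple g_tuple by (auto simp: tuples_def)
  have "set u \<union> a ` {..<n} \<subseteq> set (u @ g)" by (auto simp: g_def set_c)
  moreover have "set (u @ g) \<subseteq> carr P" using ug by (simp add: tuples_def)
  ultimately have "cl ar P (set u \<union> a ` {..<n}) \<subseteq> cl ar P (set (u @ g))"
    using cl_mono[OF P(2)] by blast
  then have "set e \<subseteq> acl ar P (cl ar P (set (u @ g)))" using alg acl_mono by (metis subset_trans)
  from acl_definable[OF P(2) ug finite_set this]
  obtain \<chi> where \<chi>: "fm_in ar (r + length g + 1) \<chi>" "finite {x \<in> carr P. holds P \<chi> (u @ g @ [x])}"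
    "\<And>x. x \<in> set e \<Longrightarrow> holds P \<chi> (u @ g @ [x])" by auto
  have A0W: "A\<^sub>0 \<subseteq> W" using A(2) csY set_c by (auto simp: W_def)
  have A0s: "A\<^sub>0 \<inter> set s = {}" using A(2) disj_cs csY YX set_c by blast
  \<comment> \<open>The sequence of conjugates starts after the blocks used in \<open>g\<close>, so
    the exchange of \<open>s\<close> with block \<open>Suc K1 + i\<close> fixes
    \<open>g\<close>.\<close>
  have same: "same_type ar P A\<^sub>0 (g @ s) (g @ block (Suc K1 + i))" for i
  proof -
    let ?h = "h (Suc K1 + i)"
    have "?h w = w" if "w \<in> set (block j)" "j < Suc K1" for w j
    proof (rule h(3))
      show "w \<in> W" "w \<notin> set s" using that(1) block_X2[of j] csY YX by (auto simp: W_def)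
      show "w \<notin> set (block (Suc K1 + i))" using that block_disjoint[of j "Suc K1 + i"] by auto
    qed
    then have "map ?h (concat (map block [0..<Suc K1])) = concat (map block [0..<Suc K1])"
      by (intro map_idI) (auto simp del: upt_Suc)
    then have "map ?h g = g" using hc by (simp add: g_def)
    then have gs: "map ?h (g @ s) = g @ block (Suc K1 + i)" using h(2) by simp
    have "holds P \<psi> ((g @ s) @ p) \<longleftrightarrow> holds P \<psi> ((g @ block (Suc K1 + i)) @ p)"
      if p: "set p \<subseteq> A\<^sub>0" and \<psi>: "fm_in ar (length (g @ s) + length p) \<psi>" for \<psi> p
    proof -
      have "?h w = w" if "w \<in> A\<^sub>0" for w using h(3) that A0W A0s block_X2 by blast
      then have "map ?h p = p" using p by (intro map_idI) auto
      moreover have "(g @ s) @ p \<in> tuples P (length (g @ s) + length p)"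
        using g_tuple s_tuple p A0W W(2) by (auto simp: tuples_def)
      ultimately show ?thesis using holds_iso[OF h(1) \<psi>, of "(g @ s) @ p" "Suc K1 + i"] gs by simp
    qed
    then show ?thesis unfolding same_type_def using s_tuple by (simp add: tuples_def)
  qed
  \<comment> \<open>A common solution fails \<open>\<phi>\<close> at the first \<open>Suc K1\<close>
    blocks, hence at infinitely many, hence holds at finitely many and so at no more than
    \<open>K2\<close>; but \<open>I\<close> has \<open>Suc K2\<close> elements.\<close>
  have incons: "\<exists>i\<in>I. \<not> holds P \<phi>' (xs @ g @ block (Suc K1 + i))"
    if I: "finite I" "card I = Suc K2" and xs: "xs \<in> tuples P q" for I xs
  proof (rule ccontr)
    assume "\<not> ?thesis"
    then have *: "holds P \<phi> (xs @ c @ block (Suc K1 + i))" "\<forall>j<Suc K1. \<not> holds P \<phi> (xs @ c @ block j)" if "i \<in> I" for i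
      using that \<phi>''(2)[OF xs block_tuple] by blast+
    obtain i0 where "i0 \<in> I" using I by fastforce
    then have lt: "{..<Suc K1} \<subseteq> {i. \<not> holds P \<phi> (xs @ c @ block i)}" using * by auto
    have "infinite {i. \<not> holds P \<phi> (xs @ c @ block i)}"
    proof
      assume fin: "finite {i. \<not> holds P \<phi> (xs @ c @ block i)}"
      then have "Suc K1 \<le> card {i. \<not> holds P \<phi> (xs @ c @ block i)}" using card_mono[OF fin lt] by simp
      then show False using K1[OF xs fin] by simp
    qed
    then have fin: "finite {i. holds P \<phi> (xs @ c @ block i)}"
      using holds_block_finite_or_cofinite[OF \<open>fm_in ar (q + (n + l)) \<phi>\<close> xs c_tuple c_W] by blast
    have "(+) (Suc K1) ` I \<subseteq> {i. holds P \<phi> (xs @ c @ block i)}" using * by auto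
    then have "card ((+) (Suc K1) ` I) \<le> K2" using card_mono[OF fin] K2[OF xs fin] le_trans by blast
    then show False using I card_image[of "(+) (Suc K1)" I] by simp
  qed
  have "set g \<union> set s \<subseteq> range a \<union> X\<^sub>2"
    using block_X2 by (fastforce simp: g_def set_c set_s)
  then have "type_forks ar P u (range a \<union> X\<^sub>2) A\<^sub>0"
    using type_forks_if_algebraic[where s' = "\<lambda>i. block (Suc K1 + i)", OF P(2) _ u_tuple g_tuple s_tuple block_tuple \<phi>''(1) e_tuple holds'
      \<chi> same incons] holds c_tuple P(3) infinite(1) by (metis Un_empty finite.emptyI subset_empty)
  then show False using nf by blast
qed

lemma holds_generic_iff:
  assumes Y: "free_on ar V B Y" "a ` {..<m} \<subseteq> Y" and Y': "free_on ar V B Y'" "a ` {..<n} \<union> set e \<subseteq> Y'"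
    and nm: "n \<le> m" and e: "distinct e" "set e \<inter> a ` {..<n} = {}" 
    and y: "distinct y" "set y \<subseteq> Y - a ` {..<m}" "length y = length e"
    and u: "set u \<subseteq> carr P" and A: "finite A\<^sub>0" "A\<^sub>0 \<subseteq> a ` {..<n} \<union> X\<^sub>2"
    and nf: "\<not> type_forks ar P u (range a \<union> X\<^sub>2) A\<^sub>0"
    and alg: "set e \<subseteq> acl ar P (cl ar P (set u \<union> a ` {..<n}))"
    and \<phi>: "fm_in ar (length e + m) \<phi>"
  shows "holds P \<phi> (e @ map a [0..<m]) \<longleftrightarrow> holds P \<phi> (y @ map a [0..<m])"
proof
  show "holds P \<phi> (e @ map a [0..<m])" if "holds P \<phi> (y @ map a [0..<m])"
  proof (rule ccontr)
    assume "\<not> ?thesis"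
    then have "holds P (Neg \<phi>) (e @ map a [0..<m])" by (simp add: holds_def)
    moreover have "fm_in ar (length e + m) (Neg \<phi>)" using \<phi> by (simp add: fm_in_def)
    ultimately have "holds P (Neg \<phi>) (y @ map a [0..<m])"
      using holds_generic_if_holds[OF Y Y' nm e y u A nf alg] by blast
    then show False using that by (simp add: holds_def)
  qed
qed (rule holds_generic_if_holds[OF assms])

section \<open>Free algebras of finite rank, and the use of the first and last clauses of
  \<open>behaves_like_free_groups\<close>\<close>

lemma card_a: "card (a ` {..<m}) = m"
  using card_image[OF inj_on_subset[OF inj_a subset_UNIV], of "{..<m}"] by simp

definition rank_bound :: nat where
  "rank_bound = (SOME n. \<forall>m \<ge> n. free_algs_rank ar V m \<subseteq> Mod ar T)"

lemma finite_rank_in_Mod: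
  assumes "finite F" "free_on ar V A F" "rank_bound \<le> card F"
  shows "A \<in> free_algs_fin ar V \<inter> Mod ar T"
proof -
  have "\<forall>m \<ge> rank_bound. free_algs_rank ar V m \<subseteq> Mod ar T"
    unfolding rank_bound_def
    by (rule someI_ex) (use behaves in \<open>unfold behaves_like_free_groups_def, elim conjE\<close>)
  moreover have "A \<in> free_algs_rank ar V (card F)" using assms by (auto simp: free_algs_rank_def)
  ultimately show ?thesis using assms by (auto simp: free_algs_fin_def)
qed

lemma fin_free: "A \<in> free_algs_fin ar V \<Longrightarrow> A \<in> free_algs ar V"
  by (auto simp: free_algs_fin_def free_algs_rank_def free_algs_def)

lemma elem_sub_if_free_factor:
  assumes "free_factor ar V A A'" "A \<in> Mod ar T" "A' \<in> Mod ar T"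
  shows "elem_sub ar A A'"
  using behaves assms unfolding behaves_like_free_groups_def free_factor_def by blast

lemma free_factor_if_elem_sub:
  assumes "elem_sub ar A A'" "A \<in> free_algs_fin ar V \<inter> Mod ar T" "A' \<in> free_algs_fin ar V \<inter> Mod ar T"
  shows "free_factor ar V A A'"
  using behaves assms fin_free[of A] fin_free[of A'] unfolding behaves_like_free_groups_def by blast

lemma gen_B: "S \<subseteq> carr B \<Longrightarrow> gen ar B S = gen ar P S"
  by (rule gen_gen[OF P(2) X1_carr])

lemma elem_sub_gen:
  assumes "free_on ar V P W" "F \<subseteq> W" "finite F" "rank_bound \<le> card F"
  shows "elem_sub ar (gen ar P F) P"
proof (rule elem_sub_if_free_factor)
  show "free_factor ar V (gen ar P F) P" using free_factor_gen(2)[OF assms(1,2)] .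
  show "gen ar P F \<in> Mod ar T" using finite_rank_in_Mod[OF assms(3) free_on_subset[OF assms(1,2)] assms(4)] by blast
qed (rule P_Mod)

text \<open>The finite support of \<open>S\<close> is enlarged by \<open>rank_bound\<close> many
  basis elements, so that \<open>F\<close> generates a model of \<open>T\<close>.\<close>

lemma finite_rank_factor:
  assumes "free_on ar V B Y" "finite S" "S \<subseteq> carr B"
  obtains F where "finite F" "F \<subseteq> Y" "S \<subseteq> cl ar P F" "rank_bound \<le> card F"
proof -
  have B: "is_alg ar B" "Y \<subseteq> carr B" using free_on_alg[OF assms(1)] free_on_carr[OF assms(1)] by auto
  obtain F where F: "finite F" "F \<subseteq> Y" "S \<subseteq> cl ar B F"
    using cl_finite_support_set[OF B _ assms(2)] assms(3) free_on_cl[OF assms(1)] by auto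
  obtain F' where F': "F' \<subseteq> Y" "finite F'" "card F' = rank_bound"
    using infinite_arbitrarily_large[OF basis_union(3)[OF assms(1)]] by blast
  have c: "F \<union> F' \<subseteq> carr B" using F F' B by blast
  have "S \<subseteq> cl ar B (F \<union> F')" using F(3) cl_mono[OF B(1) c, of F] by blast
  moreover have "rank_bound \<le> card (F \<union> F')" using F F' card_mono[of "F \<union> F'" F'] by auto
  ultimately show ?thesis using that[of "F \<union> F'"] F F' gen_B[OF c] by auto
qed

text \<open>The tuple \<open>xs\<close> has the type of \<open>ys\<close>, a part of a basis.
  Agreement on equations shows that \<open>xs\<close> freely generates its closure, agreement on all
  formulas that this closure is elementary in \<open>P\<close>. The second half of the last clause,
  applied inside a free factor of finite rank, then makes it a free factor.\<close>

lemma basis_extension: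
  assumes Y: "free_on ar V B Y" "a ` {..<m} \<subseteq> Y" and Y': "free_on ar V B Y'" "a ` {..<n} \<union> set e \<subseteq> Y'"
    and nm: "n \<le> m" "rank_bound \<le> m" and e: "distinct e" "set e \<inter> a ` {..<n} = {}" 
    and u: "set u \<subseteq> carr P" and A: "finite A\<^sub>0" "A\<^sub>0 \<subseteq> a ` {..<n} \<union> X\<^sub>2"
    and nf: "\<not> type_forks ar P u (range a \<union> X\<^sub>2) A\<^sub>0"
    and alg: "set e \<subseteq> acl ar P (cl ar P (set u \<union> a ` {..<n}))"
  obtains Z where "free_on ar V B Z" "a ` {..<m} \<union> set e \<subseteq> Z"
proof -
  have "infinite (Y - a ` {..<m})" using basis_union(3)[OF Y(1)] by simp
  then obtain S where S: "S \<subseteq> Y - a ` {..<m}" "finite S" "card S = length e"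
    using infinite_arbitrarily_large[of "Y - a ` {..<m}" "length e"] by blast
  obtain y where y': "set y = S" "distinct y" using finite_distinct_list[OF S(2)] by blast
  have y: "distinct y" "set y \<subseteq> Y - a ` {..<m}" "length y = length e"
    using y' S distinct_card[of y] by auto
  define xs where "xs = e @ map a [0..<m]"
  define ys where "ys = y @ map a [0..<m]"
  have len: "length xs = length e + m" "length ys = length xs" using y by (auto simp: xs_def ys_def)
  have iff: "holds P \<phi> xs \<longleftrightarrow> holds P \<phi> ys" if "fm_in ar (length xs) \<phi>" for \<phi>
    unfolding xs_def ys_def
    using holds_generic_iff[OF Y Y' nm(1) e y u A nf alg] that len by simp
  have set_ys: "set ys = S \<union> a ` {..<m}" and set_xs: "set xs = set e \<union> a ` {..<m}"
    by (auto simp: xs_def ys_def y' lessThan_atLeast0)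
  have ysY: "set ys \<subseteq> Y \<union> X\<^sub>2" using set_ys S Y(2) by blast
  have aB: "a ` {..<m} \<subseteq> carr B" using Y(2) free_on_carr[OF Y(1)] by blast
  have xsB: "set xs \<subseteq> carr B" using set_xs aB Y'(2) free_on_carr[OF Y'(1)] by blast
  have xsP: "set xs \<subseteq> carr P" using xsB B_carr by blast
  have ysP: "set ys \<subseteq> carr P" using ysY free_on_carr[OF basis_union(1)[OF Y(1)]] by blast
  let ?R = "gen ar P (set ys)" and ?D = "gen ar P (set xs)"
  have ca: "card (a ` {..<m}) = m" by (rule card_a)
  have cx: "rank_bound \<le> card (set xs)" and cy: "rank_bound \<le> card (set ys)"
    using card_mono[of "set xs" "a ` {..<m}"] card_mono[of "set ys" "a ` {..<m}"] set_xs set_ys ca nm(2) S(2) by auto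
  have eqs: "eval_tm P ((!) ys) s = eval_tm P ((!) ys) t \<longleftrightarrow> eval_tm P ((!) xs) s = eval_tm P ((!) xs) t"
    if "wf_tm ar s" "wf_tm ar t" "fv_tm s \<union> fv_tm t \<subseteq> {..<length ys}" for s t
    using iff[of "Eq s t"] that len by (simp add: fm_in_def holds_def)
  obtain k where k: "iso ar ?R ?D k"
    "\<And>t. wf_tm ar t \<Longrightarrow> fv_tm t \<subseteq> {..<length ys} \<Longrightarrow> k (eval_tm P ((!) ys) t) = eval_tm P ((!) xs) t"
    by (rule iso_of_same_equations[OF P(1) len(2) ysP xsP eqs]) (assumption+, rule that)
  have "k (ys ! i) = xs ! i" if "i < length ys" for i using k(2)[of "Var i"] that by simp
  then have "map k ys = xs" using len by (intro nth_equalityI) auto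
  then have "k ` set ys = set xs" by (metis list.set_map)
  then have D: "free_on ar V ?D (set xs)"
    using free_on_iso[OF free_on_subset[OF basis_union(1)[OF Y(1)] ysY] k(1) gen_in[OF P(1) xsP]] by simp
  have R_elem: "elem_sub ar ?R P"
    using elem_sub_gen[OF basis_union(1)[OF Y(1)] ysY finite_set cy] .
  \<comment> \<open>The formula is carried back along \<open>k\<close> to \<open>?R\<close>, which
    is elementary in \<open>P\<close>, and there rewritten as a formula about \<open>ys\<close>,
    where the equality of types can be used.\<close>
  have D_sat: "sat ?D \<phi> v \<longleftrightarrow> sat P \<phi> v" if \<phi>: "wf_fm ar \<phi>" and v: "v ` fv \<phi> \<subseteq> carr ?D" for \<phi> v
  proof -
    have "\<forall>i\<in>fv \<phi>. \<exists>t. wf_tm ar t \<and> fv_tm t \<subseteq> {..<length xs} \<and> v i = eval_tm P ((!) xs) t"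
      using cl_set_eval[OF P(2) xsP] v by blast
    then obtain \<tau> where \<tau>: "\<And>i. i \<in> fv \<phi> \<Longrightarrow> wf_tm ar (\<tau> i) \<and> fv_tm (\<tau> i) \<subseteq> {..<length xs} \<and> v i = eval_tm P ((!) xs) (\<tau> i)"
      by metis
    let ?w = "\<lambda>i. eval_tm P ((!) ys) (\<tau> i)"
    have w: "?w ` fv \<phi> \<subseteq> carr ?R"
    proof
      fix x assume "x \<in> ?w ` fv \<phi>"
      then obtain i where i: "i \<in> fv \<phi>" "x = ?w i" by blast
      have "(!) ys ` fv_tm (\<tau> i) \<subseteq> cl ar P (set ys)"
        using \<tau>[OF i(1)] len cl_superset[of "set ys" ar P] by (auto simp: subset_iff)
      then show "x \<in> carr ?R" using eval_tm_in_cl[of ar "\<tau> i" "(!) ys" P "set ys"] \<tau>[OF i(1)] i(2) by simp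
    qed
    have "sat ?D \<phi> v \<longleftrightarrow> sat ?D \<phi> (k \<circ> ?w)"
      by (rule sat_cong) (use \<tau> k(2) len in simp)
    also have "\<dots> \<longleftrightarrow> sat ?R \<phi> ?w" using sat_iso[OF k(1) \<phi> w] by simp
    also have "\<dots> \<longleftrightarrow> sat P \<phi> ?w" using R_elem \<phi> w unfolding elem_sub_def by blast
    also have "\<dots> \<longleftrightarrow> holds P (subst \<phi> \<tau>) ys" by (simp add: holds_def sat_subst)
    also have "\<dots> \<longleftrightarrow> holds P (subst \<phi> \<tau>) xs"
    proof (rule iff[symmetric])
      have "fv (subst \<phi> \<tau>) \<subseteq> {..<length xs}" using fv_subst[of \<phi> \<tau>] \<tau> by blast
      then show "fm_in ar (length xs) (subst \<phi> \<tau>)" using wf_subst[OF \<phi>, of \<tau>] \<tau> by (simp add: fm_in_def)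
    qed
    also have "\<dots> \<longleftrightarrow> sat P \<phi> (\<lambda>i. eval_tm P ((!) xs) (\<tau> i))" by (simp add: holds_def sat_subst)
    also have "\<dots> \<longleftrightarrow> sat P \<phi> v"
      by (rule sat_cong) (use \<tau> in simp)
    finally show ?thesis .
  qed
  \<comment> \<open>The passage from elementary substructure to free factor is available in finite
    rank only, so \<open>B\<close> is replaced by a factor \<open>?B'\<close> of finite rank
    containing \<open>xs\<close>.\<close>
  obtain F where F: "finite F" "F \<subseteq> X\<^sub>1" "set xs \<subseteq> cl ar P F" "rank_bound \<le> card F"
    using finite_rank_factor[OF basis_B finite_set xsB] by blast
  let ?B' = "gen ar P F"
  have FP: "F \<subseteq> carr P" using F(2) P(3) by blast
  have B'_basis: "free_on ar V ?B' F" using free_on_subset[OF basis, of F] F(2) by blast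
  have B'_elem: "elem_sub ar ?B' P" using elem_sub_gen[OF basis _ F(1,4)] F(2) by blast
  have DB': "subalg ar ?D ?B'"
    using subalg_gen[OF is_alg_gen F(3)] gen_gen[OF P(2) FP F(3)] by simp
  have "elem_sub ar ?D ?B'"
    unfolding elem_sub_def
  proof (intro conjI DB' allI impI)
    fix \<phi> v assume *: "wf_fm ar \<phi> \<and> v ` fv \<phi> \<subseteq> carr ?D"
    then have "v ` fv \<phi> \<subseteq> carr ?B'" using DB' by (auto simp: subalg_def)
    then show "sat ?D \<phi> v \<longleftrightarrow> sat ?B' \<phi> v" using D_sat * B'_elem unfolding elem_sub_def by blast
  qed
  then have "free_factor ar V ?D ?B'"
    using free_factor_if_elem_sub finite_rank_in_Mod[OF finite_set D cx] finite_rank_in_Mod[OF F(1) B'_basis F(4)] by blast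
  then obtain Z where "free_on ar V ?B' (set xs \<union> Z)" using free_factor_basis D by blast
  moreover have "gen ar B F = ?B'" using gen_B F(2) free_on_carr[OF basis_B] by blast
  ultimately have "free_on ar V B (set xs \<union> Z \<union> (X\<^sub>1 - F))"
    using free_on_replace[OF basis_B F(2)] by simp
  then show ?thesis using that set_xs by blast
qed

text \<open>The basis \<open>Y\<close> may depend on \<open>m\<close>; a single basis containing all
  \<open>a i\<close> emerges only as the union of a chain.\<close>

definition extendable :: "nat \<Rightarrow> 'u set \<Rightarrow> bool" where
  "extendable n E \<longleftrightarrow> finite E \<and> (\<forall>m\<ge>n. \<exists>Y. free_on ar V B Y \<and> a ` {..<m} \<union> E \<subseteq> Y)"

text \<open>One more element \<open>b\<close> is absorbed at the cost of a longer initial segment of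
  \<open>a\<close>. Clause (2) supplies a factor \<open>D\<close> containing \<open>b\<close> and
  algebraic over \<open>b\<close> and the old part, and clause (3) lets the old part be completed by
  \<open>Z1\<close> to a basis of \<open>D\<close>. Then \<open>basis_extension\<close> keeps the
  enlarged set extendable.\<close>

lemma extendable_step:
  assumes ext: "extendable n E" and b: "b \<in> carr B"
  obtains n' E' where "extendable n' E'" "n \<le> n'" "E \<subseteq> E'" "b \<in> cl ar P (a ` {..<n'} \<union> E')"
proof -
  obtain es where es: "set es = E" using ext finite_list[of E] unfolding extendable_def by blast
  define u where "u = es @ [b]"
  have aP: "range a \<subseteq> carr B"
  proof
    fix x assume "x \<in> range a"
    then obtain i where "x = a i" by blast
    then show "x \<in> carr B" using extend_a[of "Suc i"] free_on_carr by blast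
  qed
  have EB: "E \<subseteq> carr B" using ext free_on_carr by (fastforce simp: extendable_def)
  then have u: "set u \<subseteq> carr P" using es b B_carr by (auto simp: u_def)
  have "range a \<union> X\<^sub>2 \<subseteq> carr P" using aP B_carr P(3) by blast
  then obtain A0 where A0: "finite A0" "A0 \<subseteq> range a \<union> X\<^sub>2" "\<not> type_forks ar P u (range a \<union> X\<^sub>2) A0"
    using superstable P_Mod u unfolding superstable_def by blast
  have "finite {i. a i \<in> A0}" using finite_vimageI[OF A0(1) inj_a] by (simp add: vimage_def)
  then obtain k where k: "{i. a i \<in> A0} \<subseteq> {..<k}" using finite_nat_iff_bounded by blast
  \<comment> \<open>Three demands: extendability from \<open>n\<close> on, rank large enough for
    models of \<open>T\<close>, and all \<open>a i\<close> in \<open>A0\<close> having index below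
    \<open>n'\<close>.\<close>
  define n' where "n' = max n (max rank_bound k)"
  have n': "n \<le> n'" "rank_bound \<le> n'" "k \<le> n'" by (auto simp: n'_def)
  have A0': "A0 \<subseteq> a ` {..<n'} \<union> X\<^sub>2"
  proof
    fix x assume x: "x \<in> A0"
    show "x \<in> a ` {..<n'} \<union> X\<^sub>2"
    proof (cases "x \<in> X\<^sub>2")
      case False
      then obtain i where i: "x = a i" using x A0(2) by blast
      then have "i < k" using k x by blast
      then show ?thesis using i n'(3) by auto
    qed simp
  qed
  define R0 where "R0 = a ` {..<n'} \<union> E"
  obtain Y where Y: "free_on ar V B Y" "R0 \<subseteq> Y" using ext n'(1) by (auto simp: extendable_def R0_def)
  have R0: "finite R0" using ext by (simp add: R0_def extendable_def)
  have YP: "Y \<subseteq> carr P" and YX: "free_on ar V P (Y \<union> X\<^sub>2)" using basis_union[OF Y(1)] by auto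
  have "card (a ` {..<n'}) = n'" by (rule card_a)
  then have cR0: "rank_bound \<le> card R0" using card_mono[OF R0, of "a ` {..<n'}"] n'(2) by (auto simp: R0_def)
  obtain F where F: "finite F" "F \<subseteq> Y" "{b} \<subseteq> cl ar P F"
    by (rule finite_rank_factor[OF Y(1), of "{b}"]) (use b that in auto)
  \<comment> \<open>Clauses (2) and (3) concern finite rank, so the argument moves to the factor
    with basis \<open>Y0\<close>, which contains \<open>R0\<close> and \<open>b\<close>.\<close>
  define Y0 where "Y0 = R0 \<union> F"
  have Y0: "finite Y0" "Y0 \<subseteq> Y" "R0 \<subseteq> Y0" using R0 F Y by (auto simp: Y0_def)
  have Y0P: "Y0 \<subseteq> carr P" using Y0 YP by blast
  have cY0: "rank_bound \<le> card Y0" using cR0 card_mono[OF Y0(1,3)] by simp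
  let ?R = "gen ar P R0" and ?B' = "gen ar P Y0"
  have B'_basis: "free_on ar V ?B' Y0" using free_on_subset[OF YX, of Y0] Y0 by blast
  have R_basis: "free_on ar V ?R R0" using free_on_subset[OF YX, of R0] Y by blast
  have B'fin: "?B' \<in> free_algs_fin ar V \<inter> Mod ar T" using finite_rank_in_Mod[OF Y0(1) B'_basis cY0] .
  have Rfin: "?R \<in> free_algs_fin ar V \<inter> Mod ar T" using finite_rank_in_Mod[OF R0 R_basis cR0] .
  have R0B': "R0 \<subseteq> cl ar P Y0" using Y0(3) cl_superset[of Y0 ar P] by blast
  have RB': "free_factor ar V ?R ?B'"
    using free_factor_gen(2)[OF B'_basis Y0(3)] gen_gen[OF P(2) Y0P R0B'] by simp
  have bB': "b \<in> carr ?B'" using F(3) cl_mono[OF P(2) Y0P, of F] by (auto simp: Y0_def)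
  obtain D where D: "smallest_model_factor ar V T ?B' (insert b (carr ?R)) D"
    and D_acl: "carr D \<subseteq> acl ar ?B' (insert b (carr ?R))"
    using behaves Rfin B'fin RB' bB' unfolding behaves_like_free_groups_def by meson
  have DB': "free_factor ar V D ?B'" and RD: "insert b (carr ?R) \<subseteq> carr D"
    using D by (auto simp: smallest_model_factor_def)
  then obtain WD where WD: "free_on ar V D WD" by (auto simp: free_factor_def free_algs_def)
  obtain Z where "free_on ar V ?B' (WD \<union> Z)" using free_factor_basis[OF DB' WD] .
  \<comment> \<open>\<open>D\<close> has finite rank because its basis is part of a basis of
    \<open>?B'\<close>; clause (3) requires this.\<close>
  then have "finite WD" using finite_basis[OF _ B'_basis Y0(1)] by blast
  then have Dfin: "D \<in> free_algs_fin ar V" using WD by (auto simp: free_algs_fin_def free_algs_rank_def)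
  have sDB': "subalg ar D ?B'" using DB' by (auto simp: free_factor_def internal_free_product_def)
  have sRD: "subalg ar ?R D"
    using sDB' RD unfolding subalg_def by auto
  have "free_factor ar V ?R D"
    using behaves Rfin B'fin Dfin sRD sDB' RB' DB' fin_free[of ?B'] unfolding behaves_like_free_groups_def by blast
  then obtain Z1 where Z1: "free_on ar V D (R0 \<union> Z1)" using free_factor_basis R_basis by blast
  obtain Z2 where Z2: "free_on ar V ?B' (R0 \<union> Z1 \<union> Z2)" using free_factor_basis[OF DB' Z1] .
  have finZ1: "finite Z1" using finite_basis[OF Z2 B'_basis Y0(1)] by blast
  define E' where "E' = E \<union> Z1"
  have Y0B: "Y0 \<subseteq> carr B" using Y0(2) free_on_carr[OF Y(1)] by blast
  have Y': "free_on ar V B (R0 \<union> Z1 \<union> Z2 \<union> (Y - Y0))"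
    using free_on_replace[OF Y(1) Y0(2)] Z2 gen_B[OF Y0B] by simp
  \<comment> \<open>Elements of the initial segment are left out, since
    \<open>basis_extension\<close> wants \<open>e\<close> disjoint from it.\<close>
  obtain e where e: "set e = E' - a ` {..<n'}" "distinct e"
    using finite_distinct_list[of "E' - a ` {..<n'}"] finZ1 ext by (auto simp: E'_def extendable_def)
  have sB'P: "elem_sub ar ?B' P" using elem_sub_gen[OF YX _ Y0(1) cY0] Y0(2) by blast
  have D_eq: "carr D = cl ar P (R0 \<union> Z1)"
  proof -
    have "R0 \<union> Z1 \<subseteq> carr D" using free_on_carr[OF Z1] .
    moreover have "subalg ar D P" using subalg_trans[OF sDB' subalg_gen[OF P(2) Y0P]] .
    ultimately show ?thesis using cl_subalg free_on_cl[OF Z1] by metis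
  qed
  have "set e \<subseteq> carr D"
    using e(1) D_eq cl_superset[of "R0 \<union> Z1" ar P] by (auto simp: E'_def R0_def)
  moreover have "insert b (carr ?R) \<subseteq> carr ?B'"
    using bB' RB' by (auto simp: free_factor_def internal_free_product_def subalg_def)
  \<comment> \<open>Clause (2) gives algebraicity inside \<open>?B'\<close>; it passes to
    \<open>P\<close> because \<open>?B'\<close> is elementary in \<open>P\<close>.\<close>
  ultimately have "set e \<subseteq> acl ar P (insert b (carr ?R))"
    using D_acl acl_elem_sub[OF sB'P] by blast
  moreover have "insert b (carr ?R) \<subseteq> cl ar P (set u \<union> a ` {..<n'})"
  proof -
    have sub: "R0 \<subseteq> set u \<union> a ` {..<n'}" using es by (auto simp: u_def R0_def)
    have "set u \<union> a ` {..<n'} \<subseteq> carr P" using u aP B_carr by blast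
    then have "carr ?R \<subseteq> cl ar P (set u \<union> a ` {..<n'})" using cl_mono[OF P(2) _ sub] by blast
    moreover have "b \<in> cl ar P (set u \<union> a ` {..<n'})"
      using cl_superset[of "set u \<union> a ` {..<n'}" ar P] by (auto simp: u_def)
    ultimately show ?thesis by blast
  qed
  ultimately have alg: "set e \<subseteq> acl ar P (cl ar P (set u \<union> a ` {..<n'}))"
    using acl_mono by (metis subset_trans)
  have eY': "a ` {..<n'} \<union> set e \<subseteq> R0 \<union> Z1 \<union> Z2 \<union> (Y - Y0)" using e(1) by (auto simp: R0_def E'_def)
  have "\<exists>Z. free_on ar V B Z \<and> a ` {..<m} \<union> E' \<subseteq> Z" if m: "n' \<le> m" for m
  proof -
    obtain Ym where Ym: "a ` {..<m} \<subseteq> Ym" "free_on ar V B Ym" using extend_a[of m] by blast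
    have mm: "rank_bound \<le> m" "set e \<inter> a ` {..<n'} = {}" using m n'(2) e(1) by auto
    obtain Z where Z: "free_on ar V B Z" "a ` {..<m} \<union> set e \<subseteq> Z"
      by (rule basis_extension[OF Ym(2,1) Y' eY' m mm(1) e(2) mm(2) u A0(1) A0' A0(3) alg]) (rule that)
    have "a ` {..<n'} \<subseteq> a ` {..<m}" using m by (intro image_mono) auto
    moreover have "E' \<subseteq> set e \<union> a ` {..<n'}" unfolding e(1) by auto
    ultimately have "E' \<subseteq> set e \<union> a ` {..<m}" by (meson Un_mono order_refl subset_trans)
    then have "a ` {..<m} \<union> E' \<subseteq> Z" using Z(2) by (meson Un_least Un_subset_iff subset_trans)
    then show ?thesis using Z(1) by (intro exI conjI)
  qed
  moreover have "finite E'" using finZ1 ext by (simp add: E'_def extendable_def)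
  ultimately have "extendable n' E'" by (simp add: extendable_def)
  moreover have "b \<in> cl ar P (a ` {..<n'} \<union> E')"
    using RD D_eq by (simp add: R0_def E'_def Un_assoc)
  ultimately show ?thesis using that n'(1) by (auto simp: E'_def)
qed

text \<open>The step is iterated along an enumeration of the countable algebra \<open>B\<close>. The
  resulting finite sets form a chain of parts of bases that generates \<open>B\<close>, so
  \<open>free_on_chain\<close> applies.\<close>

lemma basis_containing_range:
  obtains Y where "free_on ar V B Y" "range a \<subseteq> Y"
proof -
  define b where "b = from_nat_into (carr B)"
  have ne: "carr B \<noteq> {}" using infinite(1) free_on_carr[OF basis_B] by auto
  have cB: "countable (carr B)" using countable B_carr countable_subset by blast
  have b: "range b = carr B" unfolding b_def using range_from_nat_into[OF ne cB] .
  have "\<exists>f. \<forall>i. extendable (fst (f i)) (snd (f i)) \<and> fst (f i) < fst (f (Suc i)) \<and> snd (f i) \<subseteq> snd (f (Suc i)) \<and>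
     b i \<in> cl ar P (a ` {..<fst (f (Suc i))} \<union> snd (f (Suc i)))"
  proof (rule dependent_nat_choice)
    have "\<exists>Y. free_on ar V B Y \<and> a ` {..<m} \<union> {} \<subseteq> Y" for m using extend_a[of m] by auto
    then show "\<exists>x. extendable (fst x) (snd x)" by (intro exI[of _ "(0, {})"]) (simp add: extendable_def)
    fix x :: "nat \<times> 'u set" and i assume *: "extendable (fst x) (snd x)"
    \<comment> \<open>Passing to the successor makes the lengths strictly increasing, so that every
      \<open>a j\<close> is reached.\<close>
    have "extendable (Suc (fst x)) (snd x)" using * by (auto simp: extendable_def)
    then obtain n' E' where "extendable n' E'" "Suc (fst x) \<le> n'" "snd x \<subseteq> E'" "b i \<in> cl ar P (a ` {..<n'} \<union> E')"
      using extendable_step[of "Suc (fst x)" "snd x" "b i"] b by blast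
    then show "\<exists>y. extendable (fst y) (snd y) \<and> fst x < fst y \<and> snd x \<subseteq> snd y \<and> b i \<in> cl ar P (a ` {..<fst y} \<union> snd y)"
      by (intro exI[of _ "(n', E')"]) auto
  qed
  then obtain f where f: "\<forall>i. extendable (fst (f i)) (snd (f i)) \<and> fst (f i) < fst (f (Suc i)) \<and> snd (f i) \<subseteq> snd (f (Suc i)) \<and>
     b i \<in> cl ar P (a ` {..<fst (f (Suc i))} \<union> snd (f (Suc i)))"
    by (elim exE)
  define n where "n i = fst (f i)" for i
  define E where "E i = snd (f i)" for i
  have ext: "extendable (n i) (E i)" and step: "n i < n (Suc i)" "E i \<subseteq> E (Suc i)" "b i \<in> cl ar P (a ` {..<n (Suc i)} \<union> E (Suc i))" for i
    using f by (simp_all add: n_def E_def)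
  define G where "G i = a ` {..<n i} \<union> E i" for i
  have "mono G"
    unfolding mono_iff_le_Suc G_def
  proof
    fix i
    have "a ` {..<n i} \<subseteq> a ` {..<n (Suc i)}" using step(1)[of i] by (intro image_mono) auto
    then show "a ` {..<n i} \<union> E i \<subseteq> a ` {..<n (Suc i)} \<union> E (Suc i)" using step(2)[of i] by blast
  qed
  moreover have G: "G i \<subseteq> carr B" "free_on ar V (gen ar B (G i)) (G i)" for i
  proof -
    obtain Y where Y: "free_on ar V B Y" "G i \<subseteq> Y" using ext[of i] by (auto simp: extendable_def G_def)
    then show "G i \<subseteq> carr B" "free_on ar V (gen ar B (G i)) (G i)"
      using free_on_carr free_on_subset by blast+
  qed
  moreover have "carr B \<subseteq> (\<Union>i. cl ar B (G i))"
  proof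
    fix x assume "x \<in> carr B"
    then obtain i where "x = b i" using b by blast
    then show "x \<in> (\<Union>i. cl ar B (G i))" using step(3)[of i] gen_B[OF G(1)] by (auto simp: G_def)
  qed
  ultimately have "free_on ar V B (\<Union>i. G i)"
    using free_on_chain[OF free_on_V[OF basis_B]] by blast
  moreover have "range a \<subseteq> (\<Union>i. G i)"
  proof
    fix x assume "x \<in> range a"
    then obtain j where j: "x = a j" by blast
    have "strict_mono n" using step(1) by (simp add: strict_mono_Suc_iff)
    then have "j < n (Suc j)" using strict_mono_imp_increasing[of n "Suc j"] by simp
    then show "x \<in> (\<Union>i. G i)" using j by (auto simp: G_def)
  qed
  ultimately show ?thesis using that by blast
qed

end

theorem corollary1p14:
  fixes ar :: "'f lang" and V :: "('f, 'u) alg set" and T :: "'f fm set"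
  assumes "countable (dom ar)"
    and "variety ar V"
    and "CP ar V"
    and "T = Th ar (free_algs_inf ar V)"
    and "behaves_like_free_groups ar V T"
  shows "\<not> superstable TYPE('u) ar T"
proof
  assume ss: "superstable TYPE('u) ar T"
  interpret variety_of_algebras ar V by unfold_locales fact
  \<comment> \<open>The larger algebra of (CP) is named \<open>P\<close>. It serves as the free
    product too, and an isomorphic copy of it inside itself becomes the \<open>B\<close> of the
    setting.\<close>
  obtain A P a\<^sub>0 where Pinf: "P \<in> free_algs_inf ar V" and cP: "countable (carr P)" 
    and AP: "subalg ar A P"
    and a0: "inj a\<^sub>0" "free_on ar V A (range a\<^sub>0)" "\<And>i :: nat. free_factor ar V (gen ar P (a\<^sub>0 ` {..i})) P"
    and no: "\<And>C Q i j. C \<in> free_algs ar V \<Longrightarrow> coproduct ar V P C Q i j \<Longrightarrow>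
        \<not> free_factor ar V (Q\<lparr>carr := i ` carr A\<rparr>) Q"
    using assms(3) unfolding CP_def by blast
  obtain X where X: "infinite X" "free_on ar V P X" using Pinf by (auto simp: free_algs_inf_def)
  have PV: "P \<in> V" "is_alg ar P" "X \<subseteq> carr P" using X(2) free_on_V free_on_alg free_on_carr by blast+
  have cX: "countable X" using PV(3) cP countable_subset by blast
  \<comment> \<open>The even and odd members of an enumeration split the basis into two infinite
    halves.\<close>
  let ?f = "from_nat_into X"
  have f: "bij_betw ?f UNIV X" using bij_betw_from_nat_into[OF cX X(1)] .
  define X1 where "X1 = ?f ` {n. even n}"
  define X2 where "X2 = ?f ` {n. odd n}"
  have injf: "inj ?f" using f by (simp add: bij_betw_def)
  have "{n :: nat. even n} \<union> {n. odd n} = UNIV" by auto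
  then have X12: "X1 \<union> X2 = X"
    unfolding X1_def X2_def image_Un[symmetric] using f by (simp add: bij_betw_def)
  have disj: "X1 \<inter> X2 = {}" unfolding X1_def X2_def using injf by (auto simp: inj_eq)
  have "infinite (range (\<lambda>n :: nat. 2 * n))" "infinite (range (\<lambda>n :: nat. 2 * n + 1))"
    by (intro range_inj_infinite injI, simp)+
  moreover have "range (\<lambda>n :: nat. 2 * n) \<subseteq> {n. even n}" "range (\<lambda>n :: nat. 2 * n + 1) \<subseteq> {n. odd n}" by auto
  ultimately have "infinite {n :: nat. even n}" "infinite {n :: nat. odd n}"
    using finite_subset by blast+
  then have inf: "infinite X1" "infinite X2"
    unfolding X1_def X2_def using injf finite_imageD inj_on_subset[OF injf subset_UNIV] by blast+
  have X1X: "X1 \<subseteq> X" using X12 by blast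
  have fX1: "free_on ar V (gen ar P X1) X1" using free_on_subset[OF X(2) X1X] .
  have X1P: "X1 \<subseteq> carr P" using X1X PV by blast
  have cX1: "countable X1" using cX X1X countable_subset by blast
  obtain g where g: "bij_betw g X X1"
    by (rule extend_bij_betw[OF cX X(1) cX1 inf(1), of "{}" id "{}"]) (use that in auto)
  \<comment> \<open>\<open>i\<close> maps \<open>P\<close> onto the subalgebra generated by
    \<open>X1\<close>; under it \<open>a\<^sub>0\<close> becomes the sequence
    \<open>a\<close>.\<close>
  obtain i where i: "iso ar P (gen ar P X1) i"
    by (rule free_on_iso_extend[OF X(2) fX1 g]) (rule that)
  have i': "hom ar P (gen ar P X1) i" "inj_on i (carr P)" using i by (auto simp: iso_def bij_betw_def)
  have A_alg: "is_alg ar A" "carr A \<subseteq> carr P" using AP by (auto simp: subalg_def)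
  have a0A: "range a\<^sub>0 \<subseteq> carr A" using free_on_carr[OF a0(2)] .
  define a where "a = i \<circ> a\<^sub>0"
  interpret cp_setting ar V T P X1 X2 a
  proof unfold_locales
    show "inj a" unfolding a_def
      using a0(1) inj_on_subset[OF i'(2), of "range a\<^sub>0"] a0A A_alg(2) by (intro comp_inj_on) auto
    show "\<exists>Y. a ` {..<m} \<subseteq> Y \<and> free_on ar V (gen ar P X1) Y" for m
    proof -
      let ?S = "a\<^sub>0 ` {..m}"
      have S: "?S \<subseteq> range a\<^sub>0" "?S \<subseteq> carr A" using a0A by auto
      have cl: "cl ar A ?S = cl ar P ?S" using cl_subalg[OF AP S(2)] .
      \<comment> \<open>The records \<open>gen ar A ?S\<close> and \<open>gen ar P ?S\<close> may
        differ in their operations outside the common carrier, so freeness is carried over along the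
        identity as an isomorphism.\<close>
      have "hom ar (gen ar A ?S) (gen ar P ?S) id"
        using AP cl cl_subset[OF A_alg(1) S(2)] unfolding hom_def subalg_def by auto
      then have "iso ar (gen ar A ?S) (gen ar P ?S) id" using cl by (simp add: iso_def bij_betw_def)
      moreover have "gen ar P ?S \<in> V" using gen_in[OF PV(1)] S(2) A_alg(2) by blast
      ultimately have "free_on ar V (gen ar P ?S) ?S"
        using free_on_iso[OF free_on_subset[OF a0(2) S(1)]] by fastforce
      then obtain Y where "free_on ar V P (?S \<union> Y)" using free_factor_basis[OF a0(3)] by blast
      then have "free_on ar V (gen ar P X1) (i ` (?S \<union> Y))"
        using free_on_iso[OF _ i free_on_V[OF fX1]] by blast
      moreover have "a ` {..<m} \<subseteq> i ` (?S \<union> Y)" by (auto simp: a_def)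
      ultimately show ?thesis by blast
    qed
  qed (use assms ss X(2) X12 disj inf cP in auto)
  obtain Y where Y: "free_on ar V B Y" "range a \<subseteq> Y" by (rule basis_containing_range)
  have ff: "free_factor ar V (gen ar P (range a)) P"
    using free_factor_gen(2)[OF basis_union(1)[OF Y(1)]] Y(2) by blast
  have "carr A = cl ar P (range a\<^sub>0)" using free_on_cl[OF a0(2)] cl_subalg[OF AP a0A] by simp
  moreover have "i ` cl ar P (range a\<^sub>0) = cl ar B (i ` range a\<^sub>0)"
    by (rule hom_image_cl[OF i'(1) PV(2) is_alg_gen]) (use a0A A_alg(2) in blast)
  moreover have "i ` range a\<^sub>0 = range a" by (auto simp: a_def)
  moreover have "range a \<subseteq> carr B" using Y free_on_carr by blast
  ultimately have "i ` carr A = cl ar P (range a)" using gen_B by simp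
  \<comment> \<open>This is the copy of \<open>A\<close> named in clause (b) of (CP), so
    \<open>ff\<close> is the statement that the clause forbids.\<close>
  then have eq: "P\<lparr>carr := i ` carr A\<rparr> = gen ar P (range a)" by (simp add: gen_def)
  have C: "X1 \<union> X2 - X1 = X2" using disj by blast
  have "coproduct ar V B (gen ar P X2) P id id"
    using free_factor_gen(1)[OF basis, of X1] C by simp
  \<comment> \<open>Composing with \<open>i\<close> makes \<open>P\<close> the free product of the
    original algebra of (CP) and \<open>gen ar P X2\<close>, with \<open>i\<close> as the canonical
    map of the left factor.\<close>
  from coproduct_iso[OF this i PV(1)] have "coproduct ar V P (gen ar P X2) P i id" by simp
  moreover have "gen ar P X2 \<in> free_algs ar V"
    using free_on_subset[OF basis, of X2] by (auto simp: free_algs_def)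
  ultimately show False using no ff eq by metis
qed

end
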